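(* Assume that at least one of the following conditions is valid. (1) For any subinterval $\widetilde{Q}\subseteq Q$ the estimate $$\|\mathcal{L}_\varepsilon u\|_{L_2(\widetilde{Q})}\leq C\|u\|_{W_2^2(\widetilde{Q})}$$ holds true (for all $u\in W_2^2(Q)$) with the constant $C$ independent of $\varepsilon$ and $\widetilde{Q}$. (2) The operator $\mathcal{L}_\varepsilon$ can be represented as $$\mathcal{L}_\varepsilon=\frac{d}{dx}a_\varepsilon\frac{d}{dx}+\widetilde{\mathcal{L}}_\varepsilon,$$ where $a_\varepsilon$ is a piecewise continuously differentiable function having support inside $\overline{Q}$ and satisfying $\varepsilon\max_{\overline{Q}}|a_\varepsilon'(x)|\to 0$ as $\varepsilon\to0$, and $\widetilde{\mathcal{L}}_\varepsilon:W_2^1(Q)\to L_2(Q)$ is a linear operator bounded uniformly in $\varepsilon$. Then for all sufficiently small $\varepsilon>0$ the continuous spectrum $\sigma_c(\mathcal{H}_\varepsilon)$ contains no embedded eigenvalues, i.e. no point of $\sigma_c(\mathcal{H}_\varepsilon)$ is an eigenvalue of $\mathcal{H}_\varepsilon$.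
   Context: Let $p,q:\mathbb{R}\to\mathbb{R}$ be $1$-periodic, $p$ piecewise continuously differentiable, $q$ piecewise continuous, $p(x)\geq p_0>0$ for all $x$, and $p(0)=1$. "Piecewise continuously differentiable" means continuous with piecewise continuous derivative; for $a_\varepsilon$ this is understood on the whole axis, with $a_\varepsilon$ vanishing outside $\overline{Q}$. Let $\mathcal{H}_0:=-\frac{d}{dx}p\frac{d}{dx}+q$ be the self-adjoint operator in $L_2(\mathbb{R})$ with domain $W_2^2(\mathbb{R})$. Let $Q\subset\mathbb{R}$ be a fixed bounded open interval. For each small $\varepsilon>0$ let $\mathcal{L}_\varepsilon:W_2^2(Q)\to L_2(Q)$ be a linear operator (no self-adjointness is assumed), bounded uniformly in $\varepsilon$ (operator norms bounded by a constant independent of $\varepsilon$). Denote also by $\mathcal{L}_\varepsilon$ the operator $W_{2,loc}^2(\mathbb{R})\to L_2(\mathbb{R})$ that restricts a function to $Q$, applies $\mathcal{L}_\varepsilon$, and extends the result by zero outside $Q$. Set $\mathcal{H}_\varepsilon:=\mathcal{H}_0-\varepsilon\mathcal{L}_\varepsilon$, an operator in $L_2(\mathbb{R})$ with domain $W_2^2(\mathbb{R})$. For a closed operator $A$, $\sigma_c(A)$ is the continuous spectrum in the sense of Glazman: the set of $\lambda\in\mathbb{C}$ for which there is a bounded sequence $u_n$ in the domain of $A$ having no convergent subsequence, with $(A-\lambda)u_n\to 0$. (It may contain eigenvalues; these are called embedded.) *)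

theory Defs
  imports "HOL-Analysis.Analysis"
begin

text \<open>
  Elements of Lebesgue and Sobolev spaces are represented by Borel measurable functions
  \<open>real \<Rightarrow> complex\<close>, of which only the values on the open set \<open>S\<close> in question matter;
  equality in these spaces is equality almost everywhere on \<open>S\<close>.
\<close>

definition L2 :: "real set \<Rightarrow> (real \<Rightarrow> complex) set" where
  "L2 S = {u. set_borel_measurable lborel S u \<and> set_integrable lborel S (\<lambda>x. (cmod (u x))\<^sup>2)}"

definition L2_norm :: "real set \<Rightarrow> (real \<Rightarrow> complex) \<Rightarrow> real" where
  "L2_norm S u = sqrt (LINT x:S|lborel. (cmod (u x))\<^sup>2)"

definition test_fun :: "real set \<Rightarrow> (real \<Rightarrow> real) \<Rightarrow> bool" where
  "test_fun S \<phi> \<longleftrightarrow> (\<forall>n x. (deriv ^^ n) \<phi> differentiable (at x)) \<and>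
     compact (closure {x. \<phi> x \<noteq> 0}) \<and> closure {x. \<phi> x \<noteq> 0} \<subseteq> S"

definition loc_integrable :: "real set \<Rightarrow> (real \<Rightarrow> complex) \<Rightarrow> bool" where
  "loc_integrable S u \<longleftrightarrow> (\<forall>K. compact K \<and> K \<subseteq> S \<longrightarrow> set_integrable lborel K u)"

definition has_weak_deriv :: "real set \<Rightarrow> (real \<Rightarrow> complex) \<Rightarrow> (real \<Rightarrow> complex) \<Rightarrow> bool" where
  "has_weak_deriv S u v \<longleftrightarrow> loc_integrable S u \<and> loc_integrable S v \<and>
     (\<forall>\<phi>. test_fun S \<phi> \<longrightarrow>
        (LINT x:S|lborel. deriv \<phi> x *\<^sub>R u x) = - (LINT x:S|lborel. \<phi> x *\<^sub>R v x))"

text \<open>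
  A weak derivative is unique only up to equality almost everywhere, so the function
  \<open>wderiv S u\<close> is an arbitrary representative; it is meaningful only if \<open>u\<close> has a weak derivative.
\<close>

definition wderiv :: "real set \<Rightarrow> (real \<Rightarrow> complex) \<Rightarrow> (real \<Rightarrow> complex)" where
  "wderiv S u = (SOME v. has_weak_deriv S u v)"

text \<open>The Sobolev space \<open>W\<^sub>2\<^sup>k(S)\<close> and its norm.\<close>

primrec W2 :: "nat \<Rightarrow> real set \<Rightarrow> (real \<Rightarrow> complex) set" where
  "W2 0 S = L2 S"
| "W2 (Suc k) S = {u \<in> L2 S. \<exists>v \<in> W2 k S. has_weak_deriv S u v}"

definition W2_norm :: "nat \<Rightarrow> real set \<Rightarrow> (real \<Rightarrow> complex) \<Rightarrow> real" where
  "W2_norm k S u = sqrt (\<Sum>j\<le>k. (L2_norm S ((wderiv S ^^ j) u))\<^sup>2)"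

text \<open>
  A linear operator from \<open>W\<^sub>2\<^sup>k(S)\<close> to \<open>L\<^sub>2(S)\<close>.  Together with the norm bound below, linearity almost
  everywhere makes the operator compatible with equality almost everywhere on \<open>S\<close>.
\<close>

definition linear_op :: "nat \<Rightarrow> real set \<Rightarrow> ((real \<Rightarrow> complex) \<Rightarrow> (real \<Rightarrow> complex)) \<Rightarrow> bool" where
  "linear_op k S T \<longleftrightarrow> (\<forall>u \<in> W2 k S. T u \<in> L2 S) \<and>
     (\<forall>u \<in> W2 k S. \<forall>v \<in> W2 k S. \<forall>c d.
        AE x in lborel. x \<in> S \<longrightarrow> T (\<lambda>y. c * u y + d * v y) x = c * T u x + d * T v x)"

definition unif_bounded_ops ::
  "nat \<Rightarrow> real set \<Rightarrow> real set \<Rightarrow> (real \<Rightarrow> (real \<Rightarrow> complex) \<Rightarrow> (real \<Rightarrow> complex)) \<Rightarrow> bool" where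
  "unif_bounded_ops k S E T \<longleftrightarrow> (\<forall>\<epsilon>\<in>E. linear_op k S (T \<epsilon>)) \<and>
     (\<exists>M. \<forall>\<epsilon>\<in>E. \<forall>u \<in> W2 k S. L2_norm S (T \<epsilon> u) \<le> M * W2_norm k S u)"

definition locally_finite_set :: "real set \<Rightarrow> bool" where
  "locally_finite_set B \<longleftrightarrow> (\<forall>a b. finite (B \<inter> {a..b}))"

definition piecewise_cont :: "(real \<Rightarrow> real) \<Rightarrow> bool" where
  "piecewise_cont f \<longleftrightarrow> (\<exists>B. locally_finite_set B \<and> (\<forall>x. x \<notin> B \<longrightarrow> isCont f x) \<and>
     (\<forall>x\<in>B. (\<exists>l. (f \<longlongrightarrow> l) (at_left x)) \<and> (\<exists>l. (f \<longlongrightarrow> l) (at_right x))))"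

definition piecewise_cont_diff :: "(real \<Rightarrow> real) \<Rightarrow> bool" where
  "piecewise_cont_diff f \<longleftrightarrow> continuous_on UNIV f \<and>
     (\<exists>B g. locally_finite_set B \<and> piecewise_cont g \<and>
        (\<forall>x. x \<notin> B \<longrightarrow> (f has_real_derivative g x) (at x)))"

definition max_abs_deriv :: "real set \<Rightarrow> (real \<Rightarrow> real) \<Rightarrow> real" where
  "max_abs_deriv S a = (SUP x \<in> {x \<in> S. a differentiable (at x)}. \<bar>deriv a x\<bar>)"

definition zero_ext :: "real set \<Rightarrow> (real \<Rightarrow> complex) \<Rightarrow> (real \<Rightarrow> complex)" where
  "zero_ext S u = (\<lambda>x. if x \<in> S then u x else 0)"

text \<open>The operator \<open>d/dx a d/dx\<close> on \<open>S\<close>.\<close>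

definition div_op :: "real set \<Rightarrow> (real \<Rightarrow> real) \<Rightarrow> (real \<Rightarrow> complex) \<Rightarrow> (real \<Rightarrow> complex)" where
  "div_op S a u = wderiv S (\<lambda>x. of_real (a x) * wderiv S u x)"

definition H0 :: "(real \<Rightarrow> real) \<Rightarrow> (real \<Rightarrow> real) \<Rightarrow> (real \<Rightarrow> complex) \<Rightarrow> (real \<Rightarrow> complex)" where
  "H0 p q u = (\<lambda>x. - div_op UNIV p u x + of_real (q x) * u x)"

text \<open>
  The perturbed operator \<open>H\<^sub>0 - \<epsilon> T\<close>, where \<open>T\<close> acts on functions on \<open>Q\<close>:
  its argument is restricted to \<open>Q\<close> (the values outside are irrelevant and are set to 0),
  and its result is extended by zero.
\<close>

definition H_pert ::
  "(real \<Rightarrow> real) \<Rightarrow> (real \<Rightarrow> real) \<Rightarrow> real set \<Rightarrow> real \<Rightarrow>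
     ((real \<Rightarrow> complex) \<Rightarrow> (real \<Rightarrow> complex)) \<Rightarrow> (real \<Rightarrow> complex) \<Rightarrow> (real \<Rightarrow> complex)" where
  "H_pert p q Q \<epsilon> T u = (\<lambda>x. H0 p q u x - of_real \<epsilon> * zero_ext Q (T (zero_ext Q u)) x)"

text \<open>Eigenvalues and Glazman's continuous spectrum of an operator \<open>A\<close> in \<open>L\<^sub>2(\<real>)\<close> with domain \<open>D\<close>.\<close>

definition is_eigenvalue ::
  "(real \<Rightarrow> complex) set \<Rightarrow> ((real \<Rightarrow> complex) \<Rightarrow> (real \<Rightarrow> complex)) \<Rightarrow> complex \<Rightarrow> bool" where
  "is_eigenvalue D A \<mu> \<longleftrightarrow>
     (\<exists>u \<in> D. \<not> (AE x in lborel. u x = 0) \<and> (AE x in lborel. A u x = \<mu> * u x))"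

definition cont_spectrum ::
  "(real \<Rightarrow> complex) set \<Rightarrow> ((real \<Rightarrow> complex) \<Rightarrow> (real \<Rightarrow> complex)) \<Rightarrow> complex set" where
  "cont_spectrum D A = {\<mu>. \<exists>u :: nat \<Rightarrow> real \<Rightarrow> complex.
     (\<forall>n. u n \<in> D) \<and>
     (\<exists>M. \<forall>n. L2_norm UNIV (u n) \<le> M) \<and>
     \<not> (\<exists>r g. strict_mono r \<and> g \<in> L2 UNIV \<and>
           (\<lambda>n. L2_norm UNIV (\<lambda>x. u (r n) x - g x)) \<longlonglongrightarrow> 0) \<and>
     (\<lambda>n. L2_norm UNIV (\<lambda>x. A (u n) x - \<mu> * u n x)) \<longlonglongrightarrow> 0}"

end

theory Submission
  imports Defs "HOL-Complex_Analysis.Great_Picard"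
begin

text \<open>
  A function of \<open>W\<^sub>2\<^sup>2(\<real>)\<close> has a representative \<open>U\<close> for which \<open>U\<close> and the flux \<open>V = p U'\<close> are primitives of
  locally integrable functions. The eigenvalue equation becomes the system \<open>U' = V / p\<close>,
  \<open>V' = (q - \<mu>) U - f\<close>, in which only the source \<open>f\<close> sees the perturbation, and \<open>f\<close> vanishes outside \<open>Q\<close>.

  The first half of the argument shows that an eigenfunction belonging to a point \<open>\<mu>\<close> of the continuous
  spectrum vanishes outside \<open>Q\<close>. If it does not vanish on one of the two half-lines, it is a
  square-integrable solution of the periodic equation there. The Wronskian of this solution and its
  translate by a period is constant and tends to 0, so a shift by one period multiplies the Cauchy data by
  a number \<open>\<rho>\<close> with \<open>|\<rho>| \<noteq> 1\<close> (\<open>half_line_decay\<close>). Such a multiplier is hyperbolic: the values of any \<open>u\<close> and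
  its flux at consecutive periods obey two scalar recurrences with factors \<open>\<rho>\<close> and \<open>1 / \<rho>\<close>, and each of
  them can be solved stably in \<open>l\<^sup>2(\<int>)\<close>. Hence the \<open>L\<^sub>2\<close> norm of \<open>u\<close> is controlled by \<open>(H\<^sub>\<epsilon> - \<mu>) u\<close> outside \<open>Q\<close> and
  by \<open>u\<close> in the finitely many period cells that meet \<open>Q\<close> (\<open>dichotomy_estimate\<close>). For a bounded sequence with
  \<open>(H\<^sub>\<epsilon> - \<mu>) u\<^sub>n \<rightarrow> 0\<close> the smallness of \<open>\<epsilon>\<close> gives bounds on derivatives, and the Arzela-Ascoli theorem gives
  convergence in these cells; so a subsequence converges in \<open>L\<^sub>2(\<real>)\<close>, and \<open>\<mu>\<close> is not in the continuous spectrum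
  (\<open>cont_spectrum_imp_no_hyperbolic_multiplier\<close>).

  The second half shows that a solution with zero Cauchy data at both ends of \<open>Q\<close> vanishes in \<open>Q\<close>, for \<open>\<epsilon>\<close>
  small independently of \<open>\<mu>\<close>. If the perturbation is bounded on every subinterval, its second-order part is
  absorbed on each initial segment of \<open>Q\<close> and Gronwall's inequality applies; the step of that inequality depends
  on \<open>\<mu>\<close>, the condition on \<open>\<epsilon>\<close> does not (\<open>eigenfunction_zero_of_local_bound\<close>). If the perturbation is in divergence
  form up to a first-order operator, it may be non-local and Gronwall's inequality alone is of no use. Instead the
  divergence part is added to \<open>p\<close>, and the first-order Sobolev norm of the solution is bounded by the \<open>L\<^sub>2\<close> norm of
  the source with a constant that does not depend on \<open>\<mu>\<close>: for large real \<open>\<mu>\<close> the energy \<open>|V|\<^sup>2 + \<mu> P |U|\<^sup>2\<close> is almost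
  conserved, for \<open>\<mu>\<close> far to the left the quadratic form is coercive, and imaginary parts of \<open>\<mu>\<close> are of the order of
  \<open>\<epsilon>\<close> (\<open>first_order_perturbation_imp_zero\<close>). Since the source is \<open>\<epsilon>\<close> times a function bounded by the same norm, the
  solution is 0.

  Weak derivatives enter only through the lemma of du Bois-Reymond (\<open>weak_deriv_imp_antideriv\<close>), which identifies them
  with densities of primitives.
\<close>

section \<open>Primitives of locally integrable functions\<close>

text \<open>
  Absolutely continuous functions appear as primitives of locally integrable densities. The
  two-point form needs no base point, passes to subintervals, and sees the density only up to null sets.
\<close>

definition antideriv :: "real set \<Rightarrow> (real \<Rightarrow> complex) \<Rightarrow> (real \<Rightarrow> complex) \<Rightarrow> bool" where
  "antideriv S F f \<longleftrightarrow> (\<forall>x\<in>S. \<forall>y\<in>S. x \<le> y \<longrightarrow>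
     set_integrable lborel {x..y} f \<and> F y - F x = (LINT t:{x..y}|lborel. f t))"

lemma interval_Icc_subset: "is_interval (S :: real set) \<Longrightarrow> x \<in> S \<Longrightarrow> y \<in> S \<Longrightarrow> {x..y} \<subseteq> S"
  by (meson atLeastAtMost_iff mem_is_interval_1_I subsetI)

lemma antideriv_subset: "antideriv S F f \<Longrightarrow> T \<subseteq> S \<Longrightarrow> antideriv T F f"
  unfolding antideriv_def by blast

lemma antideriv_integrable: "antideriv S F f \<Longrightarrow> x \<in> S \<Longrightarrow> y \<in> S \<Longrightarrow> set_integrable lborel {x..y} f"
  unfolding antideriv_def by (cases "x \<le> y") auto

lemma antideriv_diff_eq:
  "antideriv S F f \<Longrightarrow> x \<in> S \<Longrightarrow> y \<in> S \<Longrightarrow> x \<le> y \<Longrightarrow> F y - F x = (LINT t:{x..y}|lborel. f t)"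
  unfolding antideriv_def by blast

lemma antideriv_add:
  "antideriv S F f \<Longrightarrow> antideriv S G g \<Longrightarrow> antideriv S (\<lambda>x. F x + G x) (\<lambda>x. f x + g x)"
  unfolding antideriv_def by (simp add: set_integral_add add_diff_add)

lemma antideriv_cmult: "antideriv S F f \<Longrightarrow> antideriv S (\<lambda>x. c * F x) (\<lambda>x. c * f x)"
  unfolding antideriv_def by (simp flip: right_diff_distrib)

lemma antideriv_diff:
  "antideriv S F f \<Longrightarrow> antideriv S G g \<Longrightarrow> antideriv S (\<lambda>x. F x - G x) (\<lambda>x. f x - g x)"
  using antideriv_add[of S F f "\<lambda>x. -1 * G x" "\<lambda>x. -1 * g x"] antideriv_cmult[of S G g "-1"] by simp

lemma antideriv_cnj: "antideriv S F f \<Longrightarrow> antideriv S (\<lambda>x. cnj (F x)) (\<lambda>x. cnj (f x))"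
proof -
  assume A: "antideriv S F f"
  have i: "set_integrable lborel A (\<lambda>x. cnj (f x))" if "set_integrable lborel A f" for A
    using integrable_cnj[OF that[unfolded set_integrable_def]] by (simp add: set_integrable_def)
  have e: "(LINT t:A|lborel. cnj (f t)) = cnj (LINT t:A|lborel. f t)" for A
    unfolding set_lebesgue_integral_def by (subst Bochner_Integration.integral_cnj[symmetric]) simp
  show ?thesis using A unfolding antideriv_def by (simp add: i e flip: complex_cnj_diff)
qed

lemma antideriv_cong_AE:
  assumes A: "antideriv S F f" and S: "is_interval S"
    and m: "set_borel_measurable lborel S g" "S \<in> sets borel" and e: "AE x in lborel. x \<in> S \<longrightarrow> f x = g x"
  shows "antideriv S F g"
  unfolding antideriv_def
proof (intro ballI impI)
  fix x y assume xy: "x \<in> S" "y \<in> S" "x \<le> y"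
  then have sub: "{x..y} \<subseteq> S" using interval_Icc_subset[OF S] by blast
  have mg: "set_borel_measurable lborel {x..y} g"
    using set_borel_measurable_subset[OF m(1)] sub by simp
  have i: "set_integrable lborel {x..y} f" using antideriv_integrable[OF A] xy by blast
  then have mf: "set_borel_measurable lborel {x..y} f"
    unfolding set_integrable_def set_borel_measurable_def by auto
  have e': "AE t in lborel. t \<in> {x..y} \<longrightarrow> f t = g t" using e by eventually_elim (use sub in auto)
  have e2: "AE t\<in>{x..y} in lborel. f t = g t" using e' by simp
  have e3: "AE t\<in>{x..y} in lborel. g t = f t" using e' by (auto elim!: eventually_mono)
  have mf': "(\<lambda>t. indicator {x..y} t *\<^sub>R f t) \<in> borel_measurable lborel"
    and mg': "(\<lambda>t. indicator {x..y} t *\<^sub>R g t) \<in> borel_measurable lborel"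
    using mf mg by (simp_all add: set_borel_measurable_def)
  have ae: "AE t in lborel. indicator {x..y} t *\<^sub>R f t = indicator {x..y} t *\<^sub>R g t"
    using e' by eventually_elim (auto simp: indicator_def)
  have "set_integrable lborel {x..y} g"
    using i integrable_cong_AE[OF mf' mg' ae] by (simp add: set_integrable_def)
  moreover have "(LINT t:{x..y}|lborel. f t) = (LINT t:{x..y}|lborel. g t)"
    unfolding set_lebesgue_integral_def by (rule integral_cong_AE[OF mf' mg' ae])
  ultimately show "set_integrable lborel {x..y} g \<and> F y - F x = (LINT t:{x..y}|lborel. g t)"
    using antideriv_diff_eq[OF A] xy by simp
qed

lemma antideriv_cong: 
  assumes "antideriv S F f" "\<And>x. x \<in> S \<Longrightarrow> F x = G x"
  shows "antideriv S G f"
  using assms unfolding antideriv_def by metis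

lemma antideriv_continuous_on_Icc:
  assumes A: "antideriv {a..b} F f"
  shows "continuous_on {a..b} F"
proof (cases "a \<le> b")
  case True
  have i: "set_integrable lborel {a..b} f" using antideriv_integrable[OF A] True by simp
  have c: "continuous_on {a..b} (\<lambda>x. F a + integral {a..x} f)"
    by (intro continuous_intros indefinite_integral_continuous_1 set_borel_integral_eq_integral(1)[OF i])
  have "F x = F a + integral {a..x} f" if "x \<in> {a..b}" for x
    using antideriv_diff_eq[OF A, of a x] antideriv_integrable[OF A, of a x] True that
      set_borel_integral_eq_integral(2)[of "{a..x}" f] by (simp add: diff_eq_eq)
  then show ?thesis using c continuous_on_cong[of "{a..b}" "{a..b}" F "\<lambda>x. F a + integral {a..x} f"] by blast
qed simp

lemma antideriv_continuous_on:
  assumes A: "antideriv S F f" and S: "is_interval S" and "open S"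
  shows "continuous_on S F"
proof -
  have "isCont F x" if "x \<in> S" for x
  proof -
    obtain e where e: "e > 0" "cball x e \<subseteq> S" using \<open>open S\<close> \<open>x \<in> S\<close> open_contains_cball by blast
    have "antideriv {x - e..x + e} F f"
      using antideriv_subset[OF A] e by (simp add: cball_eq_atLeastAtMost)
    from antideriv_continuous_on_Icc[OF this]
    moreover have "x \<in> interior {x - e..x + e}" using e(1) by (simp add: interior_atLeastAtMost_real)
    ultimately show ?thesis by (rule continuous_on_interior)
  qed
  then show ?thesis by (simp add: continuous_at_imp_continuous_on)
qed

lemma set_integrable_continuous_mult:
  fixes f G :: "real \<Rightarrow> complex"
  assumes i: "set_integrable lborel {a..b} f" and c: "continuous_on {a..b} G"
  shows "set_integrable lborel {a..b} (\<lambda>x. f x * G x)"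
proof -
  obtain B where B: "\<And>x. x \<in> {a..b} \<Longrightarrow> norm (G x) \<le> B"
    using compact_imp_bounded[OF compact_continuous_image[OF c compact_Icc]] unfolding bounded_iff by (metis image_eqI)
  have mG: "(\<lambda>x. indicator {a..b} x *\<^sub>R G x) \<in> borel_measurable lborel"
    using borel_measurable_continuous_on_indicator[OF _ c] by simp
  have if': "integrable lborel (\<lambda>x. indicator {a..b} x *\<^sub>R f x)" using i by (simp add: set_integrable_def)
  have e: "indicator {a..b} x *\<^sub>R (f x * G x) = (indicator {a..b} x *\<^sub>R f x) * (indicator {a..b} x *\<^sub>R G x)" for x
    by (auto simp: indicator_def)
  show ?thesis unfolding set_integrable_def e
  proof (rule Bochner_Integration.integrable_bound)
    show "integrable lborel (\<lambda>x. of_real B * (indicator {a..b} x *\<^sub>R f x))" using if' by (intro integrable_mult_right) auto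
    show "(\<lambda>x. (indicator {a..b} x *\<^sub>R f x) * (indicator {a..b} x *\<^sub>R G x)) \<in> borel_measurable lborel"
      by (rule borel_measurable_times[OF borel_measurable_integrable[OF if'] mG])
    show "AE x in lborel. norm (indicator {a..b} x *\<^sub>R f x * indicator {a..b} x *\<^sub>R G x) \<le> norm (complex_of_real B * indicator {a..b} x *\<^sub>R f x)"
    proof (rule AE_I2)
      fix x
      show "norm (indicator {a..b} x *\<^sub>R f x * indicator {a..b} x *\<^sub>R G x) \<le> norm (complex_of_real B * indicator {a..b} x *\<^sub>R f x)"
        using mult_right_mono[of "norm (G x)" "\<bar>B\<bar>" "norm (f x)"] B[of x]
        by (auto simp: indicator_def norm_mult mult.commute)
    qed
  qed
qed

text \<open>Both double integrals below run over the triangle of pairs \<open>t \<le> s\<close>.\<close>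

lemma triangle_Fubini:
  fixes f g :: "real \<Rightarrow> complex"
  assumes f: "set_integrable lborel {a..b} f" and g: "set_integrable lborel {a..b} g"
  shows "(LINT t:{a..b}|lborel. f t * (LINT s:{t..b}|lborel. g s)) =
         (LINT s:{a..b}|lborel. (LINT t:{a..s}|lborel. f t) * g s)"
proof -
  define f' where "f' = (\<lambda>x. indicator {a..b} x *\<^sub>R f x)"
  define g' where "g' = (\<lambda>x. indicator {a..b} x *\<^sub>R g x)"
  have if': "integrable lborel f'" and ig': "integrable lborel g'"
    using f g by (simp_all add: f'_def g'_def set_integrable_def)
  have [measurable]: "f' \<in> borel_measurable lborel" "g' \<in> borel_measurable lborel"
    using if' ig' by auto
  have m: "(\<lambda>(t, s). (if t \<le> s then f' t * g' s else 0)) \<in> borel_measurable (lborel \<Otimes>\<^sub>M lborel)"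
    by measurable
  have P: "integrable (lborel \<Otimes>\<^sub>M lborel) (\<lambda>(t, s). f' t * g' s)"
  proof (rule lborel_pair.Fubini_integrable)
    show "(\<lambda>(t, s). f' t * g' s) \<in> borel_measurable (lborel \<Otimes>\<^sub>M lborel)" by measurable
    show "integrable lborel (\<lambda>x. LINT y|lborel. norm (case (x, y) of (t, s) \<Rightarrow> f' t * g' s))"
      using if' by (simp add: norm_mult)
    show "AE x in lborel. integrable lborel (\<lambda>y. case (x, y) of (t, s) \<Rightarrow> f' t * g' s)"
      using ig' by simp
  qed
  have I: "integrable (lborel \<Otimes>\<^sub>M lborel) (\<lambda>(t, s). (if t \<le> s then f' t * g' s else 0))"
    by (rule Bochner_Integration.integrable_bound[OF P m]) auto
  have "(LINT s|lborel. (LINT t|lborel. (if t \<le> s then f' t * g' s else 0))) =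
        (LINT t|lborel. (LINT s|lborel. (if t \<le> s then f' t * g' s else 0)))"
    using lborel_pair.Fubini_integral[OF I] .
  moreover have "(LINT t|lborel. (if t \<le> s then f' t * g' s else 0))
      = indicator {a..b} s *\<^sub>R ((LINT t:{a..s}|lborel. f t) * g s)" for s
  proof -
    have "(LINT t|lborel. (if t \<le> s then f' t * g' s else 0)) = (LINT t|lborel. (indicator {..s} t *\<^sub>R f' t) * g' s)"
      by (intro Bochner_Integration.integral_cong) (auto simp: indicator_def)
    also have "\<dots> = (LINT t|lborel. indicator {..s} t *\<^sub>R f' t) * g' s"
      by (rule integral_mult_left_zero)
    also have "\<dots> = indicator {a..b} s *\<^sub>R ((LINT t:{a..s}|lborel. f t) * g s)"
    proof (cases "s \<in> {a..b}")
      case True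
      then have "(\<lambda>t. indicator {..s} t *\<^sub>R f' t) = (\<lambda>t. indicator {a..s} t *\<^sub>R f t)"
        by (auto simp: f'_def indicator_def)
      then show ?thesis using True by (simp add: g'_def set_lebesgue_integral_def)
    qed (simp add: g'_def)
    finally show ?thesis .
  qed
  moreover have "(LINT s|lborel. (if t \<le> s then f' t * g' s else 0))
      = indicator {a..b} t *\<^sub>R (f t * (LINT s:{t..b}|lborel. g s))" for t
  proof -
    have "(LINT s|lborel. (if t \<le> s then f' t * g' s else 0)) = (LINT s|lborel. f' t * (indicator {t..} s *\<^sub>R g' s))"
      by (intro Bochner_Integration.integral_cong) (auto simp: indicator_def)
    also have "\<dots> = f' t * (LINT s|lborel. indicator {t..} s *\<^sub>R g' s)"
      by (rule integral_mult_right_zero)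
    also have "\<dots> = indicator {a..b} t *\<^sub>R (f t * (LINT s:{t..b}|lborel. g s))"
    proof (cases "t \<in> {a..b}")
      case True
      then have "(\<lambda>s. indicator {t..} s *\<^sub>R g' s) = (\<lambda>s. indicator {t..b} s *\<^sub>R g s)"
        by (auto simp: g'_def indicator_def)
      then show ?thesis using True by (simp add: f'_def set_lebesgue_integral_def)
    qed (simp add: f'_def)
    finally show ?thesis .
  qed
  ultimately show ?thesis unfolding set_lebesgue_integral_def[of _ "{a..b}"] by simp
qed

text \<open>
  Integration by parts for merely integrable densities. Expressing \<open>G\<close> through its value at the right
  end and \<open>F\<close> through its value at the left end reduces both terms to integrals over one triangle.
\<close>

lemma antideriv_mult:
  assumes F: "antideriv S F f" and G: "antideriv S G g" and S: "is_interval S"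
  shows "antideriv S (\<lambda>x. F x * G x) (\<lambda>x. f x * G x + F x * g x)"
  unfolding antideriv_def
proof (intro ballI impI)
  fix a b assume ab: "a \<in> S" "b \<in> S" "a \<le> b"
  have sub: "{a..b} \<subseteq> S" using interval_Icc_subset[OF S] ab by blast
  note F' = antideriv_subset[OF F sub] and G' = antideriv_subset[OF G sub]
  have f: "set_integrable lborel {a..b} f" and g: "set_integrable lborel {a..b} g"
    using antideriv_integrable F G ab by blast+
  have fG: "set_integrable lborel {a..b} (\<lambda>x. f x * G x)"
    by (rule set_integrable_continuous_mult[OF f antideriv_continuous_on_Icc[OF G']])
  have Fg: "set_integrable lborel {a..b} (\<lambda>x. F x * g x)"
    using set_integrable_continuous_mult[OF g antideriv_continuous_on_Icc[OF F']] by (simp add: mult.commute)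
  have i1: "set_integrable lborel {a..b} (\<lambda>t. f t * (G b - G t))"
    using set_integral_diff(1)[OF set_integrable_mult_left[where a="G b", OF f] fG] by (simp add: algebra_simps)
  have i2: "set_integrable lborel {a..b} (\<lambda>t. (F t - F a) * g t)"
    using set_integral_diff(1)[OF Fg set_integrable_mult_right[where a="F a", OF g]] by (simp add: algebra_simps)
  have "(LINT t:{a..b}|lborel. f t * (G b - G t)) = (LINT t:{a..b}|lborel. f t * (LINT s:{t..b}|lborel. g s))"
    using antideriv_diff_eq[OF G'] by (intro set_lebesgue_integral_cong) auto
  also have "\<dots> = (LINT s:{a..b}|lborel. (LINT t:{a..s}|lborel. f t) * g s)" by (rule triangle_Fubini[OF f g])
  also have "\<dots> = (LINT s:{a..b}|lborel. (F s - F a) * g s)"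
    using antideriv_diff_eq[OF F'] by (intro set_lebesgue_integral_cong) auto
  finally have e: "(LINT t:{a..b}|lborel. f t * (G b - G t)) = (LINT s:{a..b}|lborel. (F s - F a) * g s)" .
  have h1: "(LINT t:{a..b}|lborel. f t * (G b - G t)) = (F b - F a) * G b - (LINT t:{a..b}|lborel. f t * G t)"
    using set_integral_diff(2)[OF set_integrable_mult_left[where a="G b", OF f] fG] antideriv_diff_eq[OF F ab]
    by (simp add: algebra_simps)
  have h2: "(LINT s:{a..b}|lborel. (F s - F a) * g s) = (LINT t:{a..b}|lborel. F t * g t) - F a * (G b - G a)"
    using set_integral_diff(2)[OF Fg set_integrable_mult_right[where a="F a", OF g]] antideriv_diff_eq[OF G ab]
    by (simp add: algebra_simps)
  have "F b * G b - F a * G a = (LINT t:{a..b}|lborel. f t * G t) + (LINT t:{a..b}|lborel. F t * g t)"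
    using trans[OF trans[OF h1[symmetric] e] h2] by (simp add: algebra_simps)
  then show "set_integrable lborel {a..b} (\<lambda>x. f x * G x + F x * g x) \<and>
    F b * G b - F a * G a = (LINT t:{a..b}|lborel. f t * G t + F t * g t)"
    using set_integral_add[OF fG Fg] by simp
qed

lemma antideriv_norm_le:
  assumes "antideriv S F f" "x \<in> S" "y \<in> S" "x \<le> y"
  shows "norm (F y - F x) \<le> (LINT t:{x..y}|lborel. norm (f t))"
  unfolding antideriv_diff_eq[OF assms]
  by (rule set_integral_norm_bound[OF antideriv_integrable[OF assms(1-3)]])

section \<open>Uniqueness of densities and Gronwall's inequality\<close>

lemma set_integral_split:
  fixes f :: "real \<Rightarrow> 'a::{banach, second_countable_topology}"
  assumes "set_integrable lborel {x..z} f" "x \<le> y" "y \<le> z"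
  shows "(LINT t:{x..z}|lborel. f t) = (LINT t:{x..y}|lborel. f t) + (LINT t:{y..z}|lborel. f t)"
proof -
  have "(LINT t:{x..y} \<union> {y..z}|lborel. f t) = (LINT t:{x..y}|lborel. f t) + (LINT t:{y..z}|lborel. f t)"
  proof (rule set_integral_Un_AE)
    show "AE t in lborel. \<not> (t \<in> {x..y} \<and> t \<in> {y..z})"
      using AE_lborel_singleton[of y] by eventually_elim auto
    show "set_integrable lborel {x..y} f" "set_integrable lborel {y..z} f"
      by (rule set_integrable_subset[OF assms(1)]; use assms in auto)+
  qed auto
  moreover have "{x..y} \<union> {y..z} = {x..z}" using assms by auto
  ultimately show ?thesis by simp
qed

lemma set_integral_mono_set:
  fixes f :: "real \<Rightarrow> real"
  assumes "set_integrable lborel B f" "A \<subseteq> B" "A \<in> sets borel" "\<And>x. x \<in> B \<Longrightarrow> 0 \<le> f x"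
  shows "(LINT x:A|lborel. f x) \<le> (LINT x:B|lborel. f x)"
proof -
  have "set_integrable lborel A f" by (rule set_integrable_subset[OF assms(1)]) (use assms in auto)
  then show ?thesis using assms unfolding set_lebesgue_integral_def set_integrable_def
    by (intro integral_mono) (auto simp: indicator_def)
qed

text \<open>
  The Borel sets over which the integral vanishes form a Dynkin system that contains the intervals.
\<close>

lemma interval_integrals_zero_imp_AE_zero_Icc:
  fixes f :: "real \<Rightarrow> complex"
  assumes i: "set_integrable lborel {a..b} f"
    and z: "\<And>x y. a \<le> x \<Longrightarrow> x \<le> y \<Longrightarrow> y \<le> b \<Longrightarrow> (LINT t:{x..y}|lborel. f t) = 0"
  shows "AE x in lborel. x \<in> {a..b} \<longrightarrow> f x = 0"
proof -
  define g where "g = (\<lambda>x. indicator {a..b} x *\<^sub>R f x)"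
  have ig: "integrable lborel g" using i by (simp add: g_def set_integrable_def)
  have sg: "set_integrable lborel A g" if "A \<in> sets borel" for A
    using integrable_mult_indicator[OF _ ig, of A] that by (simp add: set_integrable_def)
  have I: "(LINT t:{x..y}|lborel. g t) = 0" for x y
  proof -
    have "(LINT t:{x..y}|lborel. g t) = (LINT t:{max a x..min b y}|lborel. f t)"
      unfolding set_lebesgue_integral_def g_def
      by (intro Bochner_Integration.integral_cong) (auto simp: indicator_def)
    also have "\<dots> = 0"
    proof (cases "max a x \<le> min b y")
      case True
      then show ?thesis by (intro z) auto
    qed (simp add: set_lebesgue_integral_def)
    finally show ?thesis .
  qed
  have U: "(LINT t|lborel. g t) = 0"
  proof -
    have "(LINT t|lborel. g t) = (LINT t:{a..b}|lborel. g t)"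
      unfolding set_lebesgue_integral_def g_def
      by (intro Bochner_Integration.integral_cong) (auto simp: indicator_def)
    then show ?thesis using I by simp
  qed
  have all: "(LINT t:A|lborel. g t) = 0" if "A \<in> sets borel" for A
  proof -
    have st: "Int_stable (range (\<lambda>(x, y). {x..y::real}))"
      by (auto simp: Int_stable_def intro!: range_eqI[where x="(max _ _, min _ _)"])
    have gen: "A \<in> sigma_sets UNIV (range (\<lambda>(x, y). {x..y::real}))"
      using that by (subst (asm) borel_eq_atLeastAtMost) simp
    have pw: "range (\<lambda>(x, y). {x..y::real}) \<subseteq> Pow UNIV" by simp
    from st pw gen show ?thesis
    proof (induction rule: sigma_sets_induct_disjoint)
      case (basic A) then show ?case using I by auto
    next
      case empty then show ?case by (simp add: set_lebesgue_integral_def)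
    next
      case (compl A)
      then have A: "A \<in> sets borel" by (subst borel_eq_atLeastAtMost) simp
      have "(LINT t:A \<union> - A|lborel. g t) = (LINT t:A|lborel. g t) + (LINT t:- A|lborel. g t)"
        using sg A by (intro set_integral_Un) auto
      then show ?case using compl U by (simp add: Compl_eq_Diff_UNIV[symmetric] set_lebesgue_integral_def)
    next
      case (union A)
      then have A: "A i \<in> sets borel" for i by (subst borel_eq_atLeastAtMost) auto
      have "(LINT t:(\<Union>i. A i)|lborel. g t) = (\<Sum>i. (LINT t:A i|lborel. g t))"
        using union A by (intro lebesgue_integral_countable_add sg) (auto simp: disjoint_family_on_def)
      then show ?case using union by simp
    qed
  qed
  have "AE x in lborel. g x = 0"
    by (rule sigma_finite_measure.density_zero[OF sigma_finite_lborel ig]) (use all in simp)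
  then show ?thesis by eventually_elim (auto simp: g_def)
qed

lemma interval_integrals_zero_imp_AE_zero:
  fixes f :: "real \<Rightarrow> complex"
  assumes S: "is_interval S" "open S"
    and i: "\<And>x y. x \<in> S \<Longrightarrow> y \<in> S \<Longrightarrow> x \<le> y \<Longrightarrow> set_integrable lborel {x..y} f"
    and z: "\<And>x y. x \<in> S \<Longrightarrow> y \<in> S \<Longrightarrow> x \<le> y \<Longrightarrow> (LINT t:{x..y}|lborel. f t) = 0"
  shows "AE x in lborel. x \<in> S \<longrightarrow> f x = 0"
proof -
  have "AE x in lborel. x \<in> {a..b} \<longrightarrow> f x = 0" if "(a, b) \<in> (\<rat> \<inter> S) \<times> (\<rat> \<inter> S)" for a b
  proof (cases "a \<le> b")
    case True
    have "{a..b} \<subseteq> S" using interval_Icc_subset[OF S(1)] that by blast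
    then show ?thesis using that True by (intro interval_integrals_zero_imp_AE_zero_Icc i z) auto
  qed simp
  moreover have "countable ((\<rat> \<inter> S) \<times> (\<rat> \<inter> S))" by (simp add: countable_Int1 countable_rat)
  ultimately have "AE x in lborel. \<forall>p\<in>(\<rat> \<inter> S) \<times> (\<rat> \<inter> S). x \<in> {fst p..snd p} \<longrightarrow> f x = 0"
    by (subst AE_ball_countable) auto
  then show ?thesis
  proof eventually_elim
    case (elim x)
    show ?case
    proof
      assume "x \<in> S"
      then obtain e where e: "e > 0" "ball x e \<subseteq> S" using \<open>open S\<close> open_contains_ball by blast
      obtain a where a: "a \<in> \<rat>" "x - e < a" "a < x" using Rats_dense_in_real[of "x - e" x] e by auto
      obtain b where b: "b \<in> \<rat>" "x < b" "b < x + e" using Rats_dense_in_real[of x "x + e"] e by auto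
      have "a \<in> S" "b \<in> S" using e a b by (auto simp: ball_def dist_real_def subset_iff)
      then show "f x = 0" using elim[rule_format, of "(a, b)"] a b by auto
    qed
  qed
qed

lemma antideriv_unique_AE:
  assumes f: "antideriv S F f" and g: "antideriv S F g" and S: "is_interval S" "open S"
  shows "AE x in lborel. x \<in> S \<longrightarrow> f x = g x"
proof -
  have d: "antideriv S (\<lambda>x. F x - F x) (\<lambda>x. f x - g x)" by (rule antideriv_diff[OF f g])
  have "AE x in lborel. x \<in> S \<longrightarrow> f x - g x = 0"
    using antideriv_integrable[OF d] antideriv_diff_eq[OF d, symmetric]
    by (intro interval_integrals_zero_imp_AE_zero[OF S]) auto
  then show ?thesis by simp
qed

lemma antideriv_constant:
  assumes f: "antideriv S F f" and "AE x in lborel. x \<in> S \<longrightarrow> f x = 0" "is_interval S" "x \<in> S" "y \<in> S"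
  shows "F x = F y"
proof -
  have *: "F y - F x = 0" if "x \<in> S" "y \<in> S" "x \<le> y" for x y
  proof -
    have sub: "{x..y} \<subseteq> S" using interval_Icc_subset assms(3) that by blast
    have "F y - F x = (LINT t:{x..y}|lborel. f t)" by (rule antideriv_diff_eq[OF f that])
    also have "\<dots> = 0" unfolding set_lebesgue_integral_def
      by (rule integral_eq_zero_AE) (use assms(2) sub in \<open>auto elim!: eventually_mono simp: indicator_def\<close>)
    finally show ?thesis .
  qed
  show ?thesis using *[of x y] *[of y x] assms(4,5) by (cases "x \<le> y") auto
qed

text \<open>
  The function \<open>(K + C * integral {a..x} E) * exp (- C * (x - a))\<close> has a nonpositive derivative.
\<close>

lemma gronwall:
  fixes E :: "real \<Rightarrow> real"
  assumes c: "continuous_on {a..b} E" and "C \<ge> 0"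
    and le: "\<And>x. x \<in> {a..b} \<Longrightarrow> E x \<le> K + C * integral {a..x} E"
    and x: "x \<in> {a..b}"
  shows "E x \<le> K * exp (C * (x - a))"
proof -
  define m where "m = (\<lambda>x. (K + C * integral {a..x} E) * exp (- C * (x - a)))"
  have d: "(m has_real_derivative (C * (E t - (K + C * integral {a..t} E)) * exp (- C * (t - a)))) (at t within {a..b})"
    if "t \<in> {a..b}" for t
    unfolding m_def
    by (rule derivative_eq_intros integral_has_real_derivative[OF c that] refl | simp add: algebra_simps)+
  have "m x \<le> m a"
  proof (cases "a = x")
    case False
    then have "a < x" using x by auto
    show ?thesis
    proof (rule DERIV_nonpos_imp_decreasing_open[of a x])
      show "a \<le> x" using x by auto
      show "continuous_on {a..x} m"
        using d x by (intro continuous_on_subset[OF DERIV_continuous_on[of "{a..b}" m]]) auto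
      fix t assume t: "a < t" "t < x"
      have "(m has_real_derivative (C * (E t - (K + C * integral {a..t} E)) * exp (- C * (t - a)))) (at t)"
        using d[of t] t x by (simp add: at_within_Icc_at)
      moreover have "C * (E t - (K + C * integral {a..t} E)) * exp (- C * (t - a)) \<le> 0"
        using le[of t] t x \<open>C \<ge> 0\<close> by (intro mult_nonpos_nonneg mult_nonneg_nonpos) auto
      ultimately show "\<exists>y. DERIV m t :> y \<and> y \<le> 0" by blast
    qed
  qed simp
  then have "(K + C * integral {a..x} E) * inverse (exp (C * (x - a))) \<le> K" by (simp add: m_def exp_minus)
  then have "K + C * integral {a..x} E \<le> K * exp (C * (x - a))"
    by (simp only: divide_inverse[symmetric] pos_divide_le_eq[OF exp_gt_zero])
  then show ?thesis using le[OF x] by simp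
qed

text \<open>
  A bound on increments has no preferred direction, so the value at any one point controls all
  others: to its right by Gronwall's inequality, to its left by the same inequality after reflection.
\<close>

lemma gronwall_two_sided:
  fixes E :: "real \<Rightarrow> real"
  assumes c: "continuous_on {a..b} E" and C: "C \<ge> 0" and nn: "\<And>x. x \<in> {a..b} \<Longrightarrow> 0 \<le> E x" and K: "K \<ge> 0"
    and le: "\<And>x y. a \<le> x \<Longrightarrow> x \<le> y \<Longrightarrow> y \<le> b \<Longrightarrow> \<bar>E y - E x\<bar> \<le> K + C * integral {x..y} E"
    and x: "x \<in> {a..b}" and y: "y \<in> {a..b}"
  shows "E x \<le> (E y + K) * exp (C * (b - a))"
proof (cases "y \<le> x")
  case True
  have "E x \<le> (E y + K) * exp (C * (x - y))"
  proof (rule gronwall[of y b E C])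
    show "continuous_on {y..b} E" by (rule continuous_on_subset[OF c]) (use y in auto)
    show "E t \<le> E y + K + C * integral {y..t} E" if "t \<in> {y..b}" for t
      using le[of y t] that y by auto
  qed (use C x True in auto)
  also have "\<dots> \<le> (E y + K) * exp (C * (b - a))"
    using nn[OF y] K C x y by (intro mult_left_mono) (auto intro!: mult_left_mono)
  finally show ?thesis .
next
  case False
  have "E (- (- x)) \<le> (E y + K) * exp (C * (- x - (- y)))"
  proof (rule gronwall[of "-y" "-a" "\<lambda>t. E (- t)" C])
    show "continuous_on {- y..- a} (\<lambda>t. E (- t))"
      using y by (intro continuous_on_compose2[OF c]) (auto intro!: continuous_intros)
    fix t assume t: "t \<in> {-y..-a}"
    have "integral {-y..t} (\<lambda>t. E (- t)) = integral {-t..y} E"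
      using Henstock_Kurzweil_Integration.integral_reflect_real[of y "-t" E] by simp
    then show "E (- t) \<le> E y + K + C * integral {-y..t} (\<lambda>t. E (- t))"
      using le[of "-t" y] t y by auto
  qed (use C x False in auto)
  also have "\<dots> \<le> (E y + K) * exp (C * (b - a))"
    using nn[OF y] K C x y by (intro mult_left_mono) (auto intro!: mult_left_mono)
  finally show ?thesis by simp
qed

section \<open>Square-integrable functions\<close>

lemma L2_measurable: "u \<in> L2 S \<Longrightarrow> (\<lambda>x. indicator S x *\<^sub>R u x) \<in> borel_measurable lborel"
  by (simp add: L2_def set_borel_measurable_def)

lemma L2_sq_integrable: "u \<in> L2 S \<Longrightarrow> set_integrable lborel S (\<lambda>x. (cmod (u x))\<^sup>2)"
  by (simp add: L2_def)

lemma L2I: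
  assumes "(\<lambda>x. indicator S x *\<^sub>R u x) \<in> borel_measurable lborel" "set_integrable lborel S (\<lambda>x. (cmod (u x))\<^sup>2)"
  shows "u \<in> L2 S"
  using assms by (simp add: L2_def set_borel_measurable_def)

lemma set_integral_nonneg':
  fixes f :: "real \<Rightarrow> real"
  assumes "\<And>x. x \<in> S \<Longrightarrow> 0 \<le> f x"
  shows "0 \<le> (LINT x:S|M. f x)"
  unfolding set_lebesgue_integral_def by (rule Bochner_Integration.integral_nonneg) (use assms in \<open>auto simp: indicator_def\<close>)

lemma L2_norm_nonneg [simp]: "0 \<le> L2_norm S u"
  by (simp add: L2_norm_def set_integral_nonneg')

lemma L2_norm_sq: "(L2_norm S u)\<^sup>2 = (LINT x:S|lborel. (cmod (u x))\<^sup>2)"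
  by (simp add: L2_norm_def set_integral_nonneg')

text \<open>
  Domination up to a constant; most memberships and norm estimates below are instances of this.
\<close>

lemma L2_bounded_by:
  assumes m: "(\<lambda>x. indicator S x *\<^sub>R u x) \<in> borel_measurable lborel"
    and v: "v \<in> L2 S" and le: "AE x in lborel. x \<in> S \<longrightarrow> cmod (u x) \<le> C * cmod (v x)" and "C \<ge> 0"
  shows "u \<in> L2 S" "L2_norm S u \<le> C * L2_norm S v"
proof -
  have iv: "integrable lborel (\<lambda>x. indicator S x *\<^sub>R (C\<^sup>2 * (cmod (v x))\<^sup>2))"
    using set_integrable_mult_right[of "C\<^sup>2", OF L2_sq_integrable[OF v]] by (simp add: set_integrable_def)
  have mu: "(\<lambda>x. indicator S x *\<^sub>R (cmod (u x))\<^sup>2) \<in> borel_measurable lborel"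
  proof -
    have "(\<lambda>x. (cmod (indicator S x *\<^sub>R u x))\<^sup>2) \<in> borel_measurable lborel" using m by measurable
    moreover have "(\<lambda>x. (cmod (indicator S x *\<^sub>R u x))\<^sup>2) = (\<lambda>x. indicator S x *\<^sub>R (cmod (u x))\<^sup>2)"
      by (auto simp: indicator_def)
    ultimately show ?thesis by simp
  qed
  have ae: "AE x in lborel. indicator S x *\<^sub>R (cmod (u x))\<^sup>2 \<le> indicator S x *\<^sub>R (C\<^sup>2 * (cmod (v x))\<^sup>2)"
    using le
  proof eventually_elim
    case (elim x)
    show ?case
    proof (cases "x \<in> S")
      case True
      then have "(cmod (u x))\<^sup>2 \<le> (C * cmod (v x))\<^sup>2" using elim by (intro power_mono) auto
      then show ?thesis using True by (simp add: power_mult_distrib)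
    qed simp
  qed
  have iu: "integrable lborel (\<lambda>x. indicator S x *\<^sub>R (cmod (u x))\<^sup>2)"
    by (rule Bochner_Integration.integrable_bound[OF iv mu])
       (use ae in \<open>eventually_elim, auto simp: indicator_def split: if_splits\<close>)
  then show "u \<in> L2 S" by (intro L2I m) (simp add: set_integrable_def)
  have "(LINT x:S|lborel. (cmod (u x))\<^sup>2) \<le> (LINT x:S|lborel. C\<^sup>2 * (cmod (v x))\<^sup>2)"
    unfolding set_lebesgue_integral_def by (rule integral_mono_AE[OF iu iv ae])
  then have "(L2_norm S u)\<^sup>2 \<le> (C * L2_norm S v)\<^sup>2" by (simp add: power_mult_distrib L2_norm_sq)
  then show "L2_norm S u \<le> C * L2_norm S v" by (rule power2_le_imp_le) (use \<open>C \<ge> 0\<close> in simp)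
qed

lemma L2_cong_AE:
  assumes v: "v \<in> L2 S" and m: "(\<lambda>x. indicator S x *\<^sub>R u x) \<in> borel_measurable lborel"
    and e: "AE x in lborel. x \<in> S \<longrightarrow> u x = v x"
  shows "u \<in> L2 S" "L2_norm S u = L2_norm S v"
proof -
  have e1: "AE x in lborel. x \<in> S \<longrightarrow> cmod (u x) \<le> 1 * cmod (v x)" using e by eventually_elim auto
  show u: "u \<in> L2 S" by (rule L2_bounded_by(1)[OF m v e1]) simp
  have e2: "AE x in lborel. x \<in> S \<longrightarrow> cmod (v x) \<le> 1 * cmod (u x)" using e by eventually_elim auto
  show "L2_norm S u = L2_norm S v"
    using L2_bounded_by(2)[OF m v e1] L2_bounded_by(2)[OF L2_measurable[OF v] u e2] by simp
qed

lemma L2_cmult: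
  assumes "u \<in> L2 S"
  shows "(\<lambda>x. c * u x) \<in> L2 S" "L2_norm S (\<lambda>x. c * u x) \<le> cmod c * L2_norm S u"
proof -
  have eq: "(\<lambda>x. indicator S x *\<^sub>R (c * u x)) = (\<lambda>x. c * (indicator S x *\<^sub>R u x))" by auto
  have m: "(\<lambda>x. indicator S x *\<^sub>R (c * u x)) \<in> borel_measurable lborel"
    unfolding eq by (intro borel_measurable_times borel_measurable_const L2_measurable assms)
  show "(\<lambda>x. c * u x) \<in> L2 S" "L2_norm S (\<lambda>x. c * u x) \<le> cmod c * L2_norm S u"
    by (rule L2_bounded_by[OF m assms, of "cmod c"]; simp add: norm_mult)+
qed

lemma L2_mult_integrable:
  assumes u: "u \<in> L2 S" and v: "v \<in> L2 S"
  shows "set_integrable lborel S (\<lambda>x. u x * v x)"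
proof -
  have i: "integrable lborel (\<lambda>x. indicator S x *\<^sub>R (cmod (u x))\<^sup>2 + indicator S x *\<^sub>R (cmod (v x))\<^sup>2)"
    using L2_sq_integrable[OF u] L2_sq_integrable[OF v] unfolding set_integrable_def
    by (rule Bochner_Integration.integrable_add)
  have eq: "(\<lambda>x. indicator S x *\<^sub>R (u x * v x)) = (\<lambda>x. (indicator S x *\<^sub>R u x) * (indicator S x *\<^sub>R v x))"
    by (auto simp: indicator_def)
  show ?thesis unfolding set_integrable_def
  proof (rule Bochner_Integration.integrable_bound[OF i])
    show "(\<lambda>x. indicator S x *\<^sub>R (u x * v x)) \<in> borel_measurable lborel"
      unfolding eq by (rule borel_measurable_times[OF L2_measurable[OF u] L2_measurable[OF v]])
    have "cmod (u x * v x) \<le> (cmod (u x))\<^sup>2 + (cmod (v x))\<^sup>2" for x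
      using sum_squares_bound[of "cmod (u x)" "cmod (v x)"] mult_nonneg_nonneg[OF norm_ge_zero[of "u x"] norm_ge_zero[of "v x"]]
      unfolding norm_mult by linarith
    then show "AE x in lborel. norm (indicator S x *\<^sub>R (u x * v x)) \<le>
        norm (indicator S x *\<^sub>R (cmod (u x))\<^sup>2 + indicator S x *\<^sub>R (cmod (v x))\<^sup>2)"
      by (intro AE_I2) (auto simp: indicator_def)
  qed
qed

text \<open>
  Integrating \<open>2 |u v| \<le> t |u|\<^sup>2 + |v|\<^sup>2 / t\<close> and optimising over \<open>t > 0\<close>; when one of the norms
  is zero the optimum is only approached, and a suitable finite \<open>t\<close> gives a contradiction.
\<close>

lemma L2_cauchy_schwarz:
  assumes u: "u \<in> L2 S" and v: "v \<in> L2 S"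
  shows "(LINT x:S|lborel. cmod (u x) * cmod (v x)) \<le> L2_norm S u * L2_norm S v"
proof -
  define I where "I = (LINT x:S|lborel. cmod (u x) * cmod (v x))"
  define a where "a = L2_norm S u"
  define b where "b = L2_norm S v"
  have a0: "a \<ge> 0" "b \<ge> 0" by (simp_all add: a_def b_def)
  have iuv: "set_integrable lborel S (\<lambda>x. cmod (u x) * cmod (v x))"
    using set_integrable_norm[OF L2_mult_integrable[OF u v]] by (simp add: norm_mult)
  note iu = L2_sq_integrable[OF u] and iv = L2_sq_integrable[OF v]
  have le: "2 * I \<le> t * a\<^sup>2 + b\<^sup>2 / t" if "t > 0" for t
  proof -
    have "(LINT x:S|lborel. 2 * (cmod (u x) * cmod (v x))) \<le> (LINT x:S|lborel. t * (cmod (u x))\<^sup>2 + (1 / t) * (cmod (v x))\<^sup>2)"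
    proof (rule set_integral_mono)
      fix x
      have "0 \<le> (sqrt t * cmod (u x) - cmod (v x) / sqrt t)\<^sup>2" by simp
      also have "\<dots> = t * (cmod (u x))\<^sup>2 + (1 / t) * (cmod (v x))\<^sup>2 - 2 * (cmod (u x) * cmod (v x))"
        using that by (simp add: power2_diff power_mult_distrib power_divide)
      finally show "2 * (cmod (u x) * cmod (v x)) \<le> t * (cmod (u x))\<^sup>2 + (1 / t) * (cmod (v x))\<^sup>2" by simp
    qed (intro set_integrable_mult_right iuv set_integral_add iu iv)+
    also have "\<dots> = t * a\<^sup>2 + (1 / t) * b\<^sup>2"
      using set_integral_add(2)[OF set_integrable_mult_right[of t, OF iu] set_integrable_mult_right[of "1/t", OF iv]]
      by (simp add: a_def b_def L2_norm_sq)
    finally show ?thesis by (simp add: I_def)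
  qed
  have "I \<le> a * b"
  proof (cases "a = 0 \<or> b = 0")
    case False
    then have ab: "a > 0" "b > 0" using a0 by auto
    have "2 * I \<le> (b / a) * a\<^sup>2 + b\<^sup>2 / (b / a)" using ab by (intro le) auto
    also have "\<dots> = 2 * (a * b)" using ab by (simp add: power2_eq_square)
    finally show ?thesis by simp
  next
    case True
    show ?thesis
    proof (rule ccontr)
      assume "\<not> I \<le> a * b"
      then have I: "I > 0" using True by auto
      show False
      proof (cases "a = 0")
        case True
        have t: "b\<^sup>2 / I + 1 > 0" using I by (intro add_nonneg_pos) auto
        have "2 * I \<le> b\<^sup>2 / (b\<^sup>2 / I + 1)" using le[OF t] True by simp
        then have "2 * I * (b\<^sup>2 / I + 1) \<le> b\<^sup>2" by (simp only: pos_le_divide_eq[OF t])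
        moreover have "2 * I * (b\<^sup>2 / I + 1) = 2 * b\<^sup>2 + 2 * I" using I by (simp add: distrib_left)
        ultimately have "2 * b\<^sup>2 + 2 * I \<le> b\<^sup>2" by simp
        then show False using I zero_le_power2[of b] by linarith
      next
        case False
        then have "b = 0" "a > 0" using True a0 by auto
        then show False using le[of "I / a\<^sup>2"] I by simp
      qed
    qed
  qed
  then show ?thesis by (simp add: I_def a_def b_def)
qed

lemma L2_add:
  assumes u: "u \<in> L2 S" and v: "v \<in> L2 S"
  shows "(\<lambda>x. u x + v x) \<in> L2 S" "L2_norm S (\<lambda>x. u x + v x) \<le> L2_norm S u + L2_norm S v"
proof -
  have iuv: "set_integrable lborel S (\<lambda>x. cmod (u x) * cmod (v x))"
    using set_integrable_norm[OF L2_mult_integrable[OF u v]] by (simp add: norm_mult)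
  note iu = L2_sq_integrable[OF u] and iv = L2_sq_integrable[OF v]
  have i: "set_integrable lborel S (\<lambda>x. (cmod (u x))\<^sup>2 + (2 * (cmod (u x) * cmod (v x)) + (cmod (v x))\<^sup>2))"
    by (intro set_integral_add(1) iu iv set_integrable_mult_right iuv)
  have le: "(cmod (u x + v x))\<^sup>2 \<le> (cmod (u x))\<^sup>2 + (2 * (cmod (u x) * cmod (v x)) + (cmod (v x))\<^sup>2)" for x
    using power_mono[OF norm_triangle_ineq[of "u x" "v x"], of 2] by (simp add: power2_sum algebra_simps)
  have m: "(\<lambda>x. indicator S x *\<^sub>R (u x + v x)) \<in> borel_measurable lborel"
    using borel_measurable_add[OF L2_measurable[OF u] L2_measurable[OF v]] by (simp add: scaleR_right_distrib)
  have eq: "(\<lambda>x. indicator S x *\<^sub>R (cmod (u x + v x))\<^sup>2) = (\<lambda>x. (cmod (indicator S x *\<^sub>R (u x + v x)))\<^sup>2)"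
    by (auto simp: indicator_def)
  have isum: "set_integrable lborel S (\<lambda>x. (cmod (u x + v x))\<^sup>2)"
    unfolding set_integrable_def
  proof (rule Bochner_Integration.integrable_bound[OF i[unfolded set_integrable_def]])
    show "(\<lambda>x. indicator S x *\<^sub>R (cmod (u x + v x))\<^sup>2) \<in> borel_measurable lborel"
      unfolding eq using m by measurable
    show "AE x in lborel. norm (indicator S x *\<^sub>R (cmod (u x + v x))\<^sup>2)
         \<le> norm (indicator S x *\<^sub>R ((cmod (u x))\<^sup>2 + (2 * (cmod (u x) * cmod (v x)) + (cmod (v x))\<^sup>2)))"
    proof (rule AE_I2)
      fix x
      have "0 \<le> (cmod (u x + v x))\<^sup>2" by simp
      then show "norm (indicator S x *\<^sub>R (cmod (u x + v x))\<^sup>2)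
         \<le> norm (indicator S x *\<^sub>R ((cmod (u x))\<^sup>2 + (2 * (cmod (u x) * cmod (v x)) + (cmod (v x))\<^sup>2)))"
        using le[of x] by (auto simp: indicator_def)
    qed
  qed
  then show "(\<lambda>x. u x + v x) \<in> L2 S" by (intro L2I m)
  have "(L2_norm S (\<lambda>x. u x + v x))\<^sup>2 \<le> (LINT x:S|lborel. (cmod (u x))\<^sup>2 + (2 * (cmod (u x) * cmod (v x)) + (cmod (v x))\<^sup>2))"
    unfolding L2_norm_sq by (rule set_integral_mono[OF isum i le])
  also have "\<dots> = (L2_norm S u)\<^sup>2 + (2 * (LINT x:S|lborel. cmod (u x) * cmod (v x)) + (L2_norm S v)\<^sup>2)"
    using set_integral_add[OF iu set_integral_add(1)[OF set_integrable_mult_right[of 2, OF iuv] iv]]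
      set_integral_add[OF set_integrable_mult_right[of 2, OF iuv] iv] by (simp add: L2_norm_sq)
  also have "\<dots> \<le> (L2_norm S u + L2_norm S v)\<^sup>2"
    using L2_cauchy_schwarz[OF u v] by (simp add: power2_sum algebra_simps)
  finally show "L2_norm S (\<lambda>x. u x + v x) \<le> L2_norm S u + L2_norm S v"
    by (rule power2_le_imp_le) simp
qed

lemma L2_diff:
  assumes u: "u \<in> L2 S" and v: "v \<in> L2 S"
  shows "(\<lambda>x. u x - v x) \<in> L2 S" "L2_norm S (\<lambda>x. u x - v x) \<le> L2_norm S u + L2_norm S v"
proof -
  have eq: "(\<lambda>x. u x - v x) = (\<lambda>x. u x + - 1 * v x)" by simp
  show "(\<lambda>x. u x - v x) \<in> L2 S"
    unfolding eq by (rule L2_add(1)[OF u L2_cmult(1)[OF v]])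
  have "L2_norm S (\<lambda>x. - 1 * v x) \<le> L2_norm S v" using L2_cmult(2)[OF v, of "- 1"] by (simp only: norm_minus_cancel norm_one mult_1)
  then show "L2_norm S (\<lambda>x. u x - v x) \<le> L2_norm S u + L2_norm S v"
    unfolding eq using L2_add(2)[OF u L2_cmult(1)[OF v, of "- 1"]] by linarith
qed

lemma L2_subset:
  assumes u: "u \<in> L2 S" and T: "T \<subseteq> S" "T \<in> sets borel"
  shows "u \<in> L2 T" "L2_norm T u \<le> L2_norm S u"
proof -
  have eq: "(\<lambda>x. indicator T x *\<^sub>R u x) = (\<lambda>x. indicator T x *\<^sub>R (indicator S x *\<^sub>R u x))"
    by (rule ext) (use T(1) in \<open>auto simp: indicator_def\<close>)
  have i: "set_integrable lborel T (\<lambda>x. (cmod (u x))\<^sup>2)"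
    using set_integrable_subset[OF L2_sq_integrable[OF u]] T by simp
  have "(\<lambda>x. indicator T x *\<^sub>R u x) \<in> borel_measurable lborel"
    unfolding eq using T(2) L2_measurable[OF u] by measurable
  then show "u \<in> L2 T" using i by (rule L2I)
  have "(LINT x:T|lborel. (cmod (u x))\<^sup>2) \<le> (LINT x:S|lborel. (cmod (u x))\<^sup>2)"
    using i L2_sq_integrable[OF u] T(1) unfolding set_lebesgue_integral_def set_integrable_def
    by (intro integral_mono) (auto simp: indicator_def)
  then show "L2_norm T u \<le> L2_norm S u" unfolding L2_norm_def by simp
qed

lemma continuous_imp_L2_Icc:
  assumes c: "continuous_on {a..b} u" shows "u \<in> L2 {a..b}"
proof (rule L2I)
  show "(\<lambda>x. indicator {a..b} x *\<^sub>R u x) \<in> borel_measurable lborel"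
    using borel_measurable_continuous_on_indicator[OF _ c] by simp
  show "set_integrable lborel {a..b} (\<lambda>x. (cmod (u x))\<^sup>2)"
    unfolding set_integrable_def
    by (intro borel_integrable_compact continuous_intros c) simp
qed

lemma L2_const_Icc:
  assumes "a \<le> b" shows "(\<lambda>_. c) \<in> L2 {a..b}" "L2_norm {a..b} (\<lambda>_. c) = cmod c * sqrt (b - a)"
proof -
  show "(\<lambda>_. c) \<in> L2 {a..b}"
    by (intro continuous_imp_L2_Icc continuous_intros)
  show "L2_norm {a..b} (\<lambda>_. c) = cmod c * sqrt (b - a)"
    using assms by (simp add: L2_norm_def set_lebesgue_integral_def real_sqrt_mult mult.commute)
qed

lemma L2_imp_integrable_Icc:
  assumes u: "u \<in> L2 {a..b}" and ab: "a \<le> b"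
  shows "set_integrable lborel {a..b} u"
    "(LINT x:{a..b}|lborel. cmod (u x)) \<le> sqrt (b - a) * L2_norm {a..b} u"
  using L2_mult_integrable[OF u L2_const_Icc(1)[OF ab, of 1]]
    L2_cauchy_schwarz[OF u L2_const_Icc(1)[OF ab, of 1]] L2_const_Icc(2)[OF ab, of 1] by (simp_all add: mult.commute)

lemma L2_cnj:
  assumes "h \<in> L2 S" shows "(\<lambda>x. cnj (h x)) \<in> L2 S" "L2_norm S (\<lambda>x. cnj (h x)) = L2_norm S h"
proof -
  have eq: "(\<lambda>x. indicator S x *\<^sub>R cnj (h x)) = (\<lambda>x. cnj (indicator S x *\<^sub>R h x))" by auto
  have "(\<lambda>x. indicator S x *\<^sub>R cnj (h x)) \<in> borel_measurable lborel"
    unfolding eq by (rule measurable_compose[OF L2_measurable[OF assms] borel_measurable_continuous_onI])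
      (intro continuous_intros)
  then show "(\<lambda>x. cnj (h x)) \<in> L2 S" using L2_sq_integrable[OF assms] by (intro L2I) simp_all
  show "L2_norm S (\<lambda>x. cnj (h x)) = L2_norm S h" by (simp add: L2_norm_def)
qed

lemma L2_null_iff:
  assumes u: "u \<in> L2 S"
  shows "L2_norm S u = 0 \<longleftrightarrow> (AE x in lborel. x \<in> S \<longrightarrow> u x = 0)"
proof -
  have "L2_norm S u = 0 \<longleftrightarrow> (LINT x|lborel. indicator S x *\<^sub>R (cmod (u x))\<^sup>2) = 0"
    by (simp add: L2_norm_def set_lebesgue_integral_def)
  also have "\<dots> \<longleftrightarrow> (AE x in lborel. indicator S x *\<^sub>R (cmod (u x))\<^sup>2 = 0)"
    using L2_sq_integrable[OF u] unfolding set_integrable_def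
    by (intro integral_nonneg_eq_0_iff_AE) auto
  also have "\<dots> \<longleftrightarrow> (AE x in lborel. x \<in> S \<longrightarrow> u x = 0)"
    by (intro AE_cong) (auto simp: indicator_def)
  finally show ?thesis .
qed

section \<open>Smooth cut-off functions\<close>

definition smooth :: "(real \<Rightarrow> real) \<Rightarrow> bool" where
  "smooth \<phi> \<longleftrightarrow> (\<forall>n x. (deriv ^^ n) \<phi> differentiable (at x))"

lemma smooth_deriv: "smooth \<phi> \<Longrightarrow> smooth (deriv \<phi>)"
  unfolding smooth_def by (metis funpow_Suc_right comp_apply)

lemma smooth_has_deriv: "smooth \<phi> \<Longrightarrow> (\<phi> has_real_derivative deriv \<phi> x) (at x)"
  unfolding smooth_def by (metis DERIV_deriv_iff_real_differentiable funpow_0)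

lemma smooth_antiderivative:
  assumes "smooth \<psi>" "\<And>x. (\<phi> has_real_derivative \<psi> x) (at x)"
  shows "smooth \<phi>" "deriv \<phi> = \<psi>"
proof -
  show d: "deriv \<phi> = \<psi>" using assms(2) DERIV_imp_deriv by blast
  show "smooth \<phi>" unfolding smooth_def
  proof (intro allI)
    fix n x
    show "(deriv ^^ n) \<phi> differentiable (at x)"
    proof (cases n)
      case 0 then show ?thesis using assms(2) real_differentiable_def by auto
    next
      case (Suc k)
      then have "(deriv ^^ n) \<phi> = (deriv ^^ k) \<psi>" by (simp add: funpow_swap1 d)
      then show ?thesis using assms(1) by (simp add: smooth_def)
    qed
  qed
qed

text \<open>
  For \<open>k = 0\<close> this is the classical smooth function with a zero of infinite order; the other
  \<open>k\<close> occur in its derivatives.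
\<close>

definition flat :: "nat \<Rightarrow> real \<Rightarrow> real" where
  "flat k x = (if 0 < x then (1 / x) ^ k * exp (- (1 / x)) else 0)"

lemma flat_tendsto_0: "(flat k \<longlongrightarrow> 0) (at_right 0)"
proof -
  have "((\<lambda>x::real. (inverse x) ^ k / exp (inverse x)) \<longlongrightarrow> 0) (at_right 0)"
    using filterlim_compose[OF tendsto_power_div_exp_0 filterlim_inverse_at_top_right] .
  moreover have "eventually (\<lambda>x. (inverse x) ^ k / exp (inverse x) = flat k x) (at_right 0)"
    unfolding eventually_at_right_field
    by (rule exI[of _ 1]) (simp add: flat_def exp_minus divide_inverse)
  ultimately show ?thesis by (rule Lim_transform_eventually)
qed

text \<open>
  At the origin the difference quotient of \<open>flat k\<close> from the right is \<open>flat (k + 1)\<close>, which tends to 0.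
\<close>

lemma flat_has_deriv:
  "(flat k has_real_derivative flat (k + 2) x - real k * flat (k + 1) x) (at x)"
proof (cases x "0::real" rule: linorder_cases)
  case greater
  have i: "((\<lambda>x. 1 / x) has_real_derivative - ((1 / x)\<^sup>2)) (at x)"
    using greater by (auto intro!: derivative_eq_intros simp: power2_eq_square)
  have "((\<lambda>x. (1 / x) ^ k * exp (- (1 / x))) has_real_derivative
      real k * (- ((1 / x)\<^sup>2) * (1 / x) ^ (k - Suc 0)) * exp (- (1 / x)) +
      exp (- (1 / x)) * - (- ((1 / x)\<^sup>2)) * (1 / x) ^ k) (at x)"
    by (intro DERIV_mult DERIV_power DERIV_fun_exp DERIV_minus i)
  moreover have "real k * (- (y\<^sup>2) * y ^ (k - Suc 0)) * exp (- y) + exp (- y) * - (- (y\<^sup>2)) * y ^ k =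
      y ^ (k + 2) * exp (- y) - real k * (y ^ (k + 1) * exp (- y))" for y
    by (cases k) (simp_all add: algebra_simps power2_eq_square)
  ultimately have "((\<lambda>x. (1 / x) ^ k * exp (- (1 / x))) has_real_derivative flat (k + 2) x - real k * flat (k + 1) x) (at x)"
    using greater by (simp only: flat_def if_True)
  then show ?thesis
    by (rule has_field_derivative_transform_within_open[of _ _ _ "{0<..}"]) (use greater in \<open>auto simp: flat_def\<close>)
next
  case less
  have "((\<lambda>x. 0) has_real_derivative flat (k + 2) x - real k * flat (k + 1) x) (at x)"
    using less by (simp add: flat_def)
  then show ?thesis
    by (rule has_field_derivative_transform_within_open[of _ _ _ "{..<0}"]) (use less in \<open>auto simp: flat_def\<close>)
next
  case equal
  have "((\<lambda>h. (flat k (0 + h) - flat k 0) / h) \<longlongrightarrow> 0) (at 0)"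
  proof (rule filterlim_split_at)
    show "((\<lambda>h. (flat k (0 + h) - flat k 0) / h) \<longlongrightarrow> 0) (at_left 0)"
      by (rule tendsto_eventually) (auto simp: eventually_at_left_field flat_def intro!: exI[of _ "-1"])
    have "eventually (\<lambda>h. flat (k + 1) h = (flat k (0 + h) - flat k 0) / h) (at_right 0)"
      by (auto simp: eventually_at_right_field flat_def intro!: exI[of _ 1])
    then show "((\<lambda>h. (flat k (0 + h) - flat k 0) / h) \<longlongrightarrow> 0) (at_right 0)"
      by (rule Lim_transform_eventually[OF flat_tendsto_0])
  qed
  then show ?thesis using equal by (simp add: DERIV_def flat_def)
qed

text \<open>
  A class that is closed under differentiation. All its members are therefore smooth, and cut-off
  functions built from \<open>flat\<close> need no separate treatment of their higher derivatives.
\<close>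

inductive flat_algebra :: "(real \<Rightarrow> real) \<Rightarrow> bool" where
  flat: "flat_algebra (\<lambda>x. flat k (a * x + b))"
| const: "flat_algebra (\<lambda>x. c)"
| add: "flat_algebra f \<Longrightarrow> flat_algebra g \<Longrightarrow> flat_algebra (\<lambda>x. f x + g x)"
| mult: "flat_algebra f \<Longrightarrow> flat_algebra g \<Longrightarrow> flat_algebra (\<lambda>x. f x * g x)"
| exp: "flat_algebra f \<Longrightarrow> flat_algebra (\<lambda>x. exp (f x))"

lemma flat_algebra_deriv:
  "flat_algebra f \<Longrightarrow> \<exists>f'. flat_algebra f' \<and> (\<forall>x. (f has_real_derivative f' x) (at x))"
proof (induction rule: flat_algebra.induct)
  case (flat k a b)
  have "((\<lambda>x. flat k (a * x + b)) has_real_derivative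
      (flat (k + 2) (a * x + b) + - real k * flat (k + 1) (a * x + b)) * a) (at x)" for x
    by (rule DERIV_chain2[where f = "flat k", THEN DERIV_cong, OF flat_has_deriv])
       (auto intro!: derivative_eq_intros)
  moreover have "flat_algebra (\<lambda>x. (flat (k + 2) (a * x + b) + - real k * flat (k + 1) (a * x + b)) * a)"
    by (intro flat_algebra.intros)
  ultimately show ?case by blast
next
  case (const c)
  show ?case by (intro exI[of _ "\<lambda>x. 0"] conjI flat_algebra.const) auto
next
  case (add f g)
  then obtain f' g' where *: "flat_algebra f'" "flat_algebra g'" "\<And>x. (f has_real_derivative f' x) (at x)"
    "\<And>x. (g has_real_derivative g' x) (at x)" by blast
  then show ?case
    by (intro exI[of _ "\<lambda>x. f' x + g' x"] conjI flat_algebra.add allI DERIV_add)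
next
  case (mult f g)
  then obtain f' g' where *: "flat_algebra f'" "flat_algebra g'" "\<And>x. (f has_real_derivative f' x) (at x)"
    "\<And>x. (g has_real_derivative g' x) (at x)" by blast
  then show ?case using mult
    by (intro exI[of _ "\<lambda>x. f' x * g x + g' x * f x"] conjI flat_algebra.add flat_algebra.mult allI DERIV_mult)
next
  case (exp f)
  then obtain f' where *: "flat_algebra f'" "\<And>x. (f has_real_derivative f' x) (at x)" by blast
  have "((\<lambda>x. exp (f x)) has_real_derivative exp (f x) * f' x) (at x)" for x
    by (intro DERIV_fun_exp *)
  then show ?case using exp *
    by (intro exI[of _ "\<lambda>x. exp (f x) * f' x"] conjI flat_algebra.mult flat_algebra.exp allI)
qed

lemma flat_algebra_smooth:
  assumes "flat_algebra f" shows "smooth f"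
  unfolding smooth_def
proof (intro allI)
  fix n x
  have "flat_algebra ((deriv ^^ n) f)"
  proof (induction n)
    case (Suc n)
    then obtain f' where f': "flat_algebra f'" "\<And>x. ((deriv ^^ n) f has_real_derivative f' x) (at x)"
      using flat_algebra_deriv by blast
    then have "(deriv ^^ Suc n) f = f'" using DERIV_imp_deriv by fastforce
    then show ?case using f' by simp
  qed (use assms in simp)
  then show "(deriv ^^ n) f differentiable (at x)"
    using flat_algebra_deriv real_differentiable_def by blast
qed

text \<open>
  Smooth functions with values in \<open>[0, 1]\<close> that increase to the indicator function of the interval
  \<open>(x, y)\<close> as \<open>n\<close> grows: the inner product of two flat functions is positive exactly there.
\<close>

definition plateau :: "real \<Rightarrow> real \<Rightarrow> nat \<Rightarrow> real \<Rightarrow> real" where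
  "plateau x y n t = 1 - exp (- real n * (flat 0 (t - x) * flat 0 (y - t)))"

lemma plateau_flat_algebra: "flat_algebra (plateau x y n)"
proof -
  have "flat_algebra (\<lambda>t. 1 + - 1 * exp (- real n * (flat 0 (1 * t + - x) * flat 0 (- 1 * t + y))))"
    by (intro flat_algebra.intros)
  moreover have "(\<lambda>t. 1 + - 1 * exp (- real n * (flat 0 (1 * t + - x) * flat 0 (- 1 * t + y)))) = plateau x y n"
    by (auto simp: plateau_def)
  ultimately show ?thesis by simp
qed

lemma plateau_range: "0 \<le> plateau x y n t" "plateau x y n t \<le> 1"
  by (auto simp: plateau_def flat_def)

lemma plateau_outside: "t \<notin> {x<..<y} \<Longrightarrow> plateau x y n t = 0"
  by (auto simp: plateau_def flat_def)

lemma plateau_inside: 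
  assumes "t \<in> {x<..<y}" shows "(\<lambda>n. plateau x y n t) \<longlonglongrightarrow> 1"
proof -
  define c where "c = flat 0 (t - x) * flat 0 (y - t)"
  have c: "c > 0" using assms by (auto simp: c_def flat_def)
  have "(\<lambda>n. exp (- c) ^ n) \<longlonglongrightarrow> 0" using c by (intro LIMSEQ_power_zero) simp
  moreover have "exp (- c) ^ n = exp (- real n * c)" for n by (simp flip: exp_of_nat_mult)
  ultimately have "(\<lambda>n. 1 - exp (- real n * c)) \<longlonglongrightarrow> 1 - 0" by (intro tendsto_intros) simp
  then show ?thesis by (simp add: plateau_def c_def)
qed

lemma plateau_continuous: "continuous_on A (plateau x y n)"
  using smooth_has_deriv[OF flat_algebra_smooth[OF plateau_flat_algebra[of x y n]]]
  by (meson DERIV_isCont continuous_at_imp_continuous_on)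

lemma plateau_integral_tendsto:
  fixes w :: "real \<Rightarrow> complex"
  assumes w: "set_integrable lborel {a..b} w" and ab: "a \<le> x" "x \<le> y" "y \<le> b"
  shows "(\<lambda>n. LINT t:{a..b}|lborel. of_real (plateau x y n t) * w t) \<longlonglongrightarrow> (LINT t:{x..y}|lborel. w t)"
proof -
  define w' where "w' = (\<lambda>t. indicator {a..b} t *\<^sub>R w t)"
  have iw: "integrable lborel w'" using w by (simp add: w'_def set_integrable_def)
  have [measurable]: "w' \<in> borel_measurable borel" using iw by auto
  have [measurable]: "plateau x y n \<in> borel_measurable borel" for n
    by (rule borel_measurable_continuous_onI[OF plateau_continuous])
  have "(\<lambda>n. LINT t|lborel. of_real (plateau x y n t) * w' t) \<longlonglongrightarrow> (LINT t|lborel. indicator {x<..<y} t *\<^sub>R w' t)"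
  proof (rule integral_dominated_convergence[where w = "\<lambda>t. norm (w' t)"])
    show "AE t in lborel. (\<lambda>n. of_real (plateau x y n t) * w' t) \<longlonglongrightarrow> indicator {x<..<y} t *\<^sub>R w' t"
    proof (rule AE_I2)
      fix t
      have "(\<lambda>n. complex_of_real (plateau x y n t) * w' t) \<longlonglongrightarrow> complex_of_real (indicator {x<..<y} t) * w' t"
        using plateau_inside[of t x y] plateau_outside[of t x y]
        by (intro tendsto_intros) (auto simp: indicator_def)
      then show "(\<lambda>n. of_real (plateau x y n t) * w' t) \<longlonglongrightarrow> indicator {x<..<y} t *\<^sub>R w' t"
        by (simp add: scaleR_conv_of_real)
    qed
    show "AE t in lborel. norm (of_real (plateau x y n t) * w' t) \<le> norm (w' t)" for n
      using plateau_range by (intro AE_I2) (simp add: norm_mult mult_left_le_one_le)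
  qed (use iw in auto)
  moreover have "(LINT t|lborel. of_real (plateau x y n t) * w' t) = (LINT t:{a..b}|lborel. of_real (plateau x y n t) * w t)" for n
    unfolding set_lebesgue_integral_def w'_def by (intro Bochner_Integration.integral_cong) auto
  moreover have "(LINT t|lborel. indicator {x<..<y} t *\<^sub>R w' t) = (LINT t:{x..y}|lborel. w t)"
    unfolding set_lebesgue_integral_def
  proof (rule integral_cong_AE)
    show "AE t in lborel. indicator {x<..<y} t *\<^sub>R w' t = indicator {x..y} t *\<^sub>R w t"
      using AE_lborel_singleton[of x] AE_lborel_singleton[of y]
      by eventually_elim (use ab in \<open>auto simp: w'_def indicator_def\<close>)
    have eq: "(\<lambda>t. indicator {x..y} t *\<^sub>R w t) = (\<lambda>t. indicator {x..y} t *\<^sub>R w' t)"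
      by (rule ext) (use ab in \<open>auto simp: w'_def indicator_def\<close>)
    show "(\<lambda>t. indicator {x..y} t *\<^sub>R w t) \<in> borel_measurable lborel" unfolding eq by measurable
  qed measurable
  ultimately show ?thesis by simp
qed

section \<open>Weak derivatives and primitives\<close>

lemma antideriv_exists:
  assumes S: "is_interval S" and i: "\<And>x y. x \<in> S \<Longrightarrow> y \<in> S \<Longrightarrow> x \<le> y \<Longrightarrow> set_integrable lborel {x..y} (f :: real \<Rightarrow> complex)"
  obtains F where "antideriv S F f"
proof (cases "S = {}")
  case True
  then show ?thesis using that[of f] by (simp add: antideriv_def)
next
  case False
  then obtain c where c: "c \<in> S" by blast
  define F where "F = (\<lambda>x. if c \<le> x then (LINT t:{c..x}|lborel. f t) else - (LINT t:{x..c}|lborel. f t))"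
  have split: "(LINT t:{x..z}|lborel. f t) = (LINT t:{x..y}|lborel. f t) + (LINT t:{y..z}|lborel. f t)"
    if "x \<in> S" "z \<in> S" "x \<le> y" "y \<le> z" for x y z
    using that i by (intro set_integral_split) auto
  have "antideriv S F f"
    unfolding antideriv_def
  proof (intro ballI impI conjI)
    fix x y assume xy: "x \<in> S" "y \<in> S" "x \<le> y"
    show "set_integrable lborel {x..y} f" using xy i by blast
    show "F y - F x = (LINT t:{x..y}|lborel. f t)"
    proof (cases "c \<le> x")
      case True
      then show ?thesis using split[of c y x] xy c by (simp add: F_def)
    next
      case False
      show ?thesis
      proof (cases "c \<le> y")
        case True
        then show ?thesis using split[of x y c] xy c False by (simp add: F_def)
      next
        case False': False
        then show ?thesis using split[of x c y] xy c False by (simp add: F_def)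
      qed
    qed
  qed
  then show ?thesis by (rule that)
qed

lemma loc_integrableD_Icc:
  assumes "loc_integrable S u" "is_interval S" "x \<in> S" "y \<in> S"
  shows "set_integrable lborel {x..y} u"
  using assms interval_Icc_subset by (simp add: loc_integrable_def)

lemma compact_subset_interval:
  assumes S: "is_interval (S::real set)" "open S" and K: "compact K" "K \<subseteq> S" "K \<noteq> {}"
  obtains a b where "a \<in> S" "b \<in> S" "K \<subseteq> {a<..<b}"
proof -
  obtain m where m: "m \<in> K" "\<And>x. x \<in> K \<Longrightarrow> m \<le> x" using compact_attains_inf[OF K(1,3)] by blast
  obtain M where M: "M \<in> K" "\<And>x. x \<in> K \<Longrightarrow> x \<le> M" using compact_attains_sup[OF K(1,3)] by blast
  obtain e where e: "e > 0" "cball m e \<subseteq> S" using S(2) m K open_contains_cball by (metis subsetD)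
  obtain d where d: "d > 0" "cball M d \<subseteq> S" using S(2) M K open_contains_cball by (metis subsetD)
  show ?thesis
  proof (rule that[of "m - e" "M + d"])
    have "m - e \<in> cball m e" "M + d \<in> cball M d" using e d by (simp_all add: dist_real_def)
    then show "m - e \<in> S" "M + d \<in> S" using e d by blast+
    show "K \<subseteq> {m - e<..<M + d}"
    proof
      fix x assume "x \<in> K"
      then show "x \<in> {m - e<..<M + d}" using m(2)[of x] M(2)[of x] e d by auto
    qed
  qed
qed

lemma loc_integrableI_Icc:
  assumes S: "is_interval S" "open S"
    and i: "\<And>x y. x \<in> S \<Longrightarrow> y \<in> S \<Longrightarrow> x \<le> y \<Longrightarrow> set_integrable lborel {x..y} u"
  shows "loc_integrable S u"
  unfolding loc_integrable_def
proof (intro allI impI)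
  fix K assume K: "compact K \<and> K \<subseteq> S"
  show "set_integrable lborel K u"
  proof (cases "K = {}")
    case False
    then obtain a b where ab: "a \<in> S" "b \<in> S" "K \<subseteq> {a<..<b}" using compact_subset_interval[OF S] K by metis
    then have "a \<le> b" using False by fastforce
    then have "set_integrable lborel {a..b} u" using i ab by blast
    then show ?thesis
      by (rule set_integrable_subset) (use K ab in \<open>auto intro: borel_compact\<close>)
  qed simp
qed

lemma smooth_antideriv:
  assumes "smooth \<phi>"
  shows "antideriv UNIV (\<lambda>x. of_real (\<phi> x)) (\<lambda>x. of_real (deriv \<phi> x))"
  unfolding antideriv_def
proof (intro ballI impI)
  fix x y :: real assume "x \<le> y"
  have c: "continuous_on {x..y} (\<lambda>x. complex_of_real (deriv \<phi> x))"
    using smooth_has_deriv[OF smooth_deriv[OF assms]]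
    by (intro continuous_on_of_real) (meson DERIV_isCont continuous_at_imp_continuous_on)
  have i: "set_integrable lborel {x..y} (\<lambda>x. complex_of_real (deriv \<phi> x))"
    unfolding set_integrable_def by (rule borel_integrable_compact[OF _ c]) simp
  have "((\<lambda>x. complex_of_real (deriv \<phi> x)) has_integral (of_real (\<phi> y) - of_real (\<phi> x))) {x..y}"
  proof (rule fundamental_theorem_of_calculus[OF \<open>x \<le> y\<close>])
    fix t
    have "((\<lambda>x. complex_of_real (\<phi> x)) has_vector_derivative complex_of_real (deriv \<phi> t)) (at t)"
      using smooth_has_deriv[OF assms] by (intro has_vector_derivative_of_real) (simp add: has_real_derivative_iff_has_vector_derivative)
    then show "((\<lambda>x. complex_of_real (\<phi> x)) has_vector_derivative complex_of_real (deriv \<phi> t)) (at t within {x..y})"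
      by (rule has_vector_derivative_at_within)
  qed
  from integral_unique[OF this]
  show "set_integrable lborel {x..y} (\<lambda>x. complex_of_real (deriv \<phi> x)) \<and>
      complex_of_real (\<phi> y) - of_real (\<phi> x) = (LINT t:{x..y}|lborel. of_real (deriv \<phi> t))"
    unfolding set_borel_integral_eq_integral(2)[OF i] using i by simp
qed

lemma test_fun_smooth: "test_fun S \<phi> \<Longrightarrow> smooth \<phi>"
  by (simp add: test_fun_def smooth_def)

lemma zero_outside_imp_deriv_zero:
  assumes z: "\<And>x. x \<notin> {a..b} \<Longrightarrow> \<phi> x = (0::real)" and "x \<notin> {a..b}"
  shows "deriv \<phi> x = 0"
proof -
  have "((\<lambda>x. 0) has_real_derivative 0) (at x)" by simp
  then have "(\<phi> has_real_derivative 0) (at x)"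
    by (rule has_field_derivative_transform_within_open[of _ _ _ "- {a..b}"]) (use assms in auto)
  then show ?thesis by (rule DERIV_imp_deriv)
qed

lemma test_fun_support:
  assumes S: "is_interval S" "open S" and t: "test_fun S \<phi>"
  obtains "\<And>x. \<phi> x = 0" | a b where "a \<in> S" "b \<in> S" "a < b" "\<And>x. x \<notin> {a<..<b} \<Longrightarrow> \<phi> x = 0"
proof (cases "closure {x. \<phi> x \<noteq> 0} = {}")
  case True
  then have "\<phi> x = 0" for x using closure_subset[of "{x. \<phi> x \<noteq> 0}"] by auto
  then show ?thesis by (rule that(1))
next
  case False
  then obtain a b where ab: "a \<in> S" "b \<in> S" "closure {x. \<phi> x \<noteq> 0} \<subseteq> {a<..<b}"
    using compact_subset_interval[OF S, of "closure {x. \<phi> x \<noteq> 0}"] t unfolding test_fun_def by metis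
  then have "a < b" using False by fastforce
  moreover have "\<phi> x = 0" if "x \<notin> {a<..<b}" for x
    using ab(3) that closure_subset[of "{x. \<phi> x \<noteq> 0}"] by blast
  ultimately show ?thesis using ab that(2) by blast
qed

lemma set_integral_restrict_support:
  fixes f :: "real \<Rightarrow> complex"
  assumes "{a..b} \<subseteq> S" "\<And>x. x \<notin> {a..b} \<Longrightarrow> f x = 0"
  shows "(LINT x:S|lborel. f x) = (LINT x:{a..b}|lborel. f x)"
  unfolding set_lebesgue_integral_def
  by (intro Bochner_Integration.integral_cong refl) (use assms in \<open>auto simp: indicator_def\<close>)

lemma test_fun_parts:
  assumes S: "is_interval S" "open S" and V: "antideriv S V v" and t: "test_fun S \<phi>"
  shows "(LINT x:S|lborel. deriv \<phi> x *\<^sub>R V x) = - (LINT x:S|lborel. \<phi> x *\<^sub>R v x)"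
proof (rule test_fun_support[OF S t])
  assume z: "\<And>x. \<phi> x = 0"
  then have "\<phi> = (\<lambda>x. 0)" by auto
  then show ?thesis by simp
next
  fix a b assume ab: "a \<in> S" "b \<in> S" "a < b" and z: "\<And>x. x \<notin> {a<..<b} \<Longrightarrow> \<phi> x = 0"
  have sub: "{a..b} \<subseteq> S" using interval_Icc_subset[OF S(1)] ab by blast
  have z': "deriv \<phi> x = 0" if "x \<notin> {a..b}" for x
    by (rule zero_outside_imp_deriv_zero[OF _ that]) (use z in auto)
  have V': "antideriv {a..b} V v" by (rule antideriv_subset[OF V sub])
  have P: "antideriv {a..b} (\<lambda>x. of_real (\<phi> x)) (\<lambda>x. of_real (deriv \<phi> x))"
    by (rule antideriv_subset[OF smooth_antideriv[OF test_fun_smooth[OF t]]]) simp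
  have m: "antideriv {a..b} (\<lambda>x. of_real (\<phi> x) * V x) (\<lambda>x. of_real (deriv \<phi> x) * V x + of_real (\<phi> x) * v x)"
    by (rule antideriv_mult[OF P V']) simp
  have i1: "set_integrable lborel {a..b} (\<lambda>x. of_real (deriv \<phi> x) * V x)"
    using antideriv_integrable[OF P, of a b] ab
    by (intro set_integrable_continuous_mult antideriv_continuous_on_Icc[OF V']) auto
  have i2: "set_integrable lborel {a..b} (\<lambda>x. of_real (\<phi> x) * v x)"
    using set_integrable_continuous_mult[OF antideriv_integrable[OF V', of a b] antideriv_continuous_on_Icc[OF P]] ab
    by (simp add: mult.commute)
  have "0 = of_real (\<phi> b) * V b - of_real (\<phi> a) * V a" using z[of a] z[of b] by simp
  also have "\<dots> = (LINT x:{a..b}|lborel. of_real (deriv \<phi> x) * V x + of_real (\<phi> x) * v x)"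
    by (rule antideriv_diff_eq[OF m]) (use ab in auto)
  also have "\<dots> = (LINT x:{a..b}|lborel. of_real (deriv \<phi> x) * V x) + (LINT x:{a..b}|lborel. of_real (\<phi> x) * v x)"
    by (rule set_integral_add[OF i1 i2])
  finally have e: "(LINT x:{a..b}|lborel. of_real (deriv \<phi> x) * V x) = - (LINT x:{a..b}|lborel. of_real (\<phi> x) * v x)"
    by (simp add: eq_neg_iff_add_eq_0)
  have "(LINT x:S|lborel. deriv \<phi> x *\<^sub>R V x) = (LINT x:{a..b}|lborel. deriv \<phi> x *\<^sub>R V x)"
    using z' by (intro set_integral_restrict_support sub) simp
  moreover have "(LINT x:S|lborel. \<phi> x *\<^sub>R v x) = (LINT x:{a..b}|lborel. \<phi> x *\<^sub>R v x)"
    using z by (intro set_integral_restrict_support sub) auto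
  ultimately show ?thesis using e unfolding scaleR_conv_of_real by (simp only:)
qed

lemma antideriv_imp_weak_deriv:
  assumes S: "is_interval S" "open S" and U: "antideriv S U v"
    and i: "\<And>x y. x \<in> S \<Longrightarrow> y \<in> S \<Longrightarrow> x \<le> y \<Longrightarrow> set_integrable lborel {x..y} u"
    and e: "AE x in lborel. x \<in> S \<longrightarrow> u x = U x"
    and m: "(\<lambda>x. indicator S x *\<^sub>R u x) \<in> borel_measurable lborel"
  shows "has_weak_deriv S u v"
  unfolding has_weak_deriv_def
proof (intro conjI allI impI)
  show "loc_integrable S u" by (rule loc_integrableI_Icc[OF S i])
  show "loc_integrable S v" by (rule loc_integrableI_Icc[OF S]) (rule antideriv_integrable[OF U])
  fix \<phi> assume t: "test_fun S \<phi>"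
  have mU: "(\<lambda>x. indicator S x *\<^sub>R U x) \<in> borel_measurable lborel"
    using borel_measurable_continuous_on_indicator[OF _ antideriv_continuous_on[OF U S]] S by simp
  have [measurable]: "deriv \<phi> \<in> borel_measurable borel"
    using smooth_has_deriv[OF smooth_deriv[OF test_fun_smooth[OF t]]]
    by (intro borel_measurable_continuous_onI) (meson DERIV_isCont continuous_at_imp_continuous_on)
  have c: "(\<lambda>x. indicator S x *\<^sub>R (deriv \<phi> x *\<^sub>R h x)) = (\<lambda>x. deriv \<phi> x *\<^sub>R (indicator S x *\<^sub>R h x))" for h :: "real \<Rightarrow> complex"
    by (auto simp: mult.commute)
  have "(LINT x:S|lborel. deriv \<phi> x *\<^sub>R u x) = (LINT x:S|lborel. deriv \<phi> x *\<^sub>R U x)"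
    unfolding set_lebesgue_integral_def c
  proof (rule integral_cong_AE)
    show "(\<lambda>x. deriv \<phi> x *\<^sub>R indicator S x *\<^sub>R u x) \<in> borel_measurable lborel"
      by (rule borel_measurable_scaleR[OF _ m]) simp
    show "(\<lambda>x. deriv \<phi> x *\<^sub>R indicator S x *\<^sub>R U x) \<in> borel_measurable lborel"
      by (rule borel_measurable_scaleR[OF _ mU]) simp
    show "AE x in lborel. deriv \<phi> x *\<^sub>R indicat_real S x *\<^sub>R u x = deriv \<phi> x *\<^sub>R indicat_real S x *\<^sub>R U x"
      using e by eventually_elim (auto simp: indicator_def)
  qed
  then show "(LINT x:S|lborel. deriv \<phi> x *\<^sub>R u x) = - (LINT x:S|lborel. \<phi> x *\<^sub>R v x)"
    using test_fun_parts[OF S U t] by simp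
qed

text \<open>
  A combination of two cut-off functions with total integral 0 is the derivative of a compactly
  supported smooth function. These test functions are sufficient to recognise constants.
\<close>

lemma two_plateaus_primitive:
  fixes a b :: real and n :: nat
  assumes ab: "a < x" "x < y" "y < b" "a < c" "c < d" "d < b"
  defines "A \<equiv> integral {a..b} (plateau x y n)" and "B \<equiv> integral {a..b} (plateau c d n)"
  obtains \<phi> where "smooth \<phi>" "\<And>t. t \<notin> {a..b} \<Longrightarrow> \<phi> t = 0"
    "deriv \<phi> = (\<lambda>t. B * plateau x y n t - A * plateau c d n t)"
proof -
  define \<psi> where "\<psi> = (\<lambda>t. B * plateau x y n t - A * plateau c d n t)"
  define \<phi> where "\<phi> = (\<lambda>t. integral {a..t} \<psi>)"
  have cont: "continuous_on S \<psi>" for S unfolding \<psi>_def by (intro continuous_intros plateau_continuous)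
  have "flat_algebra (\<lambda>t. B * plateau x y n t + - A * plateau c d n t)"
    by (intro flat_algebra.intros plateau_flat_algebra)
  then have sm: "smooth \<psi>" using flat_algebra_smooth by (simp add: \<psi>_def)
  have out: "\<psi> t = 0" if "t \<notin> {min x c<..<max y d}" for t
  proof -
    have "t \<notin> {x<..<y}" "t \<notin> {c<..<d}" using that by auto
    then show ?thesis using plateau_outside by (simp add: \<psi>_def)
  qed
  have int_ab: "integral {a..b} \<psi> = 0"
  proof -
    have "integral {a..b} \<psi> = integral {a..b} (\<lambda>t. B * plateau x y n t) - integral {a..b} (\<lambda>t. A * plateau c d n t)"
      unfolding \<psi>_def
      by (intro Henstock_Kurzweil_Integration.integral_diff integrable_continuous_interval continuous_intros plateau_continuous)
    then show ?thesis by (simp add: A_def B_def)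
  qed
  have zr: "\<phi> t = 0" if "t \<ge> max y d" for t
  proof -
    have z: "integral {max y d..s} \<psi> = 0" for s
    proof -
      have "integral {max y d..s} \<psi> = integral {max y d..s} (\<lambda>_. 0)"
        by (rule Henstock_Kurzweil_Integration.integral_cong, rule out) (auto simp: less_max_iff_disj)
      then show ?thesis by simp
    qed
    have "integral {a..s} \<psi> = integral {a..max y d} \<psi>" if "s \<ge> max y d" for s
      using Henstock_Kurzweil_Integration.integral_combine[of a "max y d" s \<psi>] that ab z[of s]
        integrable_continuous_interval[OF cont] by simp
    from this[of t] this[of b] show ?thesis using that ab int_ab by (simp add: \<phi>_def)
  qed
  have zl: "\<phi> t = 0" if "t \<le> min x c" for t
  proof -
    have "integral {a..t} \<psi> = integral {a..t} (\<lambda>_. 0)"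
      by (rule Henstock_Kurzweil_Integration.integral_cong, rule out) (use that in \<open>auto simp: min_less_iff_disj\<close>)
    then show ?thesis by (simp add: \<phi>_def)
  qed
  have D: "(\<phi> has_real_derivative \<psi> t) (at t)" for t
  proof (cases "t < min x c")
    case True
    have "((\<lambda>x. 0) has_real_derivative \<psi> t) (at t)" using out[of t] True by simp
    then show ?thesis
      by (rule has_field_derivative_transform_within_open[of _ _ _ "{..<min x c}"]) (use True zl in auto)
  next
    case False
    then have t: "a < t" using ab by auto
    then have "(\<phi> has_real_derivative \<psi> t) (at t within {a..t + 1})"
      unfolding \<phi>_def by (intro integral_has_real_derivative cont) auto
    then show ?thesis using t by (simp add: at_within_Icc_at)
  qed
  show ?thesis
  proof (rule that[of \<phi>])
    show "smooth \<phi>" by (rule smooth_antiderivative[OF sm D])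
    show "deriv \<phi> = (\<lambda>t. B * plateau x y n t - A * plateau c d n t)"
      using smooth_antiderivative(2)[OF sm D] by (simp add: \<psi>_def)
    fix t assume "t \<notin> {a..b}"
    then show "\<phi> t = 0" using ab zl[of t] zr[of t] by auto
  qed
qed

text \<open>
  The lemma of du Bois-Reymond. The difference \<open>w\<close> of \<open>u\<close> and a primitive of \<open>v\<close> is orthogonal to the
  derivatives of all test functions. Testing with two cut-off functions and letting both tend to
  indicator functions shows that \<open>w\<close> has the same mean over every interval as over one fixed
  interval \<open>[c, d]\<close>, so it equals that mean almost everywhere.
\<close>

lemma weak_deriv_imp_antideriv:
  assumes S: "is_interval S" "open S" and wd: "has_weak_deriv S u v"
  obtains U where "antideriv S U v" "AE x in lborel. x \<in> S \<longrightarrow> u x = U x"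
proof (cases "S = {}")
  case True
  then show ?thesis using that[of u] by (simp add: antideriv_def)
next
  case False
  then obtain s where s: "s \<in> S" by blast
  obtain e where e: "e > 0" "ball s e \<subseteq> S" using S(2) s open_contains_ball by blast
  define c where "c = s - e/2"
  define d where "d = s + e/2"
  have cd: "c < d" "c \<in> S" "d \<in> S" using e by (auto simp: c_def d_def subset_iff dist_real_def)
  have iu: "set_integrable lborel {x..y} u" and iv: "set_integrable lborel {x..y} v" if "x \<in> S" "y \<in> S" for x y
    using wd that S by (auto simp: has_weak_deriv_def intro: loc_integrableD_Icc)
  obtain V where V: "antideriv S V v" using antideriv_exists[OF S(1) iv] by blast
  define w where "w = (\<lambda>x. u x - V x)"
  have iV: "set_integrable lborel {x..y} V" if "x \<in> S" "y \<in> S" for x y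
    unfolding set_integrable_def using interval_Icc_subset[OF S(1)] that
    by (intro borel_integrable_compact continuous_on_subset[OF antideriv_continuous_on[OF V S]]) auto
  have iw: "set_integrable lborel {x..y} w" if "x \<in> S" "y \<in> S" for x y
    unfolding w_def using iu iV that by (intro set_integral_diff) auto
  \<comment> \<open>The mean of \<open>w\<close> over the reference interval.\<close>
  define m where "m = (LINT t:{c..d}|lborel. w t) / of_real (d - c)"
  have key: "(LINT t:{x..y}|lborel. w t - m) = 0" if xy: "x \<in> S" "y \<in> S" "x \<le> y" for x y
  proof (cases "x = y")
    case True
    have "(LINT t:{x..y}|lborel. w t - m) = (LINT t|lborel. 0)" unfolding set_lebesgue_integral_def True
    proof (rule Bochner_Integration.integral_eq_zero_AE[THEN trans])
      show "AE t in lborel. indicat_real {y..y} t *\<^sub>R (w t - m) = 0"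
        using AE_lborel_singleton[of y] by eventually_elim (auto simp: indicator_def)
    qed simp
    then show ?thesis by simp
  next
    case False
    then have "x < y" using xy by simp
    have K: "{x, y, c, d} \<subseteq> S" using xy cd by simp
    obtain a b where ab: "a \<in> S" "b \<in> S" "{x, y, c, d} \<subseteq> {a<..<b}"
      by (rule compact_subset_interval[OF S _ K]) auto
    then have ab': "a < x" "y < b" "a < c" "d < b" by auto
    have sub: "{a..b} \<subseteq> S" using interval_Icc_subset[OF S(1)] ab by blast
    have iwab: "set_integrable lborel {a..b} w" using iw ab by blast
    have i1: "set_integrable lborel {a..b} (\<lambda>_. 1 :: complex)"
      unfolding set_integrable_def by (rule borel_integrable_compact) auto
    define A where "A = (\<lambda>n. integral {a..b} (plateau x y n))"
    define B where "B = (\<lambda>n. integral {a..b} (plateau c d n))"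
    have conv: "(LINT t:{a..b}|lborel. of_real (plateau p q n t) * 1) = complex_of_real (integral {a..b} (plateau p q n))" for p q n
    proof -
      have i: "set_integrable lborel {a..b} (plateau p q n)"
        unfolding set_integrable_def by (rule borel_integrable_compact[OF _ plateau_continuous]) auto
      show ?thesis
        using set_borel_integral_eq_integral(2)[OF i] set_integral_complex_of_real[of lborel "{a..b}" "plateau p q n"] by simp
    qed
    have len: "(LINT t:{p..q}|lborel. 1 :: complex) = of_real (q - p)" if "p \<le> q" for p q :: real
      using that by (simp add: set_lebesgue_integral_def scaleR_conv_of_real)
    have limA: "(\<lambda>n. complex_of_real (A n)) \<longlonglongrightarrow> of_real (y - x)"
      using plateau_integral_tendsto[OF i1, of x y] ab' xy len[of x y] unfolding conv A_def by simp
    have limB: "(\<lambda>n. complex_of_real (B n)) \<longlonglongrightarrow> of_real (d - c)"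
      using plateau_integral_tendsto[OF i1, of c d] ab' cd len[of c d] unfolding conv B_def by simp
    have limw: "(\<lambda>n. LINT t:{a..b}|lborel. of_real (plateau x y n t) * w t) \<longlonglongrightarrow> (LINT t:{x..y}|lborel. w t)"
      using ab' xy by (intro plateau_integral_tendsto iwab) auto
    have limw': "(\<lambda>n. LINT t:{a..b}|lborel. of_real (plateau c d n t) * w t) \<longlonglongrightarrow> (LINT t:{c..d}|lborel. w t)"
      using ab' cd by (intro plateau_integral_tendsto iwab) auto
    have eq: "of_real (B n) * (LINT t:{a..b}|lborel. of_real (plateau x y n t) * w t) =
        of_real (A n) * (LINT t:{a..b}|lborel. of_real (plateau c d n t) * w t)" for n
    proof -
      obtain \<phi> where \<phi>: "smooth \<phi>" "\<And>t. t \<notin> {a..b} \<Longrightarrow> \<phi> t = 0"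
        "deriv \<phi> = (\<lambda>t. B n * plateau x y n t - A n * plateau c d n t)"
        using two_plateaus_primitive[OF ab'(1) \<open>x < y\<close> ab'(2,3) cd(1) ab'(4), of n] unfolding A_def B_def by blast
      have cl: "closure {x. \<phi> x \<noteq> 0} \<subseteq> {a..b}"
        by (rule closure_minimal) (use \<phi>(2) in blast, simp)
      have "compact (closure {x. \<phi> x \<noteq> 0})"
        unfolding compact_closure by (rule bounded_subset[of "{a..b}"]) (use \<phi>(2) in \<open>simp, blast\<close>)
      then have t: "test_fun S \<phi>"
        using \<phi>(1) cl sub by (auto simp: test_fun_def smooth_def)
      have iP: "set_integrable lborel {a..b} (\<lambda>t. w t * of_real (plateau p q n t))" for p q
        by (intro set_integrable_continuous_mult iwab continuous_on_of_real plateau_continuous)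
      have d0: "deriv \<phi> x = 0" if "x \<notin> {a..b}" for x
        by (rule zero_outside_imp_deriv_zero[OF \<phi>(2) that])
      have r: "(LINT x:S|lborel. deriv \<phi> x *\<^sub>R h x) = (LINT x:{a..b}|lborel. h x * of_real (deriv \<phi> x))" for h :: "real \<Rightarrow> complex"
        using set_integral_restrict_support[OF sub, of "\<lambda>x. deriv \<phi> x *\<^sub>R h x"] d0
        by (simp add: scaleR_conv_of_real mult.commute)
      have cd': "continuous_on {a..b} (\<lambda>x. complex_of_real (deriv \<phi> x))"
        unfolding \<phi>(3) by (intro continuous_intros plateau_continuous)
      have "(LINT x:S|lborel. deriv \<phi> x *\<^sub>R u x) = (LINT x:S|lborel. deriv \<phi> x *\<^sub>R V x)"
        using wd t test_fun_parts[OF S V t] by (simp add: has_weak_deriv_def)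
      then have "0 = (LINT x:{a..b}|lborel. u x * of_real (deriv \<phi> x)) - (LINT x:{a..b}|lborel. V x * of_real (deriv \<phi> x))"
        unfolding r by simp
      also have "\<dots> = (LINT x:{a..b}|lborel. u x * of_real (deriv \<phi> x) - V x * of_real (deriv \<phi> x))"
        using iu iV ab by (intro set_integral_diff(2)[symmetric] set_integrable_continuous_mult cd') auto
      also have "\<dots> = (LINT t:{a..b}|lborel. of_real (B n) * (w t * of_real (plateau x y n t)) - of_real (A n) * (w t * of_real (plateau c d n t)))"
        unfolding \<phi>(3) w_def by (simp add: algebra_simps)
      also have "\<dots> = of_real (B n) * (LINT t:{a..b}|lborel. w t * of_real (plateau x y n t)) -
          of_real (A n) * (LINT t:{a..b}|lborel. w t * of_real (plateau c d n t))"
        using set_integral_diff(2)[OF set_integrable_mult_right[of "of_real (B n)", OF iP] set_integrable_mult_right[of "of_real (A n)", OF iP]]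
        by simp
      finally show ?thesis by (simp add: mult.commute)
    qed
    have "of_real (d - c) * (LINT t:{x..y}|lborel. w t) = of_real (y - x) * (LINT t:{c..d}|lborel. w t)"
      using tendsto_mult[OF limB limw] tendsto_mult[OF limA limw'] unfolding eq by (rule LIMSEQ_unique)
    then have "(LINT t:{x..y}|lborel. w t) = of_real (y - x) * m"
      using cd(1) by (simp add: m_def field_simps)
    moreover have "(LINT t:{x..y}|lborel. w t - m) = (LINT t:{x..y}|lborel. w t) - (LINT t:{x..y}|lborel. m)"
      using xy iw by (intro set_integral_diff) (auto simp: set_integrable_def)
    moreover have "(LINT t:{x..y}|lborel. m) = of_real (y - x) * m"
      using xy by (simp add: set_lebesgue_integral_def scaleR_conv_of_real)
    ultimately show ?thesis by simp
  qed
  have "AE x in lborel. x \<in> S \<longrightarrow> w x - m = 0"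
    by (rule interval_integrals_zero_imp_AE_zero[OF S _ key])
       (auto intro!: set_integral_diff iw borel_integrable_compact simp: set_integrable_def[of _ _ "\<lambda>_. m"])
  then have "AE x in lborel. x \<in> S \<longrightarrow> u x = V x + m" by eventually_elim (auto simp: w_def algebra_simps)
  moreover have "antideriv S (\<lambda>x. V x + m) v" using V by (simp add: antideriv_def)
  ultimately show ?thesis using that by blast
qed

section \<open>Sobolev functions\<close>

text \<open>
  Local integrability only speaks of compact subsets; the intervals with rational ends in \<open>S\<close> are a
  countable cover, which glues the pieces.
\<close>

lemma loc_integrable_measurable:
  assumes S: "is_interval S" "open S" and w: "loc_integrable S w"
  shows "(\<lambda>x. indicator S x *\<^sub>R w x) \<in> borel_measurable lborel"
proof -
  define C where "C = insert (- S) ((\<lambda>(a, b). {a..b}) ` ((\<rat> \<inter> S) \<times> (\<rat> \<inter> S)))"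
  have "(\<lambda>x. indicator S x *\<^sub>R w x) \<in> borel_measurable borel"
  proof (rule measurable_piecewise_restrict[of C])
    show "countable C" unfolding C_def by (simp add: countable_Int1 countable_rat)
    show "X \<inter> space borel \<in> sets borel" if "X \<in> C" for X using that S by (auto simp: C_def)
    show "space borel \<subseteq> \<Union> C"
    proof
      fix x :: real
      show "x \<in> \<Union> C"
      proof (cases "x \<in> S")
        case True
        then obtain e where e: "e > 0" "ball x e \<subseteq> S" using \<open>open S\<close> open_contains_ball by blast
        obtain a where a: "a \<in> \<rat>" "x - e < a" "a < x" using Rats_dense_in_real[of "x - e" x] e by auto
        obtain b where b: "b \<in> \<rat>" "x < b" "b < x + e" using Rats_dense_in_real[of x "x + e"] e by auto
        have "a \<in> ball x e" "b \<in> ball x e" using a b by (auto simp: dist_real_def)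
        then have "(a, b) \<in> (\<rat> \<inter> S) \<times> (\<rat> \<inter> S)" using a b e by auto
        moreover have "x \<in> {a..b}" using a b by auto
        ultimately show ?thesis unfolding C_def by blast
      qed (simp add: C_def)
    qed
    fix X assume "X \<in> C"
    then consider "X = - S" | a b where "X = {a..b}" "a \<in> S" "b \<in> S" by (auto simp: C_def)
    then show "(\<lambda>x. indicator S x *\<^sub>R w x) \<in> borel_measurable (restrict_space borel X)"
    proof cases
      case 1
      have "(\<lambda>x. indicator (- S) x *\<^sub>R (indicator S x *\<^sub>R w x)) = (\<lambda>x. 0)" by (auto simp: indicator_def)
      then show ?thesis using S unfolding 1 by (subst borel_measurable_restrict_space_iff) auto
    next
      case 2
      have sub: "{a..b} \<subseteq> S" using interval_Icc_subset[OF S(1)] 2 by blast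
      have "(\<lambda>x. indicator {a..b} x *\<^sub>R w x) \<in> borel_measurable lborel"
        using loc_integrableD_Icc[OF w S(1) 2(2,3)] borel_measurable_integrable unfolding set_integrable_def by blast
      moreover have "(\<lambda>x. indicator {a..b} x *\<^sub>R (indicator S x *\<^sub>R w x)) = (\<lambda>x. indicator {a..b} x *\<^sub>R w x)"
        by (rule ext) (use sub in \<open>auto simp: indicator_def\<close>)
      ultimately show ?thesis unfolding 2 by (subst borel_measurable_restrict_space_iff) auto
    qed
  qed
  then show ?thesis by simp
qed

lemma continuous_AE_zero_imp_zero:
  fixes f :: "real \<Rightarrow> complex"
  assumes S: "open S" and c: "continuous_on S f" and z: "AE x in lborel. x \<in> S \<longrightarrow> f x = 0" and x: "x \<in> S"
  shows "f x = 0"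
proof (rule ccontr)
  assume nz: "f x \<noteq> 0"
  define N where "N = S \<inter> f -` (- {0})"
  have oN: "open N" unfolding N_def using continuous_open_preimage[OF c S, of "- {0}"] by auto
  have "AE x in lborel. x \<notin> N" using z by eventually_elim (auto simp: N_def)
  then have "N \<in> null_sets lborel" using oN by (subst (asm) AE_iff_null_sets[symmetric]) auto
  then have "negligible N" by (simp add: negligible_iff_null_sets null_sets_completionI)
  moreover have "N \<noteq> {}" using x nz by (auto simp: N_def)
  ultimately show False using open_not_negligible[OF oN] by blast
qed

lemma antideriv_loc_integrable:
  assumes S: "is_interval S" "open S" and U: "antideriv S U v"
    and m: "(\<lambda>x. indicator S x *\<^sub>R u x) \<in> borel_measurable lborel" and e: "AE x in lborel. x \<in> S \<longrightarrow> u x = U x"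
    and xy: "x \<in> S" "y \<in> S"
  shows "set_integrable lborel {x..y} u"
proof -
  have sub: "{x..y} \<subseteq> S" using interval_Icc_subset[OF S(1)] xy by blast
  have iU: "integrable lborel (\<lambda>t. indicator {x..y} t *\<^sub>R U t)"
    by (rule borel_integrable_compact) (use continuous_on_subset[OF antideriv_continuous_on[OF U S] sub] in auto)
  have eq: "(\<lambda>t. indicator {x..y} t *\<^sub>R u t) = (\<lambda>t. indicator {x..y} t *\<^sub>R (indicator S t *\<^sub>R u t))"
    by (rule ext) (use sub in \<open>auto simp: indicator_def\<close>)
  have mu: "(\<lambda>t. indicator {x..y} t *\<^sub>R u t) \<in> borel_measurable lborel"
    unfolding eq by (rule borel_measurable_scaleR[OF _ m]) simp
  have ae: "AE t in lborel. indicator {x..y} t *\<^sub>R u t = indicator {x..y} t *\<^sub>R U t"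
    using e by eventually_elim (use sub in \<open>auto simp: indicator_def\<close>)
  show ?thesis unfolding set_integrable_def
    using iU integrable_cong_AE[OF mu borel_measurable_integrable[OF iU] ae] by simp
qed

text \<open>The representative picked by \<open>wderiv\<close> is a density of any primitive representing the function.\<close>

lemma wderiv_of_primitive:
  assumes S: "is_interval S" "open S" and U: "antideriv S U v"
    and m: "(\<lambda>x. indicator S x *\<^sub>R u x) \<in> borel_measurable lborel" and e: "AE x in lborel. x \<in> S \<longrightarrow> u x = U x"
  shows "has_weak_deriv S u (wderiv S u)" "AE x in lborel. x \<in> S \<longrightarrow> wderiv S u x = v x"
    "(\<lambda>x. indicator S x *\<^sub>R wderiv S u x) \<in> borel_measurable lborel"
proof -
  have "has_weak_deriv S u v"
    by (rule antideriv_imp_weak_deriv[OF S U antideriv_loc_integrable[OF S U m e] e m])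
  then show wd: "has_weak_deriv S u (wderiv S u)" unfolding wderiv_def by (rule someI[of "has_weak_deriv S u"])
  then show "(\<lambda>x. indicator S x *\<^sub>R wderiv S u x) \<in> borel_measurable lborel"
    by (intro loc_integrable_measurable[OF S]) (simp add: has_weak_deriv_def)
  obtain U' where U': "antideriv S U' (wderiv S u)" "AE x in lborel. x \<in> S \<longrightarrow> u x = U' x"
    by (rule weak_deriv_imp_antideriv[OF S wd])
  have "AE x in lborel. x \<in> S \<longrightarrow> U' x - U x = 0"
    using U'(2) e by eventually_elim auto
  then have "U' x - U x = 0" if "x \<in> S" for x
    using that by (intro continuous_AE_zero_imp_zero[OF S(2)] continuous_on_diff
      antideriv_continuous_on[OF U'(1) S] antideriv_continuous_on[OF U S])
  then have "antideriv S U (wderiv S u)" by (intro antideriv_cong[OF U'(1)]) auto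
  then show "AE x in lborel. x \<in> S \<longrightarrow> wderiv S u x = v x" by (rule antideriv_unique_AE[OF _ U S])
qed

lemma L2_norm_cong_AE:
  assumes m: "(\<lambda>x. indicator S x *\<^sub>R u x) \<in> borel_measurable lborel" "(\<lambda>x. indicator S x *\<^sub>R v x) \<in> borel_measurable lborel"
    and e: "AE x in lborel. x \<in> S \<longrightarrow> u x = v x"
  shows "L2_norm S u = L2_norm S v"
proof -
  have eq: "(\<lambda>x. indicator S x *\<^sub>R (cmod (h x))\<^sup>2) = (\<lambda>x. (cmod (indicator S x *\<^sub>R h x))\<^sup>2)" for h
    by (auto simp: indicator_def)
  have "(LINT x:S|lborel. (cmod (u x))\<^sup>2) = (LINT x:S|lborel. (cmod (v x))\<^sup>2)"
    unfolding set_lebesgue_integral_def eq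
  proof (rule integral_cong_AE)
    show "(\<lambda>x. (cmod (indicat_real S x *\<^sub>R u x))\<^sup>2) \<in> borel_measurable lborel" using m(1) by measurable
    show "(\<lambda>x. (cmod (indicat_real S x *\<^sub>R v x))\<^sup>2) \<in> borel_measurable lborel" using m(2) by measurable
    show "AE x in lborel. (cmod (indicat_real S x *\<^sub>R u x))\<^sup>2 = (cmod (indicat_real S x *\<^sub>R v x))\<^sup>2"
      using e by eventually_elim (auto simp: indicator_def)
  qed
  then show ?thesis by (simp add: L2_norm_def)
qed

lemma antideriv_measurable:
  assumes S: "is_interval S" "open S" and U: "antideriv S U v"
  shows "(\<lambda>x. indicator S x *\<^sub>R U x) \<in> borel_measurable lborel" "(\<lambda>x. indicator S x *\<^sub>R v x) \<in> borel_measurable lborel"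
proof -
  show "(\<lambda>x. indicator S x *\<^sub>R U x) \<in> borel_measurable lborel"
    using borel_measurable_continuous_on_indicator[OF _ antideriv_continuous_on[OF U S]] S by simp
  show "(\<lambda>x. indicator S x *\<^sub>R v x) \<in> borel_measurable lborel"
    by (rule loc_integrable_measurable[OF S loc_integrableI_Icc[OF S]]) (rule antideriv_integrable[OF U])
qed

text \<open>
  The norms are defined through arbitrary representatives of weak derivatives; for a function given
  by primitives they can be read off the densities.
\<close>

lemma W2_norm_1_eq:
  assumes S: "is_interval S" "open S" and U: "antideriv S U v"
    and m: "(\<lambda>x. indicator S x *\<^sub>R u x) \<in> borel_measurable lborel" and e: "AE x in lborel. x \<in> S \<longrightarrow> u x = U x"
  shows "W2_norm 1 S u = sqrt ((L2_norm S U)\<^sup>2 + (L2_norm S v)\<^sup>2)"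
proof -
  note w = wderiv_of_primitive[OF S U m e] and mm = antideriv_measurable[OF S U]
  show ?thesis using L2_norm_cong_AE[OF m mm(1) e] L2_norm_cong_AE[OF w(3) mm(2) w(2)]
    by (simp add: W2_norm_def)
qed

lemma W2_norm_2_eq:
  assumes S: "is_interval S" "open S" and U: "antideriv S U U1" and U1: "antideriv S U1 u2"
    and m: "(\<lambda>x. indicator S x *\<^sub>R u x) \<in> borel_measurable lborel" and e: "AE x in lborel. x \<in> S \<longrightarrow> u x = U x"
  shows "W2_norm 2 S u = sqrt ((L2_norm S U)\<^sup>2 + (L2_norm S U1)\<^sup>2 + (L2_norm S u2)\<^sup>2)"
proof -
  note w = wderiv_of_primitive[OF S U m e] and mm = antideriv_measurable[OF S U]
  note w' = wderiv_of_primitive[OF S U1 w(3) w(2)] and mm' = antideriv_measurable[OF S U1]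
  show ?thesis using L2_norm_cong_AE[OF m mm(1) e] L2_norm_cong_AE[OF w(3) mm(2) w(2)] L2_norm_cong_AE[OF w'(3) mm'(2) w'(2)]
    by (simp add: W2_norm_def numeral_2_eq_2)
qed

lemma W2_1_primitive:
  assumes S: "is_interval S" "open S" and u: "u \<in> W2 (Suc 0) S"
  obtains U v where "antideriv S U v" "AE x in lborel. x \<in> S \<longrightarrow> u x = U x" "u \<in> L2 S" "v \<in> L2 S"
proof -
  obtain v where v: "u \<in> L2 S" "v \<in> L2 S" "has_weak_deriv S u v" using u by auto
  obtain U where "antideriv S U v" "AE x in lborel. x \<in> S \<longrightarrow> u x = U x"
    by (rule weak_deriv_imp_antideriv[OF S v(3)])
  then show ?thesis by (rule that[OF _ _ v(1,2)])
qed

lemma W2_2_primitives: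
  assumes S: "is_interval S" "open S" and u: "u \<in> W2 2 S"
  obtains U U1 u2 where "antideriv S U U1" "antideriv S U1 u2" "AE x in lborel. x \<in> S \<longrightarrow> u x = U x"
    "u \<in> L2 S" "U \<in> L2 S" "U1 \<in> L2 S" "u2 \<in> L2 S"
proof -
  obtain v where v: "u \<in> L2 S" "v \<in> W2 (Suc 0) S" "has_weak_deriv S u v" using u by (auto simp: numeral_2_eq_2)
  obtain U1 u2 where U1: "antideriv S U1 u2" "AE x in lborel. x \<in> S \<longrightarrow> v x = U1 x" "v \<in> L2 S" "u2 \<in> L2 S"
    by (rule W2_1_primitive[OF S v(2)])
  obtain U where U: "antideriv S U v" "AE x in lborel. x \<in> S \<longrightarrow> u x = U x"
    by (rule weak_deriv_imp_antideriv[OF S v(3)])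
  have m1: "(\<lambda>x. indicator S x *\<^sub>R U1 x) \<in> borel_measurable lborel" by (rule antideriv_measurable(1)[OF S U1(1)])
  have UU1: "antideriv S U U1"
    by (rule antideriv_cong_AE[OF U(1) S(1) _ _ U1(2)]) (use m1 S in \<open>auto simp: set_borel_measurable_def\<close>)
  have s1: "AE x in lborel. x \<in> S \<longrightarrow> U1 x = v x" using U1(2) by eventually_elim auto
  have s2: "AE x in lborel. x \<in> S \<longrightarrow> U x = u x" using U(2) by eventually_elim auto
  show ?thesis
    by (rule that[OF UU1 U1(1) U(2) v(1) L2_cong_AE(1)[OF v(1) antideriv_measurable(1)[OF S UU1] s2]
          L2_cong_AE(1)[OF U1(3) m1 s1] U1(4)])
qed

lemma W2_2_I:
  assumes S: "is_interval S" "open S" and U: "antideriv S U U1" and U1: "antideriv S U1 u2"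
    and L: "U \<in> L2 S" "U1 \<in> L2 S" "u2 \<in> L2 S"
    and m: "(\<lambda>x. indicator S x *\<^sub>R u x) \<in> borel_measurable lborel" and e: "AE x in lborel. x \<in> S \<longrightarrow> u x = U x"
  shows "u \<in> W2 2 S"
proof -
  have m1: "(\<lambda>x. indicator S x *\<^sub>R U1 x) \<in> borel_measurable lborel" by (rule antideriv_measurable(1)[OF S U1(1)])
  have "has_weak_deriv S U1 u2"
    by (rule antideriv_imp_weak_deriv[OF S U1 antideriv_loc_integrable[OF S U1 m1] _ m1]) auto
  then have "U1 \<in> W2 (Suc 0) S" using L by auto
  moreover have "has_weak_deriv S u U1"
    by (rule antideriv_imp_weak_deriv[OF S U antideriv_loc_integrable[OF S U m e] e m])
  moreover have "u \<in> L2 S" by (rule L2_cong_AE(1)[OF L(1) m e])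
  ultimately show ?thesis by (auto simp: numeral_2_eq_2)
qed

lemma W2_Suc_0_I:
  assumes S: "is_interval S" "open S" and U: "antideriv S U v" and L: "U \<in> L2 S" "v \<in> L2 S"
    and m: "(\<lambda>x. indicator S x *\<^sub>R u x) \<in> borel_measurable lborel" and e: "AE x in lborel. x \<in> S \<longrightarrow> u x = U x"
  shows "u \<in> W2 1 S"
proof -
  have "has_weak_deriv S u v"
    by (rule antideriv_imp_weak_deriv[OF S U antideriv_loc_integrable[OF S U m e] e m])
  moreover have "u \<in> L2 S" by (rule L2_cong_AE(1)[OF L(1) m e])
  ultimately show ?thesis using L by auto
qed

section \<open>The Sturm-Liouville system\<close>

lemma antideriv_shift:
  assumes "antideriv S F f"
  shows "antideriv {x. x + c \<in> S} (\<lambda>x. F (x + c)) (\<lambda>x. f (x + c))"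
  unfolding antideriv_def
proof (intro ballI impI)
  fix x y assume xy: "x \<in> {x. x + c \<in> S}" "y \<in> {x. x + c \<in> S}" "x \<le> y"
  have eq: "(\<lambda>t. indicator {x..y} t *\<^sub>R f (t + c)) = (\<lambda>t. indicator {x + c..y + c} (c + 1 * t) *\<^sub>R f (c + 1 * t))"
    by (auto simp: indicator_def add.commute)
  have i: "integrable lborel (\<lambda>t. indicator {x + c..y + c} t *\<^sub>R f t)"
    using antideriv_integrable[OF assms, of "x + c" "y + c"] xy by (simp add: set_integrable_def)
  have "set_integrable lborel {x..y} (\<lambda>t. f (t + c))"
    unfolding set_integrable_def eq by (rule lborel_integrable_real_affine[OF i]) simp
  moreover have "(LINT t:{x..y}|lborel. f (t + c)) = (LINT t:{x + c..y + c}|lborel. f t)"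
    unfolding set_lebesgue_integral_def eq
    using lborel_integral_real_affine[of 1 "\<lambda>t. indicator {x + c..y + c} t *\<^sub>R f t" c] by simp
  ultimately show "set_integrable lborel {x..y} (\<lambda>t. f (t + c)) \<and> F (y + c) - F (x + c) = (LINT t:{x..y}|lborel. f (t + c))"
    using antideriv_diff_eq[OF assms, of "x + c" "y + c"] xy by simp
qed

locale sturm_liouville =
  fixes p q :: "real \<Rightarrow> real" and p0 q1 :: real
  assumes p_cont: "continuous_on UNIV p" and p0: "0 < p0" and p_lower: "\<And>x. p0 \<le> p x"
    and q_meas: "q \<in> borel_measurable borel" and q_bound: "\<And>x. \<bar>q x\<bar> \<le> q1"
begin

text \<open>
  The equation \<open>- (p U')' + (q - \<mu>) U = f\<close> as a first-order system for \<open>U\<close> and its flux \<open>V = p U'\<close>.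
  The flux, unlike the derivative, is differentiated without differentiating \<open>p\<close>.
\<close>

definition sol :: "complex \<Rightarrow> real set \<Rightarrow> (real \<Rightarrow> complex) \<Rightarrow> (real \<Rightarrow> complex) \<Rightarrow> (real \<Rightarrow> complex) \<Rightarrow> bool" where
  "sol \<mu> S U V f \<longleftrightarrow> antideriv S U (\<lambda>x. V x / of_real (p x)) \<and>
     antideriv S V (\<lambda>x. (of_real (q x) - \<mu>) * U x - f x)"

lemma p_pos: "0 < p x" using p0 p_lower[of x] by linarith

lemma q1_nonneg: "0 \<le> q1" using q_bound[of 0] by linarith

text \<open>
  A Lipschitz constant of the system, hence the exponent in Gronwall's inequality.
\<close>

definition growth :: "complex \<Rightarrow> real" where "growth \<mu> = 1 / p0 + q1 + cmod \<mu>"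

lemma growth_nonneg: "0 \<le> growth \<mu>" using p0 q1_nonneg by (simp add: growth_def)

lemma sol_subset: "sol \<mu> S U V f \<Longrightarrow> T \<subseteq> S \<Longrightarrow> sol \<mu> T U V f"
  unfolding sol_def using antideriv_subset by blast

lemma sol_diff:
  assumes "sol \<mu> S U V f" "sol \<mu> S U' V' f'"
  shows "sol \<mu> S (\<lambda>x. U x - U' x) (\<lambda>x. V x - V' x) (\<lambda>x. f x - f' x)"
proof -
  have "antideriv S (\<lambda>x. U x - U' x) (\<lambda>x. V x / of_real (p x) - V' x / of_real (p x))"
    using assms antideriv_diff unfolding sol_def by blast
  moreover have "antideriv S (\<lambda>x. V x - V' x) (\<lambda>x. ((of_real (q x) - \<mu>) * U x - f x) - ((of_real (q x) - \<mu>) * U' x - f' x))"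
    using assms antideriv_diff unfolding sol_def by blast
  ultimately show ?thesis unfolding sol_def by (simp add: diff_divide_distrib algebra_simps)
qed

lemma sol_cmult:
  assumes "sol \<mu> S U V f"
  shows "sol \<mu> S (\<lambda>x. c * U x) (\<lambda>x. c * V x) (\<lambda>x. c * f x)"
proof -
  have "antideriv S (\<lambda>x. c * U x) (\<lambda>x. c * (V x / of_real (p x)))"
    using assms antideriv_cmult unfolding sol_def by blast
  moreover have "antideriv S (\<lambda>x. c * V x) (\<lambda>x. c * ((of_real (q x) - \<mu>) * U x - f x))"
    using assms antideriv_cmult unfolding sol_def by blast
  ultimately show ?thesis unfolding sol_def by (simp add: algebra_simps)
qed

lemma sol_continuous:
  assumes "sol \<mu> {a..b} U V f"
  shows "continuous_on {a..b} U" "continuous_on {a..b} V"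
  using assms antideriv_continuous_on_Icc unfolding sol_def by blast+

lemma sol_gronwall:
  assumes sol: "sol \<mu> {a..b} U V f" and f: "f \<in> L2 {a..b}" and x: "x \<in> {a..b}" and y: "y \<in> {a..b}"
  shows "cmod (U x) + cmod (V x) \<le> (cmod (U y) + cmod (V y) + (LINT t:{a..b}|lborel. cmod (f t))) * exp (growth \<mu> * (b - a))"
proof -
  have ab: "a \<le> b" using x by simp
  note c = sol_continuous[OF sol]
  note U = sol[unfolded sol_def, THEN conjunct1] and V = sol[unfolded sol_def, THEN conjunct2]
  have f1: "set_integrable lborel {a..b} f" by (rule L2_imp_integrable_Icc[OF f ab])
  have fn: "set_integrable lborel {a..b} (\<lambda>t. cmod (f t))" by (rule set_integrable_norm[OF f1])
  show ?thesis
  proof (rule gronwall_two_sided[of a b "\<lambda>x. cmod (U x) + cmod (V x)"])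
    show "continuous_on {a..b} (\<lambda>x. cmod (U x) + cmod (V x))" by (intro continuous_intros c)
    show "0 \<le> (LINT t:{a..b}|lborel. cmod (f t))" by (rule set_integral_nonneg') simp
    fix s t assume st: "a \<le> s" "s \<le> t" "t \<le> b"
    have sub: "{s..t} \<subseteq> {a..b}" using st by auto
    have ce: "continuous_on {s..t} (\<lambda>x. cmod (U x) + cmod (V x))"
      by (rule continuous_on_subset[OF _ sub]) (intro continuous_intros c)
    have ie: "set_integrable lborel {s..t} (\<lambda>x. cmod (U x) + cmod (V x))"
      unfolding set_integrable_def by (rule borel_integrable_compact[OF _ ce]) simp
    have ifn: "set_integrable lborel {s..t} (\<lambda>t. cmod (f t))"
      by (rule set_integrable_subset[OF fn]) (use sub in auto)
    have iU: "set_integrable lborel {s..t} (\<lambda>x. cmod (V x / of_real (p x)))"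
      by (rule set_integrable_norm[OF antideriv_integrable[OF U]]) (use st in auto)
    have iV: "set_integrable lborel {s..t} (\<lambda>x. cmod ((of_real (q x) - \<mu>) * U x - f x))"
      by (rule set_integrable_norm[OF antideriv_integrable[OF V]]) (use st in auto)
    have "\<bar>cmod (U t) + cmod (V t) - (cmod (U s) + cmod (V s))\<bar> \<le> cmod (U t - U s) + cmod (V t - V s)"
      using norm_triangle_ineq3[of "U t" "U s"] norm_triangle_ineq3[of "V t" "V s"] by linarith
    also have "\<dots> \<le> (LINT x:{s..t}|lborel. cmod (V x / of_real (p x))) + (LINT x:{s..t}|lborel. cmod ((of_real (q x) - \<mu>) * U x - f x))"
      using st by (intro add_mono antideriv_norm_le[OF U] antideriv_norm_le[OF V]) auto
    also have "\<dots> = (LINT x:{s..t}|lborel. cmod (V x / of_real (p x)) + cmod ((of_real (q x) - \<mu>) * U x - f x))"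
      by (rule set_integral_add(2)[OF iU iV, symmetric])
    also have "\<dots> \<le> (LINT x:{s..t}|lborel. growth \<mu> * (cmod (U x) + cmod (V x)) + cmod (f x))"
    proof (rule set_integral_mono)
      show "set_integrable lborel {s..t} (\<lambda>x. cmod (V x / of_real (p x)) + cmod ((of_real (q x) - \<mu>) * U x - f x))"
        by (rule set_integral_add(1)[OF iU iV])
      show "set_integrable lborel {s..t} (\<lambda>x. growth \<mu> * (cmod (U x) + cmod (V x)) + cmod (f x))"
        by (intro set_integral_add(1) set_integrable_mult_right ie ifn)
      fix x
      have "cmod (V x / of_real (p x)) \<le> cmod (V x) / p0"
        using p_pos[of x] p_lower[of x] p0 by (simp add: norm_divide frac_le)
      also have "\<dots> \<le> growth \<mu> * cmod (V x)"
        using q1_nonneg by (simp add: growth_def distrib_right)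
      finally have 1: "cmod (V x / of_real (p x)) \<le> growth \<mu> * cmod (V x)" .
      have "cmod (of_real (q x) - \<mu>) \<le> q1 + cmod \<mu>"
        using norm_triangle_ineq4[of "of_real (q x)" \<mu>] q_bound[of x] by simp
      also have "\<dots> \<le> growth \<mu>" using p0 by (simp add: growth_def)
      finally have "cmod ((of_real (q x) - \<mu>) * U x) \<le> growth \<mu> * cmod (U x)"
        by (simp add: norm_mult mult_right_mono)
      then have 2: "cmod ((of_real (q x) - \<mu>) * U x - f x) \<le> growth \<mu> * cmod (U x) + cmod (f x)"
        using norm_triangle_ineq4[of "(of_real (q x) - \<mu>) * U x" "f x"] by linarith
      show "cmod (V x / of_real (p x)) + cmod ((of_real (q x) - \<mu>) * U x - f x) \<le> growth \<mu> * (cmod (U x) + cmod (V x)) + cmod (f x)"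
        using 1 2 by (simp add: distrib_left)
    qed
    also have "\<dots> = growth \<mu> * integral {s..t} (\<lambda>x. cmod (U x) + cmod (V x)) + (LINT x:{s..t}|lborel. cmod (f x))"
      using set_integral_add(2)[OF set_integrable_mult_right[of "growth \<mu>", OF ie] ifn] set_borel_integral_eq_integral(2)[OF ie]
      by simp
    also have "(LINT x:{s..t}|lborel. cmod (f x)) \<le> (LINT x:{a..b}|lborel. cmod (f x))"
      by (rule set_integral_mono_set[OF fn sub]) auto
    finally show "\<bar>cmod (U t) + cmod (V t) - (cmod (U s) + cmod (V s))\<bar>
        \<le> (LINT x:{a..b}|lborel. cmod (f x)) + growth \<mu> * integral {s..t} (\<lambda>x. cmod (U x) + cmod (V x))" by simp
  qed (use x y growth_nonneg in auto)
qed

lemma sol_unique: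
  assumes "sol \<mu> {a..b} U V (\<lambda>_. 0)" "y \<in> {a..b}" "U y = 0" "V y = 0" "x \<in> {a..b}"
  shows "U x = 0" "V x = 0"
proof -
  have "(\<lambda>_. 0) \<in> L2 {a..b}" by (rule continuous_imp_L2_Icc) simp
  from sol_gronwall[OF assms(1) this assms(5,2)] assms(3,4)
  have "cmod (U x) + cmod (V x) \<le> 0" by simp
  then have "cmod (U x) = 0" "cmod (V x) = 0"
    using norm_ge_zero[of "U x"] norm_ge_zero[of "V x"] by linarith+
  then show "U x = 0" "V x = 0" by simp_all
qed

text \<open>
  Pairing with a homogeneous solution eliminates both coefficients and the spectral parameter:
  only the source contributes to the derivative.
\<close>

lemma wronskian:
  assumes "sol \<mu> S U V f" "sol \<mu> S \<phi> \<psi> (\<lambda>_. 0)" "is_interval S"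
  shows "antideriv S (\<lambda>x. U x * \<psi> x - V x * \<phi> x) (\<lambda>x. f x * \<phi> x)"
proof -
  have "antideriv S (\<lambda>x. U x * \<psi> x - V x * \<phi> x)
    (\<lambda>x. (V x / of_real (p x) * \<psi> x + U x * ((of_real (q x) - \<mu>) * \<phi> x - 0)) -
         (((of_real (q x) - \<mu>) * U x - f x) * \<phi> x + V x * (\<psi> x / of_real (p x))))"
    using assms unfolding sol_def by (intro antideriv_diff antideriv_mult) auto
  moreover have "(\<lambda>x. (V x / of_real (p x) * \<psi> x + U x * ((of_real (q x) - \<mu>) * \<phi> x - 0)) -
         (((of_real (q x) - \<mu>) * U x - f x) * \<phi> x + V x * (\<psi> x / of_real (p x)))) = (\<lambda>x. f x * \<phi> x)"
    by (auto simp: algebra_simps)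
  ultimately show ?thesis by simp
qed

text \<open>
  Averaging Gronwall's inequality over its base point turns the reference value into \<open>L\<^sub>2\<close> norms.
\<close>

lemma sol_pointwise_bound:
  assumes sol: "sol \<mu> {s..s+1} U V f" and f: "f \<in> L2 {s..s+1}" and x: "x \<in> {s..s+1}"
  shows "cmod (U x) + cmod (V x) \<le> exp (growth \<mu>) * (L2_norm {s..s+1} U + L2_norm {s..s+1} V + L2_norm {s..s+1} f)"
proof -
  note c = sol_continuous[OF sol]
  define F where "F = (LINT t:{s..s+1}|lborel. cmod (f t))"
  have F: "F \<le> L2_norm {s..s+1} f" using L2_imp_integrable_Icc(2)[OF f] by (simp add: F_def)
  have iU: "set_integrable lborel {s..s+1} (\<lambda>y. cmod (U y))" and iV: "set_integrable lborel {s..s+1} (\<lambda>y. cmod (V y))"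
    unfolding set_integrable_def using c by (intro borel_integrable_compact continuous_intros; simp)+
  have i1: "set_integrable lborel {s..s+1} (\<lambda>y. F)" and i2: "set_integrable lborel {s..s+1} (\<lambda>y. cmod (U x) + cmod (V x))"
    unfolding set_integrable_def by (intro borel_integrable_compact continuous_intros; simp)+
  have c1: "(LINT y:{s..s+1}|lborel. d) = d" for d :: real by (simp add: set_lebesgue_integral_def)
  have iUVF: "set_integrable lborel {s..s+1} (\<lambda>y. cmod (U y) + cmod (V y) + F)"
    by (intro set_integral_add iU iV i1)
  have "cmod (U x) + cmod (V x) = (LINT y:{s..s+1}|lborel. cmod (U x) + cmod (V x))" by (simp only: c1)
  also have "\<dots> \<le> (LINT y:{s..s+1}|lborel. exp (growth \<mu>) * (cmod (U y) + cmod (V y) + F))"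
  proof (rule set_integral_mono[OF i2])
    show "set_integrable lborel {s..s+1} (\<lambda>y. exp (growth \<mu>) * (cmod (U y) + cmod (V y) + F))"
      by (intro set_integrable_mult_right iUVF)
    show "cmod (U x) + cmod (V x) \<le> exp (growth \<mu>) * (cmod (U y) + cmod (V y) + F)" if "y \<in> {s..s+1}" for y
      using sol_gronwall[OF sol f x that] by (simp add: F_def mult.commute)
  qed
  also have "\<dots> = exp (growth \<mu>) * ((LINT y:{s..s+1}|lborel. cmod (U y)) + (LINT y:{s..s+1}|lborel. cmod (V y)) + F)"
    using set_integral_add(2)[OF set_integral_add(1)[OF iU iV] i1] set_integral_add(2)[OF iU iV] c1 by simp
  also have "\<dots> \<le> exp (growth \<mu>) * (L2_norm {s..s+1} U + L2_norm {s..s+1} V + L2_norm {s..s+1} f)"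
    using L2_imp_integrable_Icc(2)[OF continuous_imp_L2_Icc[OF c(1)]] L2_imp_integrable_Icc(2)[OF continuous_imp_L2_Icc[OF c(2)]] F
    by (intro mult_left_mono add_mono) auto
  finally show ?thesis .
qed

end

section \<open>Recurrences over the integers and period cells\<close>

text \<open>
  Since \<open>c y + G\<close> is the convex combination of \<open>y\<close> and \<open>G / (1 - c)\<close> with weights \<open>c\<close> and \<open>1 - c\<close>,
  convexity of the square yields an inequality that can be summed and solved for the sum.
\<close>

lemma l2_contraction:
  fixes x y G :: "int \<Rightarrow> real"
  assumes nn: "\<And>n. 0 \<le> x n" "\<And>n. 0 \<le> y n"
    and sx: "(\<lambda>n. (x n)\<^sup>2) summable_on UNIV" and sy: "(\<lambda>n. (y n)\<^sup>2) summable_on UNIV"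
    and sG: "(\<lambda>n. (G n)\<^sup>2) summable_on UNIV"
    and eq: "(\<Sum>\<^sub>\<infinity>n. (x n)\<^sup>2) = (\<Sum>\<^sub>\<infinity>n. (y n)\<^sup>2)"
    and le: "\<And>n. x n \<le> c * y n + G n" and c: "0 \<le> c" "c < 1"
  shows "(\<Sum>\<^sub>\<infinity>n. (x n)\<^sup>2) \<le> (\<Sum>\<^sub>\<infinity>n. (G n)\<^sup>2) / (1 - c)\<^sup>2"
proof -
  have pw: "(x n)\<^sup>2 \<le> c * (y n)\<^sup>2 + (1 / (1 - c)) * (G n)\<^sup>2" for n
  proof -
    have "(1 - c) * (c * y n + G n)\<^sup>2 + c * (G n - (1 - c) * y n)\<^sup>2 = (1 - c) * (c * (y n)\<^sup>2) + (G n)\<^sup>2"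
      by (simp add: power2_eq_square algebra_simps)
    then have "(1 - c) * (c * y n + G n)\<^sup>2 \<le> (1 - c) * (c * (y n)\<^sup>2) + (G n)\<^sup>2"
      using c(1) mult_nonneg_nonneg[OF c(1) zero_le_power2[of "G n - (1 - c) * y n"]] by linarith
    then have "(1 - c) * (c * y n + G n)\<^sup>2 \<le> (1 - c) * (c * (y n)\<^sup>2 + (1 / (1 - c)) * (G n)\<^sup>2)"
      using c(2) by (simp add: distrib_left)
    then have convex: "(c * y n + G n)\<^sup>2 \<le> c * (y n)\<^sup>2 + (1 / (1 - c)) * (G n)\<^sup>2"
      using c(2) by (metis diff_gt_0_iff_gt mult_le_cancel_left_pos)
    have "(x n)\<^sup>2 \<le> (c * y n + G n)\<^sup>2" using le nn by (intro power_mono) auto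
    also note convex
    finally show ?thesis .
  qed
  have "(\<Sum>\<^sub>\<infinity>n. (x n)\<^sup>2) \<le> (\<Sum>\<^sub>\<infinity>n. c * (y n)\<^sup>2 + (1 / (1 - c)) * (G n)\<^sup>2)"
    by (intro infsum_mono sx summable_on_add summable_on_cmult_right sy sG pw)
  also have "\<dots> = (\<Sum>\<^sub>\<infinity>n. c * (y n)\<^sup>2) + (\<Sum>\<^sub>\<infinity>n. (1 / (1 - c)) * (G n)\<^sup>2)"
    by (intro infsum_add summable_on_cmult_right sy sG)
  also have "\<dots> = c * (\<Sum>\<^sub>\<infinity>n. (x n)\<^sup>2) + (1 / (1 - c)) * (\<Sum>\<^sub>\<infinity>n. (G n)\<^sup>2)"
    by (simp only: infsum_cmult_right' eq)
  finally have "(1 - c) * (\<Sum>\<^sub>\<infinity>n. (x n)\<^sup>2) \<le> (\<Sum>\<^sub>\<infinity>n. (G n)\<^sup>2) / (1 - c)" by (simp add: algebra_simps)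
  then have "(\<Sum>\<^sub>\<infinity>n. (x n)\<^sup>2) \<le> (\<Sum>\<^sub>\<infinity>n. (G n)\<^sup>2) / (1 - c) / (1 - c)"
    using c by (subst pos_le_divide_eq) (auto simp: mult.commute)
  then show ?thesis by (simp add: power2_eq_square)
qed

lemma shift_int:
  fixes g :: "int \<Rightarrow> real"
  shows "(\<lambda>n. g (n + 1)) summable_on UNIV \<longleftrightarrow> g summable_on UNIV" "(\<Sum>\<^sub>\<infinity>n. g (n + 1)) = (\<Sum>\<^sub>\<infinity>n. g n)"
proof -
  have b: "bij_betw (\<lambda>n::int. n + 1) UNIV UNIV"
    by (rule bij_betwI[where g = "\<lambda>n. n - 1"]) auto
  show "(\<lambda>n. g (n + 1)) summable_on UNIV \<longleftrightarrow> g summable_on UNIV" by (rule summable_on_reindex_bij_betw[OF b])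
  show "(\<Sum>\<^sub>\<infinity>n. g (n + 1)) = (\<Sum>\<^sub>\<infinity>n. g n)" by (rule infsum_reindex_bij_betw[OF b])
qed

text \<open>
  A multiplier off the unit circle makes the first-order recurrence hyperbolic: it can be solved
  stably in one of the two directions.
\<close>

lemma l2_recurrence:
  fixes a :: "int \<Rightarrow> complex" and G :: "int \<Rightarrow> real"
  assumes sa: "(\<lambda>n. (cmod (a n))\<^sup>2) summable_on UNIV" and sG: "(\<lambda>n. (G n)\<^sup>2) summable_on UNIV"
    and le: "\<And>n. cmod (a (n + 1) - \<rho> * a n) \<le> G n" and \<rho>: "cmod \<rho> \<noteq> 1"
  shows "(\<Sum>\<^sub>\<infinity>n. (cmod (a n))\<^sup>2) \<le> (\<Sum>\<^sub>\<infinity>n. (G n)\<^sup>2) / (1 - cmod \<rho>)\<^sup>2"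
proof -
  note sh = shift_int[of "\<lambda>n. (cmod (a n))\<^sup>2"]
  show ?thesis
  proof (cases "cmod \<rho> < 1")
    case True
    have "cmod (a (n + 1)) \<le> cmod \<rho> * cmod (a n) + G n" for n
      using le[of n] norm_triangle_ineq2[of "a (n + 1)" "\<rho> * a n"] by (simp add: norm_mult)
    from l2_contraction[of "\<lambda>n. cmod (a (n + 1))" "\<lambda>n. cmod (a n)" G, OF _ _ _ sa sG sh(2) this _ True]
    show ?thesis using sh sa by simp
  next
    case False
    then have r: "cmod \<rho> > 1" using \<rho> by simp
    have le': "cmod (a n) \<le> (1 / cmod \<rho>) * cmod (a (n + 1)) + G n / cmod \<rho>" for n
    proof -
      have "cmod \<rho> * cmod (a n) \<le> cmod (a (n + 1)) + G n"
        using le[of n] norm_triangle_ineq3[of "a (n + 1)" "\<rho> * a n"] by (simp add: norm_mult)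
      then have "cmod (a n) \<le> (cmod (a (n + 1)) + G n) / cmod \<rho>" using r by (subst pos_le_divide_eq) (auto simp: mult.commute)
      then show ?thesis by (simp add: add_divide_distrib)
    qed
    have rn: "\<rho> \<noteq> 0" using r by auto
    have r1: "1 / cmod \<rho> < 1" using r by (simp only: divide_less_eq_1_pos[OF order_less_trans[OF zero_less_one r]])
    have sG': "(\<lambda>n. (G n / cmod \<rho>)\<^sup>2) summable_on UNIV"
      using summable_on_cmult_left[OF sG, of "inverse ((cmod \<rho>)\<^sup>2)"] by (simp add: divide_inverse power_mult_distrib power_inverse)
    have iG': "(\<Sum>\<^sub>\<infinity>n. (G n / cmod \<rho>)\<^sup>2) = (\<Sum>\<^sub>\<infinity>n. (G n)\<^sup>2) / (cmod \<rho>)\<^sup>2"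
      using infsum_cmult_left'[of "\<lambda>n. (G n)\<^sup>2" "inverse ((cmod \<rho>)\<^sup>2)" UNIV] by (simp add: divide_inverse power_mult_distrib power_inverse)
    have "(\<Sum>\<^sub>\<infinity>n. (cmod (a n))\<^sup>2) \<le> (\<Sum>\<^sub>\<infinity>n. (G n / cmod \<rho>)\<^sup>2) / (1 - 1 / cmod \<rho>)\<^sup>2"
      by (rule l2_contraction[of "\<lambda>n. cmod (a n)" "\<lambda>n. cmod (a (n + 1))", OF _ _ sa _ sG' _ le' _ r1]) (use r sh sa in auto)
    also have "\<dots> = (\<Sum>\<^sub>\<infinity>n. (G n)\<^sup>2) / (cmod \<rho> * (1 - 1 / cmod \<rho>))\<^sup>2" by (simp add: iG' power_mult_distrib)
    also have "cmod \<rho> * (1 - 1 / cmod \<rho>) = cmod \<rho> - 1" using rn by (simp add: right_diff_distrib)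
    finally show ?thesis by (simp add: power2_commute)
  qed
qed

abbreviation cell :: "real \<Rightarrow> int \<Rightarrow> real set" where
  "cell x0 n \<equiv> {x0 + of_int n..x0 + of_int n + 1}"

lemma sum_cells:
  fixes g :: "real \<Rightarrow> real"
  assumes g: "set_integrable lborel UNIV g"
  shows "(\<Sum>n\<in>{- int N..<int N}. (LINT t:cell x0 n|lborel. g t)) = (LINT t:{x0 - real N..x0 + real N}|lborel. g t)"
proof (induction N)
  case 0
  have "(LINT t:{x0..x0}|lborel. g t) = 0"
    unfolding set_lebesgue_integral_def
  proof (rule integral_eq_zero_AE)
    show "AE t in lborel. indicator {x0..x0} t *\<^sub>R g t = 0"
      using AE_lborel_singleton[of x0] by eventually_elim (auto simp: indicator_def)
  qed
  then show ?case by simp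
next
  case (Suc N)
  have i: "set_integrable lborel {x..y} g" for x y by (rule set_integrable_subset[OF g]) auto
  have e: "{- int (Suc N)..<int (Suc N)} = insert (- int N - 1) (insert (int N) {- int N..<int N})" by auto
  have "(\<Sum>n\<in>{- int (Suc N)..<int (Suc N)}. (LINT t:cell x0 n|lborel. g t)) =
      (LINT t:{x0 - real N - 1..x0 - real N}|lborel. g t) + ((LINT t:{x0 + real N..x0 + real N + 1}|lborel. g t) +
      (LINT t:{x0 - real N..x0 + real N}|lborel. g t))"
    unfolding e using Suc by (subst sum.insert; simp add: add_diff_eq)+
  also have "\<dots> = (LINT t:{x0 - real N - 1..x0 + real N + 1}|lborel. g t)"
    using set_integral_split[OF i, of "x0 - real N - 1" "x0 - real N" "x0 + real N + 1"]
      set_integral_split[OF i, of "x0 - real N" "x0 + real N" "x0 + real N + 1"] by simp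
  finally show ?case by (simp add: algebra_simps)
qed

lemma cells_summable:
  fixes g :: "real \<Rightarrow> real"
  assumes g: "set_integrable lborel UNIV g" and nn: "\<And>x. 0 \<le> g x"
  shows "(\<lambda>n. LINT t:cell x0 n|lborel. g t) summable_on UNIV"
    "(\<Sum>\<^sub>\<infinity>n. (LINT t:cell x0 n|lborel. g t)) \<le> (LINT t:UNIV|lborel. g t)"
proof -
  have b: "(\<Sum>n\<in>F. (LINT t:cell x0 n|lborel. g t)) \<le> (LINT t:UNIV|lborel. g t)" if "finite F" for F
  proof -
    define N where "N = nat (Max (insert 0 (abs ` F))) + 1"
    have "\<bar>n\<bar> < int N" if "n \<in> F" for n
    proof -
      have "\<bar>n\<bar> \<le> Max (insert 0 (abs ` F))" using that \<open>finite F\<close> by (intro Max_ge) auto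
      then show ?thesis unfolding N_def by linarith
    qed
    then have "F \<subseteq> {- int N..<int N}" by fastforce
    then have "(\<Sum>n\<in>F. (LINT t:cell x0 n|lborel. g t)) \<le> (\<Sum>n\<in>{- int N..<int N}. (LINT t:cell x0 n|lborel. g t))"
      by (intro sum_mono2) (auto intro!: set_integral_nonneg' nn)
    also have "\<dots> \<le> (LINT t:UNIV|lborel. g t)"
      unfolding sum_cells[OF g] by (rule set_integral_mono_set[OF g]) (auto simp: nn)
    finally show ?thesis .
  qed
  show s: "(\<lambda>n. LINT t:cell x0 n|lborel. g t) summable_on UNIV"
    by (rule nonneg_bdd_above_summable_on) (auto intro!: bdd_aboveI2 b set_integral_nonneg' nn)
  show "(\<Sum>\<^sub>\<infinity>n. (LINT t:cell x0 n|lborel. g t)) \<le> (LINT t:UNIV|lborel. g t)"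
    by (rule infsum_le_finite_sums[OF s]) (rule b)
qed

lemma integral_le_cells:
  fixes g :: "real \<Rightarrow> real"
  assumes g: "set_integrable lborel UNIV g" and nn: "\<And>x. 0 \<le> g x"
  shows "(LINT t:UNIV|lborel. g t) \<le> (\<Sum>\<^sub>\<infinity>n. (LINT t:cell x0 n|lborel. g t))"
proof -
  have U: "(\<Union>N. {x0 - real N..x0 + real N}) = UNIV"
  proof -
    have "y \<in> (\<Union>N. {x0 - real N..x0 + real N})" for y
      using real_arch_simple[of "\<bar>y - x0\<bar>"] by (auto simp: abs_le_iff algebra_simps)
    then show ?thesis by blast
  qed
  have "(\<lambda>N. LINT t:{x0 - real N..x0 + real N}|lborel. g t) \<longlonglongrightarrow> (LINT t:(\<Union>N. {x0 - real N..x0 + real N})|lborel. g t)"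
    by (rule set_integral_cont_up) (auto simp: incseq_def U g)
  then have "(\<lambda>N. LINT t:{x0 - real N..x0 + real N}|lborel. g t) \<longlonglongrightarrow> (LINT t:UNIV|lborel. g t)" by (simp add: U)
  then show ?thesis
  proof (rule LIMSEQ_le_const2)
    have "(LINT t:{x0 - real N..x0 + real N}|lborel. g t) \<le> (\<Sum>\<^sub>\<infinity>n. (LINT t:cell x0 n|lborel. g t))" for N
      unfolding sum_cells[OF g, symmetric]
      by (rule finite_sum_le_infsum[OF cells_summable(1)[OF g nn]]) (auto intro!: set_integral_nonneg' nn)
    then show "\<exists>N. \<forall>n\<ge>N. (LINT t:{x0 - real n..x0 + real n}|lborel. g t) \<le> (\<Sum>\<^sub>\<infinity>n. (LINT t:cell x0 n|lborel. g t))"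
      by blast
  qed
qed

lemma L2_cells:
  assumes "u \<in> L2 UNIV"
  shows "(\<lambda>n. (L2_norm (cell x0 n) u)\<^sup>2) summable_on UNIV" "(\<Sum>\<^sub>\<infinity>n. (L2_norm (cell x0 n) u)\<^sup>2) = (L2_norm UNIV u)\<^sup>2"
  using cells_summable[OF L2_sq_integrable[OF assms]] integral_le_cells[OF L2_sq_integrable[OF assms]]
  unfolding L2_norm_sq by (auto intro!: antisym)

lemma periodic_int:
  fixes h :: "real \<Rightarrow> 'a"
  assumes h: "\<And>x. h (x + 1) = h x"
  shows "h (x + of_int n) = h x"
proof (induction n rule: int_induct[where k = 0])
  case (step1 i)
  then show ?case using h[of "x + of_int i"] by (simp add: algebra_simps)
next
  case (step2 i)
  then show ?case using h[of "x + of_int (i - 1)"] by (simp add: algebra_simps)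
qed simp

locale periodic_sturm_liouville = sturm_liouville +
  assumes p_per: "\<And>x. p (x + 1) = p x" and q_per: "\<And>x. q (x + 1) = q x"
begin

lemma per_int: "p (x + of_int n) = p x" "q (x + of_int n) = q x"
  using periodic_int[where h = p] periodic_int[where h = q] p_per q_per by blast+

lemma sol_shift:
  assumes "sol \<mu> S U V f"
  shows "sol \<mu> {x. x + of_int n \<in> S} (\<lambda>x. U (x + of_int n)) (\<lambda>x. V (x + of_int n)) (\<lambda>x. f (x + of_int n))"
  using assms antideriv_shift[of S _ _ "of_int n"] unfolding sol_def
  by (fastforce simp: per_int dest: antideriv_shift[of S _ _ "of_int n"])

end

section \<open>Decaying solutions on half-lines\<close>

context periodic_sturm_liouville
begin

text \<open>
  The \<open>n\<close>-th unit cell met when moving away from the base point in the direction \<open>\<tau>\<close>; leftwards the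
  first such cell has index \<open>- 1\<close>.
\<close>

definition half_cell :: "int \<Rightarrow> nat \<Rightarrow> int" where
  "half_cell \<tau> n = (if \<tau> = 1 then int n else - int n - 1)"

lemma half_line_cell:
  assumes \<tau>: "\<tau> = 1 \<or> \<tau> = - 1"
  shows "cell e (half_cell \<tau> n) \<subseteq> {x. 0 \<le> of_int \<tau> * (x - e)}" "e + of_int \<tau> * real n \<in> cell e (half_cell \<tau> n)"
    "e + of_int \<tau> * real (Suc n) \<in> cell e (half_cell \<tau> n)" "inj (half_cell \<tau>)"
  using \<tau> by (auto simp: half_cell_def inj_def)

text \<open>
  The values of \<open>U\<close> and \<open>V\<close> at the points \<open>e + \<tau> n\<close> tend to 0 because both functions are square
  integrable. The Wronskian of the solution and its translate by a period is constant, so it is 0,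
  and consecutive Cauchy data are proportional. By uniqueness the factor is the same at every step
  and is not 0; since the data decay, its modulus is less than 1.
\<close>

lemma half_line_decay:
  fixes \<tau> :: int and e :: real
  assumes \<tau>: "\<tau> = 1 \<or> \<tau> = - 1" and sol: "sol \<mu> {x. 0 \<le> of_int \<tau> * (x - e)} U V (\<lambda>_. 0)"
    and L: "U \<in> L2 UNIV" "V \<in> L2 UNIV" and nz: "U e \<noteq> 0 \<or> V e \<noteq> 0"
  obtains \<rho> where "U (e + of_int \<tau>) = \<rho> * U e" "V (e + of_int \<tau>) = \<rho> * V e" "\<rho> \<noteq> 0" "cmod \<rho> < 1"
proof -
  define k where "k = half_cell \<tau>"
  note k = half_line_cell(1,2,3)[OF \<tau>, of e, folded k_def] half_line_cell(4)[OF \<tau>, folded k_def]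
  define pt where "pt = (\<lambda>n. e + of_int \<tau> * real n)"
  have pt: "pt n \<in> cell e (k n)" "pt (Suc n) \<in> cell e (k n)" for n using k(2,3) by (simp_all add: pt_def)
  have pt_shift: "pt (Suc n) = pt n + of_int \<tau>" for n by (simp add: pt_def algebra_simps)
  have pt0: "pt 0 = e" "pt (Suc 0) = e + of_int \<tau>" by (simp_all add: pt_def)
  have sol_cell: "sol \<mu> (cell e (k n)) U V (\<lambda>_. 0)" for n by (rule sol_subset[OF sol k(1)])
  have sol_cell': "sol \<mu> (cell e (k n)) (\<lambda>x. U (x + of_int \<tau>)) (\<lambda>x. V (x + of_int \<tau>)) (\<lambda>_. 0)" for n
  proof -
    have "sol \<mu> {x. x + of_int \<tau> \<in> {x. 0 \<le> of_int \<tau> * (x - e)}} (\<lambda>x. U (x + of_int \<tau>)) (\<lambda>x. V (x + of_int \<tau>)) (\<lambda>_. 0)"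
      by (rule sol_shift[OF sol])
    then show ?thesis
    proof (rule sol_subset)
      have "0 \<le> of_int \<tau> * (x + of_int \<tau> - e)" if "0 \<le> of_int \<tau> * (x - e)" for x using that \<tau> by auto
      then show "cell e (k n) \<subseteq> {x. x + of_int \<tau> \<in> {x. 0 \<le> of_int \<tau> * (x - e)}}" using k(1)[of n] by blast
    qed
  qed
  have step: "U (pt (Suc (Suc n))) = c * U (pt (Suc n)) \<and> V (pt (Suc (Suc n))) = c * V (pt (Suc n))"
    if "U (pt (Suc n)) = c * U (pt n)" "V (pt (Suc n)) = c * V (pt n)" for c n
  proof -
    have s: "sol \<mu> (cell e (k n)) (\<lambda>x. U (x + of_int \<tau>) - c * U x) (\<lambda>x. V (x + of_int \<tau>) - c * V x) (\<lambda>_. 0)"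
      using sol_diff[OF sol_cell'[of n] sol_cmult[OF sol_cell[of n], of c]] by simp
    have z: "U (pt n + of_int \<tau>) - c * U (pt n) = 0" "V (pt n + of_int \<tau>) - c * V (pt n) = 0"
      using that by (simp_all add: pt_shift)
    show ?thesis using sol_unique[OF s pt(1) z pt(2)] by (simp add: pt_shift)
  qed
  have nonzero: "U (pt (Suc n)) \<noteq> 0 \<or> V (pt (Suc n)) \<noteq> 0" if "U (pt n) \<noteq> 0 \<or> V (pt n) \<noteq> 0" for n
    using sol_unique[OF sol_cell[of n] pt(2) _ _ pt(1)] that by blast
  have decay: "(\<lambda>n. cmod (U (pt n)) + cmod (V (pt n))) \<longlonglongrightarrow> 0"
  proof -
    have lim: "(\<lambda>n. L2_norm (cell e (k n)) W) \<longlonglongrightarrow> 0" if "W \<in> L2 UNIV" for W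
    proof -
      have "(\<lambda>n. (L2_norm (cell e n) W)\<^sup>2) summable_on (range k)"
        by (rule summable_on_subset_banach[OF L2_cells(1)[OF that]]) simp
      then have "(\<lambda>n. (L2_norm (cell e (k n)) W)\<^sup>2) summable_on UNIV"
        by (subst (asm) summable_on_reindex[OF k(4)]) (simp add: comp_def)
      then have "summable (\<lambda>n. (L2_norm (cell e (k n)) W)\<^sup>2)"
        by (subst (asm) summable_on_UNIV_nonneg_real_iff) auto
      then have "(\<lambda>n. (L2_norm (cell e (k n)) W)\<^sup>2) \<longlonglongrightarrow> 0" by (rule summable_LIMSEQ_zero)
      then have "(\<lambda>n. sqrt ((L2_norm (cell e (k n)) W)\<^sup>2)) \<longlonglongrightarrow> sqrt 0" by (intro tendsto_intros)
      then show ?thesis by simp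
    qed
    define B where "B = (\<lambda>n. exp (growth \<mu>) * (L2_norm (cell e (k n)) U + L2_norm (cell e (k n)) V + L2_norm (cell e (k n)) (\<lambda>_. 0)))"
    have "B \<longlonglongrightarrow> exp (growth \<mu>) * (0 + 0 + 0)"
      unfolding B_def by (intro tendsto_intros lim L) (auto intro!: L2I simp: set_integrable_def)
    then have B: "B \<longlonglongrightarrow> 0" by simp
    have le: "cmod (U (pt n)) + cmod (V (pt n)) \<le> B n" for n
      unfolding B_def by (rule sol_pointwise_bound[OF sol_cell _ pt(1)]) (rule continuous_imp_L2_Icc, simp)
    have "norm (cmod (U (pt n)) + cmod (V (pt n))) \<le> B n" for n
      using le[of n] by (simp add: abs_of_nonneg)
    then show ?thesis by (intro Lim_null_comparison[OF _ B]) (simp add: always_eventually)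
  qed
  have u0: "(\<lambda>n. U (pt n)) \<longlonglongrightarrow> 0" by (rule Lim_null_comparison[OF _ decay]) simp
  have v0: "(\<lambda>n. V (pt n)) \<longlonglongrightarrow> 0" by (rule Lim_null_comparison[OF _ decay]) simp
  \<comment> \<open>The Wronskian of the solution and its translate, taken at the sample points.\<close>
  define W where "W = (\<lambda>n. U (pt n) * V (pt (Suc n)) - V (pt n) * U (pt (Suc n)))"
  have "W n = W (Suc n)" for n
    using antideriv_constant[OF wronskian[OF sol_cell[of n] sol_cell'[of n]] _ _ pt] by (simp add: W_def pt_shift)
  then have "W n = W 0" for n by (induction n) auto
  then have "W = (\<lambda>_. W 0)" by blast
  moreover have "W \<longlonglongrightarrow> 0 * 0 - 0 * 0" unfolding W_def
    by (intro tendsto_intros u0 v0 LIMSEQ_Suc[OF u0] LIMSEQ_Suc[OF v0])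
  ultimately have "(\<lambda>_::nat. W 0) \<longlonglongrightarrow> 0" by simp
  then have W0: "W 0 = 0" by (simp add: LIMSEQ_const_iff)
  define \<rho> where "\<rho> = (if U e \<noteq> 0 then U (pt 1) / U e else V (pt 1) / V e)"
  have r1: "U (pt (Suc 0)) = \<rho> * U (pt 0)" "V (pt (Suc 0)) = \<rho> * V (pt 0)"
    using W0 nz by (auto simp: W_def \<rho>_def pt0 field_simps)
  have geo: "U (pt (Suc n)) = \<rho> * U (pt n) \<and> V (pt (Suc n)) = \<rho> * V (pt n)" for n
  proof (induction n)
    case (Suc n) then show ?case using step by blast
  qed (use r1 in simp)
  have \<rho>0: "\<rho> \<noteq> 0" using nonzero[of 0] nz r1 pt0 by auto
  have grow: "cmod (U e) \<le> cmod (U (pt n)) \<and> cmod (V e) \<le> cmod (V (pt n))" if "1 \<le> cmod \<rho>" for n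
  proof (induction n)
    case (Suc n)
    have "cmod (U (pt n)) \<le> cmod \<rho> * cmod (U (pt n))" "cmod (V (pt n)) \<le> cmod \<rho> * cmod (V (pt n))"
      using mult_right_mono[OF that norm_ge_zero[of "U (pt n)"]] mult_right_mono[OF that norm_ge_zero[of "V (pt n)"]]
      by simp_all
    then show ?case using Suc geo[of n] by (simp add: norm_mult)
  qed (simp add: pt0)
  have "cmod \<rho> < 1"
  proof (rule ccontr)
    assume "\<not> cmod \<rho> < 1"
    then have g: "cmod (U e) \<le> cmod (U (pt n))" "cmod (V e) \<le> cmod (V (pt n))" for n using grow by auto
    have "cmod (U e) \<le> 0" "cmod (V e) \<le> 0"
      using LIMSEQ_le_const[OF tendsto_norm_zero[OF u0]] LIMSEQ_le_const[OF tendsto_norm_zero[OF v0]] g by blast+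
    then show False using nz by simp
  qed
  then show ?thesis using r1 \<rho>0 by (intro that[of \<rho>]) (simp_all add: pt0)
qed

text \<open>
  A Floquet multiplier together with its eigenvector. The eigenvector of the monodromy matrix is given
  by the solution that it generates on one period cell, so that the matrix itself never appears.
\<close>

definition multiplier :: "complex \<Rightarrow> real \<Rightarrow> (real \<Rightarrow> complex) \<Rightarrow> (real \<Rightarrow> complex) \<Rightarrow> complex \<Rightarrow> bool" where
  "multiplier \<mu> x0 \<phi> \<psi> \<rho> \<longleftrightarrow> sol \<mu> {x0..x0+1} \<phi> \<psi> (\<lambda>_. 0) \<and> (\<phi> x0 \<noteq> 0 \<or> \<psi> x0 \<noteq> 0) \<and>
     \<phi> (x0 + 1) = \<rho> * \<phi> x0 \<and> \<psi> (x0 + 1) = \<rho> * \<psi> x0"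

text \<open>
  Decay to the right gives a multiplier inside the unit circle, decay to the left one outside it.
\<close>

lemma half_line_multiplier:
  fixes \<tau> :: int and e :: real
  assumes \<tau>: "\<tau> = 1 \<or> \<tau> = - 1" and sol: "sol \<mu> {x. 0 \<le> of_int \<tau> * (x - e)} U V (\<lambda>_. 0)"
    and L: "U \<in> L2 UNIV" "V \<in> L2 UNIV" and nz: "U e \<noteq> 0 \<or> V e \<noteq> 0"
  obtains x0 \<rho> where "multiplier \<mu> x0 U V \<rho>" "\<rho> \<noteq> 0" "cmod \<rho> \<noteq> 1"
proof -
  obtain \<rho> where \<rho>: "U (e + of_int \<tau>) = \<rho> * U e" "V (e + of_int \<tau>) = \<rho> * V e" "\<rho> \<noteq> 0" "cmod \<rho> < 1"
    by (rule half_line_decay[OF assms])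
  show ?thesis
  proof (cases "\<tau> = 1")
    case True
    then have "{e..e+1} \<subseteq> {x. 0 \<le> of_int \<tau> * (x - e)}" by auto
    then have "multiplier \<mu> e U V \<rho>" using \<rho> nz True sol_subset[OF sol] by (simp add: multiplier_def)
    then show ?thesis using \<rho> that by simp
  next
    case False
    then have t: "\<tau> = - 1" using \<tau> by simp
    then have "{e - 1..e} \<subseteq> {x. 0 \<le> of_int \<tau> * (x - e)}" by auto
    then have "multiplier \<mu> (e - 1) U V (inverse \<rho>)"
      using \<rho> nz t sol_subset[OF sol] by (simp add: multiplier_def)
    moreover have "cmod (inverse \<rho>) \<noteq> 1" using \<rho>(4) by (simp add: norm_inverse)
    ultimately show ?thesis using \<rho>(3) that by simp
  qed
qed

end

section \<open>The dichotomy estimate\<close>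

lemma sum_sq_le3: "(a + b + c)\<^sup>2 \<le> 3 * (a\<^sup>2 + b\<^sup>2 + (c::real)\<^sup>2)"
proof -
  have "0 \<le> (a - b)\<^sup>2 + (b - c)\<^sup>2 + (a - c)\<^sup>2" by simp
  then show ?thesis by (simp add: power2_eq_square algebra_simps)
qed

lemma sum_sq_le2: "(a + b)\<^sup>2 \<le> 2 * (a\<^sup>2 + (b::real)\<^sup>2)"
  using sum_squares_bound[of a b] by (simp add: power2_sum)

lemma square_summable_bound:
  fixes f g :: "int \<Rightarrow> real"
  assumes "g summable_on UNIV" "\<And>n. 0 \<le> f n" "\<And>n. f n \<le> g n"
  shows "f summable_on UNIV"
  by (rule summable_on_comparison_test[OF assms(1)]) (use assms in auto)

lemma finite_support_summable:
  fixes h :: "int \<Rightarrow> real"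
  assumes "finite J"
  shows "(\<lambda>n. if n \<in> J then h n else 0) summable_on UNIV" "(\<Sum>\<^sub>\<infinity>n. if n \<in> J then h n else 0) = sum h J"
proof -
  have "((\<lambda>n. if n \<in> J then h n else 0) summable_on UNIV) = (h summable_on J)"
    by (rule summable_on_cong_neutral) auto
  then show "(\<lambda>n. if n \<in> J then h n else 0) summable_on UNIV" using assms by (simp add: summable_on_finite)
  have "(\<Sum>\<^sub>\<infinity>n. if n \<in> J then h n else 0) = infsum h J"
    by (rule infsum_cong_neutral) auto
  then show "(\<Sum>\<^sub>\<infinity>n. if n \<in> J then h n else 0) = sum h J" using assms by simp
qed

context periodic_sturm_liouville
begin

lemma multiplier_translate:
  assumes "multiplier \<mu> x0 \<phi> \<psi> \<rho>"
  shows "sol \<mu> (cell x0 n) (\<lambda>x. \<phi> (x - of_int n)) (\<lambda>x. \<psi> (x - of_int n)) (\<lambda>_. 0)"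
proof -
  have "sol \<mu> {x. x + of_int (- n) \<in> {x0..x0+1}} (\<lambda>x. \<phi> (x + of_int (- n))) (\<lambda>x. \<psi> (x + of_int (- n))) (\<lambda>_. 0)"
    using assms unfolding multiplier_def by (intro sol_shift) blast
  moreover have "cell x0 n \<subseteq> {x. x + of_int (- n) \<in> {x0..x0+1}}" by auto
  ultimately have "sol \<mu> (cell x0 n) (\<lambda>x. \<phi> (x + of_int (- n))) (\<lambda>x. \<psi> (x + of_int (- n))) (\<lambda>_. 0)"
    by (rule sol_subset)
  then show ?thesis by simp
qed

text \<open>
  The component of the Cauchy data across the eigenvector is a Wronskian with the translated
  eigensolution. It is therefore multiplied by \<open>1 / \<rho>\<close> over one period, up to the source.
\<close>

lemma multiplier_wronskian_step:
  assumes m: "multiplier \<mu> x0 \<phi> \<psi> \<rho>" and sol: "sol \<mu> (cell x0 n) U V f" and f: "f \<in> L2 (cell x0 n)"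
    and M: "\<And>x. x \<in> {x0..x0+1} \<Longrightarrow> cmod (\<phi> x) \<le> M"
  shows "cmod (\<rho> * (U (x0 + of_int n + 1) * \<psi> x0 - V (x0 + of_int n + 1) * \<phi> x0)
     - (U (x0 + of_int n) * \<psi> x0 - V (x0 + of_int n) * \<phi> x0)) \<le> M * L2_norm (cell x0 n) f"
proof -
  let ?s = "x0 + of_int n"
  note wr = wronskian[OF sol multiplier_translate[OF m]]
  have M0: "0 \<le> M" using order_trans[OF norm_ge_zero M[of x0]] by simp
  have i: "set_integrable lborel (cell x0 n) (\<lambda>x. cmod (f x))"
    by (rule set_integrable_norm[OF L2_imp_integrable_Icc(1)[OF f]]) simp
  have "\<rho> * (U (?s + 1) * \<psi> x0 - V (?s + 1) * \<phi> x0) - (U ?s * \<psi> x0 - V ?s * \<phi> x0) =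
    (U (?s + 1) * \<psi> (?s + 1 - of_int n) - V (?s + 1) * \<phi> (?s + 1 - of_int n)) - (U ?s * \<psi> (?s - of_int n) - V ?s * \<phi> (?s - of_int n))"
    using m by (simp add: multiplier_def algebra_simps)
  also have "cmod \<dots> \<le> (LINT x:cell x0 n|lborel. cmod (f x * \<phi> (x - of_int n)))"
    by (rule antideriv_norm_le[OF wr]) auto
  also have "\<dots> \<le> (LINT x:cell x0 n|lborel. M * cmod (f x))"
  proof (rule set_integral_mono)
    show "set_integrable lborel (cell x0 n) (\<lambda>x. cmod (f x * \<phi> (x - of_int n)))"
      by (rule set_integrable_norm[OF antideriv_integrable[OF wr]]) auto
    show "cmod (f x * \<phi> (x - of_int n)) \<le> M * cmod (f x)" if "x \<in> cell x0 n" for x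
    proof -
      have "cmod (\<phi> (x - of_int n)) \<le> M" by (rule M) (use that in auto)
      from mult_left_mono[OF this norm_ge_zero[of "f x"]] show ?thesis by (simp add: norm_mult mult.commute)
    qed
  qed (intro set_integrable_mult_right i)
  also have "\<dots> = M * (LINT x:cell x0 n|lborel. cmod (f x))" by simp
  also have "\<dots> \<le> M * L2_norm (cell x0 n) f"
    using L2_imp_integrable_Icc(2)[OF f] M0 by (intro mult_left_mono) auto
  finally show ?thesis .
qed

lemma sol_cell_gronwall:
  assumes "sol \<mu> (cell x0 n) U V f" "f \<in> L2 (cell x0 n)" "x \<in> cell x0 n" "y \<in> cell x0 n"
  shows "cmod (U x) + cmod (V x) \<le> exp (growth \<mu>) * (cmod (U y) + cmod (V y) + L2_norm (cell x0 n) f)"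
proof -
  have F: "(LINT t:cell x0 n|lborel. cmod (f t)) \<le> L2_norm (cell x0 n) f"
    using L2_imp_integrable_Icc(2)[OF assms(2)] by simp
  have "cmod (U x) + cmod (V x) \<le> (cmod (U y) + cmod (V y) + (LINT t:cell x0 n|lborel. cmod (f t))) * exp (growth \<mu>)"
    using sol_gronwall[OF assms] by simp
  also have "\<dots> \<le> (cmod (U y) + cmod (V y) + L2_norm (cell x0 n) f) * exp (growth \<mu>)"
    using F by (intro mult_right_mono) auto
  finally show ?thesis by (simp only: mult.commute)
qed

lemma L2_norm_cell_le:
  assumes c: "continuous_on (cell x0 n) U" and B: "\<And>x. x \<in> cell x0 n \<Longrightarrow> cmod (U x) \<le> B"
  shows "L2_norm (cell x0 n) U \<le> B"
proof -
  have B0: "0 \<le> B" using order_trans[OF norm_ge_zero B[of "x0 + of_int n"]] by simp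
  have "L2_norm (cell x0 n) U \<le> B * L2_norm (cell x0 n) (\<lambda>_. 1)"
    using B B0 by (intro L2_bounded_by(2) L2_const_Icc L2_measurable continuous_imp_L2_Icc c) auto
  also have "L2_norm (cell x0 n) (\<lambda>_. 1) = 1" using L2_const_Icc(2)[of "x0 + of_int n" "x0 + of_int n + 1" 1] by simp
  finally show ?thesis by simp
qed

lemma sol_sample_summable:
  assumes J: "finite J" and L: "U \<in> L2 UNIV" "V \<in> L2 UNIV" "f \<in> L2 UNIV"
    and sol: "\<And>n. n \<notin> J \<Longrightarrow> sol \<mu> (cell x0 n) U V f"
  shows "(\<lambda>n. (cmod (U (x0 + of_int n)) + cmod (V (x0 + of_int n)))\<^sup>2) summable_on UNIV"
proof (rule square_summable_bound)
  define y where "y = (\<lambda>n. cmod (U (x0 + of_int n)) + cmod (V (x0 + of_int n)))"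
  let ?h = "\<lambda>n. (exp (growth \<mu>))\<^sup>2 * 3 * ((L2_norm (cell x0 n) U)\<^sup>2 + (L2_norm (cell x0 n) V)\<^sup>2 + (L2_norm (cell x0 n) f)\<^sup>2)
      + (if n \<in> J then (y n)\<^sup>2 else 0)"
  show "?h summable_on UNIV"
    by (intro summable_on_add summable_on_cmult_right L2_cells(1) L finite_support_summable J)
  show "(cmod (U (x0 + of_int n)) + cmod (V (x0 + of_int n)))\<^sup>2 \<le> ?h n" for n
  proof (cases "n \<in> J")
    case False
    have "(y n)\<^sup>2 \<le> (exp (growth \<mu>) * (L2_norm (cell x0 n) U + L2_norm (cell x0 n) V + L2_norm (cell x0 n) f))\<^sup>2"
      unfolding y_def by (intro power_mono sol_pointwise_bound[OF sol[OF False] L2_subset(1)[OF L(3)]]) auto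
    also have "\<dots> \<le> (exp (growth \<mu>))\<^sup>2 * (3 * ((L2_norm (cell x0 n) U)\<^sup>2 + (L2_norm (cell x0 n) V)\<^sup>2 + (L2_norm (cell x0 n) f)\<^sup>2))"
      unfolding power_mult_distrib by (intro mult_left_mono sum_sq_le3) auto
    finally show ?thesis using False by (simp add: y_def mult.assoc)
  qed (simp add: y_def)
qed simp

text \<open>
  Let \<open>a\<close> and \<open>b\<close> be the coordinates of the Cauchy data of \<open>U\<close> at \<open>x0 + n\<close> along the eigenvector and
  across it. The sequence \<open>b\<close> satisfies a recurrence with factor \<open>1 / \<rho>\<close> by the Wronskian identity, and
  then \<open>a\<close> one with factor \<open>\<rho>\<close>, by Gronwall's inequality for \<open>U\<close> minus a multiple of the
  eigensolution. Both factors lie off the unit circle, so the square sums of \<open>a\<close> and \<open>b\<close> over all integers are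
  bounded by those of the defects. In the finitely many cells of \<open>J\<close>, where no equation is known,
  the defect is estimated by the data themselves.
\<close>

lemma dichotomy_estimate:
  assumes m: "multiplier \<mu> x0 \<phi> \<psi> \<rho>" and \<rho>: "\<rho> \<noteq> 0" "cmod \<rho> \<noteq> 1"
  obtains C where "C \<ge> 0"
    "\<And>U V f J. finite J \<Longrightarrow> U \<in> L2 UNIV \<Longrightarrow> V \<in> L2 UNIV \<Longrightarrow> f \<in> L2 UNIV \<Longrightarrow>
       (\<And>n. n \<notin> J \<Longrightarrow> sol \<mu> (cell x0 n) U V f) \<Longrightarrow>
       (L2_norm UNIV U)\<^sup>2 \<le> C * ((L2_norm UNIV f)\<^sup>2 +
         (\<Sum>n\<in>J. (cmod (U (x0 + of_int n)) + cmod (V (x0 + of_int n)) +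
                  (cmod (U (x0 + of_int n + 1)) + cmod (V (x0 + of_int n + 1))) + L2_norm (cell x0 n) U)\<^sup>2))"
proof -
  have sm: "sol \<mu> {x0..x0+1} \<phi> \<psi> (\<lambda>_. 0)" and nz: "\<phi> x0 \<noteq> 0 \<or> \<psi> x0 \<noteq> 0"
    and per: "\<phi> (x0 + 1) = \<rho> * \<phi> x0" "\<psi> (x0 + 1) = \<rho> * \<psi> x0" using m by (simp_all add: multiplier_def)
  obtain M where M: "\<And>x. x \<in> {x0..x0+1} \<Longrightarrow> cmod (\<phi> x) \<le> M"
    using compact_imp_bounded[OF compact_continuous_image[OF sol_continuous(1)[OF sm] compact_Icc]]
    unfolding bounded_iff by (metis image_eqI)
  have M0: "0 \<le> M" using order_trans[OF norm_ge_zero M[of x0]] by simp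
  define N where "N = (cmod (\<phi> x0))\<^sup>2 + (cmod (\<psi> x0))\<^sup>2"
  have N: "N > 0" unfolding N_def using nz by (metis add_nonneg_pos add_pos_nonneg zero_le_power2 zero_less_norm_iff zero_less_power)
  have Nc: "of_real N = \<phi> x0 * cnj (\<phi> x0) + \<psi> x0 * cnj (\<psi> x0)"
    by (simp only: N_def of_real_add complex_norm_square)
  define A where "A = cmod (\<phi> x0) + cmod (\<psi> x0)"
  have A: "A \<ge> 0" by (simp add: A_def)
  define K where "K = exp (growth \<mu>)"
  have K: "K \<ge> 1" using growth_nonneg by (simp add: K_def)
  define r where "r = cmod \<rho>"
  have r: "r > 0" "r \<noteq> 1" using \<rho> by (simp_all add: r_def)
  define c1 where "c1 = M + (r + 1) * A"
  define c2 where "c2 = (A / N) * (K * (A / N + 1) + r + 1)"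
  define c3 where "c3 = K * (A + A / N + 1)"
  have AN: "0 \<le> A / N" using A N by simp
  have K0: "0 \<le> K" and r0: "0 \<le> r" using K r by simp_all
  have c0: "0 \<le> c1" "0 \<le> c2" "0 \<le> c3"
    unfolding c1_def c2_def c3_def
    by (intro mult_nonneg_nonneg add_nonneg_nonneg zero_le_one M0 A AN K0 r0)+
  define Bb where "Bb = (c1 / r)\<^sup>2 / (1 - 1 / r)\<^sup>2"
  define Ba where "Ba = 2 * c2\<^sup>2 * (Bb + 1) / (1 - r)\<^sup>2"
  show ?thesis
  proof (rule that[of "3 * c3\<^sup>2 * (Ba + Bb + 1)"])
    show "0 \<le> 3 * c3\<^sup>2 * (Ba + Bb + 1)" by (simp add: Ba_def Bb_def)
    fix U V f and J :: "int set"
    assume J: "finite J" and L: "U \<in> L2 UNIV" "V \<in> L2 UNIV" "f \<in> L2 UNIV"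
      and sol: "\<And>n. n \<notin> J \<Longrightarrow> sol \<mu> (cell x0 n) U V f"
    define u where "u = (\<lambda>n::int. U (x0 + of_int n))"
    define v where "v = (\<lambda>n::int. V (x0 + of_int n))"
    define y where "y = (\<lambda>n. cmod (u n) + cmod (v n))"
    define F where "F = (\<lambda>n. L2_norm (cell x0 n) f)"
    define h where "h = (\<lambda>n. y n + y (n + 1) + L2_norm (cell x0 n) U)"
    \<comment> \<open>The defect of cell \<open>n\<close>: the norm of the source, or the data themselves in an uncontrolled cell.\<close>
    define G where "G = (\<lambda>n. if n \<in> J then h n else F n)"
    define a where "a = (\<lambda>n. (u n * cnj (\<phi> x0) + v n * cnj (\<psi> x0)) / of_real N)"
    define b where "b = (\<lambda>n. u n * \<psi> x0 - v n * \<phi> x0)"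
    have y0: "0 \<le> y n" for n by (simp add: y_def)
    have h0: "0 \<le> h n" for n using y0 by (simp add: h_def add_nonneg_nonneg)
    have G0: "0 \<le> G n" for n using h0 by (simp add: G_def F_def)
    have fL: "f \<in> L2 (cell x0 n)" for n by (rule L2_subset(1)[OF L(3)]) auto
    have yA: "cmod s * cmod (\<phi> x0) + cmod t * cmod (\<psi> x0) \<le> (cmod s + cmod t) * A"
      "cmod s * cmod (\<psi> x0) + cmod t * cmod (\<phi> x0) \<le> (cmod s + cmod t) * A" for s t :: complex
      by (simp_all add: A_def algebra_simps mult_nonneg_nonneg)
    have b_le: "cmod (b n) \<le> A * y n" for n
      using norm_triangle_ineq4[of "u n * \<psi> x0" "v n * \<phi> x0"] yA(2)[of "u n" "v n"]
      by (simp add: b_def y_def norm_mult mult.commute)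
    have coord: "cmod ((s * cnj (\<phi> x0) + t * cnj (\<psi> x0)) / of_real N) \<le> (A / N) * (cmod s + cmod t)" for s t
    proof -
      have "cmod (s * cnj (\<phi> x0) + t * cnj (\<psi> x0)) \<le> (cmod s + cmod t) * A"
        using norm_triangle_ineq[of "s * cnj (\<phi> x0)" "t * cnj (\<psi> x0)"] yA(1)[of s t] by (simp add: norm_mult)
      then show ?thesis using N by (simp add: norm_divide divide_right_mono mult.commute)
    qed
    have a_le: "cmod (a n) \<le> (A / N) * y n" for n unfolding a_def y_def by (rule coord)
    \<comment> \<open>The vector orthogonal to the eigenvector has the components \<open>cnj (\<psi> x0)\<close> and \<open>- cnj (\<phi> x0)\<close>.\<close>
    have dec: "u n - a n * \<phi> x0 = b n * cnj (\<psi> x0) / of_real N" "v n - a n * \<psi> x0 = - b n * cnj (\<phi> x0) / of_real N" for n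
    proof -
      have Nn: "complex_of_real N \<noteq> 0" using N by simp
      have "u n - a n * \<phi> x0 = (of_real N * u n - (u n * cnj (\<phi> x0) + v n * cnj (\<psi> x0)) * \<phi> x0) / of_real N"
        using Nn by (simp add: a_def diff_divide_distrib)
      also have "of_real N * u n - (u n * cnj (\<phi> x0) + v n * cnj (\<psi> x0)) * \<phi> x0 = b n * cnj (\<psi> x0)"
        unfolding Nc b_def by (simp add: algebra_simps)
      finally show "u n - a n * \<phi> x0 = b n * cnj (\<psi> x0) / of_real N" .
      have "v n - a n * \<psi> x0 = (of_real N * v n - (u n * cnj (\<phi> x0) + v n * cnj (\<psi> x0)) * \<psi> x0) / of_real N"
        using Nn by (simp add: a_def diff_divide_distrib)
      also have "of_real N * v n - (u n * cnj (\<phi> x0) + v n * cnj (\<psi> x0)) * \<psi> x0 = - b n * cnj (\<phi> x0)"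
        unfolding Nc b_def by (simp add: algebra_simps)
      finally show "v n - a n * \<psi> x0 = - b n * cnj (\<phi> x0) / of_real N" .
    qed
    have dec_le: "cmod (u n - a n * \<phi> x0) + cmod (v n - a n * \<psi> x0) = (A / N) * cmod (b n)" for n
      unfolding dec using N by (simp add: norm_mult norm_divide A_def add_divide_distrib distrib_left mult.commute)
    have y_le: "y n \<le> A * cmod (a n) + (A / N) * cmod (b n)" for n
    proof -
      have "cmod (u n) \<le> cmod (a n) * cmod (\<phi> x0) + cmod (u n - a n * \<phi> x0)"
        "cmod (v n) \<le> cmod (a n) * cmod (\<psi> x0) + cmod (v n - a n * \<psi> x0)"
        using norm_triangle_ineq[of "a n * \<phi> x0" "u n - a n * \<phi> x0"] norm_triangle_ineq[of "a n * \<psi> x0" "v n - a n * \<psi> x0"]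
        by (simp_all add: norm_mult)
      then show ?thesis using dec_le[of n] by (simp add: y_def A_def algebra_simps)
    qed
    have step_b: "cmod (\<rho> * b (n + 1) - b n) \<le> c1 * G n" for n
    proof (cases "n \<in> J")
      case True
      have "cmod (\<rho> * b (n + 1) - b n) \<le> r * cmod (b (n + 1)) + cmod (b n)"
        using norm_triangle_ineq4[of "\<rho> * b (n + 1)" "b n"] by (simp add: norm_mult r_def)
      also have "\<dots> \<le> r * (A * h n) + A * h n"
        using b_le[of n] b_le[of "n+1"] r A y0[of n] y0[of "n+1"]
        by (intro add_mono mult_left_mono order_trans[OF b_le]) (auto simp: h_def)
      also have "\<dots> \<le> c1 * G n" using True M0 h0[of n] by (simp add: c1_def G_def algebra_simps)
      finally show ?thesis .
    next
      case False
      have "cmod (\<rho> * b (n + 1) - b n) \<le> M * F n"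
        using multiplier_wronskian_step[OF m sol[OF False] fL M] by (simp add: b_def u_def v_def F_def algebra_simps)
      also have "\<dots> \<le> c1 * G n" using False A r by (simp add: c1_def G_def F_def mult_right_mono)
      finally show ?thesis .
    qed
    have step_a: "cmod (a (n + 1) - \<rho> * a n) \<le> c2 * (cmod (b n) + G n)" for n
    proof (cases "n \<in> J")
      case True
      have "cmod (a (n + 1) - \<rho> * a n) \<le> cmod (a (n + 1)) + r * cmod (a n)"
        using norm_triangle_ineq4[of "a (n + 1)" "\<rho> * a n"] by (simp add: norm_mult r_def)
      also have "\<dots> \<le> (A / N) * h n + r * ((A / N) * h n)"
        using r AN y0[of n] y0[of "n+1"]
        by (intro add_mono mult_left_mono order_trans[OF a_le]) (auto simp: h_def)
      also have "\<dots> = (A / N) * (r + 1) * h n" by (simp add: algebra_simps add_divide_distrib)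
      also have "\<dots> \<le> c2 * h n" unfolding c2_def
        using AN K h0[of n] by (intro mult_right_mono mult_left_mono) auto
      also have "\<dots> \<le> c2 * (cmod (b n) + G n)" using True c0 by (intro mult_left_mono) (auto simp: G_def)
      finally show ?thesis .
    next
      case False
      let ?s = "x0 + of_int n"
      have s: "sol \<mu> (cell x0 n) (\<lambda>x. U x - a n * \<phi> (x - of_int n)) (\<lambda>x. V x - a n * \<psi> (x - of_int n)) f"
        using sol_diff[OF sol[OF False] sol_cmult[OF multiplier_translate[OF m], where c = "a n"]] by simp
      have e: "x0 + of_int n + 1 - of_int n = x0 + 1" "x0 + of_int n - of_int n = x0" by simp_all
      have "cmod (u (n + 1) - a n * (\<rho> * \<phi> x0)) + cmod (v (n + 1) - a n * (\<rho> * \<psi> x0))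
          \<le> K * (cmod (u n - a n * \<phi> x0) + cmod (v n - a n * \<psi> x0) + F n)"
        using sol_cell_gronwall[OF s fL, of "?s + 1" ?s] unfolding e per
        by (simp add: u_def v_def K_def F_def algebra_simps)
      also have "\<dots> = K * ((A / N) * cmod (b n) + G n)" using False by (simp add: dec_le G_def)
      also have "\<dots> \<le> K * ((A / N + 1) * (cmod (b n) + G n))"
        using K mult_nonneg_nonneg[OF AN G0[of n]] norm_ge_zero[of "b n"]
        by (intro mult_left_mono) (simp_all add: algebra_simps)
      finally have d: "cmod (u (n + 1) - a n * (\<rho> * \<phi> x0)) + cmod (v (n + 1) - a n * (\<rho> * \<psi> x0)) \<le> K * (A / N + 1) * (cmod (b n) + G n)"
        by (simp add: mult.assoc)
      have "a (n + 1) - \<rho> * a n = ((u (n + 1) - a n * (\<rho> * \<phi> x0)) * cnj (\<phi> x0) + (v (n + 1) - a n * (\<rho> * \<psi> x0)) * cnj (\<psi> x0)) / of_real N"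
      proof -
        have eq: "(u (n + 1) - a n * (\<rho> * \<phi> x0)) * cnj (\<phi> x0) + (v (n + 1) - a n * (\<rho> * \<psi> x0)) * cnj (\<psi> x0) =
          (u (n + 1) * cnj (\<phi> x0) + v (n + 1) * cnj (\<psi> x0)) - \<rho> * a n * of_real N"
          unfolding Nc by (simp add: algebra_simps)
        have an: "a (n + 1) = (u (n + 1) * cnj (\<phi> x0) + v (n + 1) * cnj (\<psi> x0)) / of_real N" by (simp add: a_def)
        show ?thesis unfolding eq diff_divide_distrib an using N by simp
      qed
      then have "cmod (a (n + 1) - \<rho> * a n) \<le> (A / N) * (cmod (u (n + 1) - a n * (\<rho> * \<phi> x0)) + cmod (v (n + 1) - a n * (\<rho> * \<psi> x0)))"
        using coord by simp
      also have "\<dots> \<le> (A / N) * (K * (A / N + 1) * (cmod (b n) + G n))" by (intro mult_left_mono d AN)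
      also have "\<dots> \<le> (A / N) * ((K * (A / N + 1) + r + 1) * (cmod (b n) + G n))"
        using AN r G0[of n] by (intro mult_left_mono mult_right_mono) auto
      finally show ?thesis by (simp add: c2_def mult.assoc)
    qed
    have U_le: "L2_norm (cell x0 n) U \<le> c3 * (cmod (a n) + cmod (b n) + G n)" for n
    proof (cases "n \<in> J")
      case True
      have "1 * 1 \<le> c3" unfolding c3_def using K A AN by (intro mult_mono) auto
      then have "h n \<le> c3 * h n" using mult_right_mono[OF _ h0[of n], of 1 c3] by simp
      also have "\<dots> \<le> c3 * (cmod (a n) + cmod (b n) + G n)" using True c0 by (intro mult_left_mono) (auto simp: G_def)
      finally show ?thesis using y0[of n] y0[of "n+1"] by (simp add: h_def)
    next
      case False
      have "L2_norm (cell x0 n) U \<le> K * (y n + F n)"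
      proof (rule L2_norm_cell_le[OF sol_continuous(1)[OF sol[OF False]]])
        fix x assume "x \<in> cell x0 n"
        then have "cmod (U x) + cmod (V x) \<le> K * (y n + F n)"
          using sol_cell_gronwall[OF sol[OF False] fL, of x "x0 + of_int n"] by (simp add: K_def y_def u_def v_def F_def)
        then show "cmod (U x) \<le> K * (y n + F n)" using norm_ge_zero[of "V x"] by linarith
      qed
      also have "\<dots> \<le> K * (A * cmod (a n) + (A / N) * cmod (b n) + F n)" using y_le[of n] K by (intro mult_left_mono) auto
      also have "\<dots> \<le> K * ((A + A / N + 1) * (cmod (a n) + cmod (b n) + G n))"
      proof (intro mult_left_mono)
        have "0 \<le> A * (cmod (b n) + G n) + A / N * (cmod (a n) + G n) + (cmod (a n) + cmod (b n))"
          using A AN G0[of n] by (intro add_nonneg_nonneg mult_nonneg_nonneg) auto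
        then show "A * cmod (a n) + (A / N) * cmod (b n) + F n \<le> (A + A / N + 1) * (cmod (a n) + cmod (b n) + G n)"
          using False by (simp add: G_def algebra_simps)
      qed (use K in simp)
      finally show ?thesis by (simp add: c3_def mult.assoc)
    qed
    have sy: "(\<lambda>n. (y n)\<^sup>2) summable_on UNIV"
      using sol_sample_summable[OF J L sol] by (simp add: y_def u_def v_def)
    have sqle: "(cmod z)\<^sup>2 \<le> c\<^sup>2 * (w)\<^sup>2" if "cmod z \<le> c * w" for z c w
      using power_mono[OF that norm_ge_zero, of 2] by (simp add: power_mult_distrib)
    have sa: "(\<lambda>n. (cmod (a n))\<^sup>2) summable_on UNIV"
      by (rule square_summable_bound[OF summable_on_cmult_right[OF sy]]) (auto intro: sqle a_le)
    have sb: "(\<lambda>n. (cmod (b n))\<^sup>2) summable_on UNIV"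
      by (rule square_summable_bound[OF summable_on_cmult_right[OF sy]]) (auto intro: sqle b_le)
    have sF: "(\<lambda>n. (F n)\<^sup>2) summable_on UNIV" and iF: "(\<Sum>\<^sub>\<infinity>n. (F n)\<^sup>2) = (L2_norm UNIV f)\<^sup>2"
      using L2_cells[OF L(3)] by (simp_all add: F_def)
    note sJ = finite_support_summable[OF J, of "\<lambda>n. (h n)\<^sup>2"]
    have Gle: "(G n)\<^sup>2 \<le> (F n)\<^sup>2 + (if n \<in> J then (h n)\<^sup>2 else 0)" for n by (simp add: G_def)
    have sG: "(\<lambda>n. (G n)\<^sup>2) summable_on UNIV"
      by (rule square_summable_bound[OF summable_on_add[OF sF sJ(1)] _ Gle]) simp
    define g where "g = (\<Sum>\<^sub>\<infinity>n. (G n)\<^sup>2)"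
    have g: "g \<le> (L2_norm UNIV f)\<^sup>2 + (\<Sum>n\<in>J. (h n)\<^sup>2)"
      using infsum_mono[OF sG summable_on_add[OF sF sJ(1)] Gle] infsum_add[OF sF sJ(1)] by (simp add: g_def iF sJ(2))
    have g0: "0 \<le> g" by (simp add: g_def infsum_nonneg)
    have b_sum: "(\<Sum>\<^sub>\<infinity>n. (cmod (b n))\<^sup>2) \<le> Bb * g"
    proof -
      have st: "cmod (b (n + 1) - inverse \<rho> * b n) \<le> (c1 / r) * G n" for n
      proof -
        have "b (n + 1) - inverse \<rho> * b n = inverse \<rho> * (\<rho> * b (n + 1) - b n)" using \<rho>(1) by (simp add: right_diff_distrib)
        then have "cmod (b (n + 1) - inverse \<rho> * b n) = cmod (\<rho> * b (n + 1) - b n) / r"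
          by (simp add: norm_mult norm_inverse r_def divide_inverse mult.commute)
        also have "\<dots> \<le> c1 * G n / r" using r by (intro divide_right_mono step_b) auto
        finally show ?thesis by simp
      qed
      have s2: "(\<lambda>n. ((c1 / r) * G n)\<^sup>2) summable_on UNIV"
        unfolding power_mult_distrib by (intro summable_on_cmult_right sG)
      have r': "cmod (inverse \<rho>) \<noteq> 1" using \<rho> by (simp add: norm_inverse)
      from l2_recurrence[OF sb s2 st r'] show ?thesis
        unfolding power_mult_distrib infsum_cmult_right'
        by (simp add: Bb_def g_def norm_inverse norm_divide r_def inverse_eq_divide mult.commute)
    qed
    have sbG: "(\<lambda>n. 2 * c2\<^sup>2 * ((cmod (b n))\<^sup>2 + (G n)\<^sup>2)) summable_on UNIV"
      by (intro summable_on_cmult_right summable_on_add sb sG)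
    have bG: "(c2 * (cmod (b n) + G n))\<^sup>2 \<le> 2 * c2\<^sup>2 * ((cmod (b n))\<^sup>2 + (G n)\<^sup>2)" for n
    proof -
      have "(c2 * (cmod (b n) + G n))\<^sup>2 \<le> c2\<^sup>2 * (2 * ((cmod (b n))\<^sup>2 + (G n)\<^sup>2))"
        unfolding power_mult_distrib by (intro mult_left_mono sum_sq_le2) simp
      then show ?thesis by (simp only: mult_ac)
    qed
    have sbG': "(\<lambda>n. (c2 * (cmod (b n) + G n))\<^sup>2) summable_on UNIV"
      by (rule square_summable_bound[OF sbG _ bG]) simp
    have bG_sum: "(\<Sum>\<^sub>\<infinity>n. (c2 * (cmod (b n) + G n))\<^sup>2) \<le> 2 * c2\<^sup>2 * ((Bb + 1) * g)"
    proof -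
      have "(\<Sum>\<^sub>\<infinity>n. (c2 * (cmod (b n) + G n))\<^sup>2) \<le> (\<Sum>\<^sub>\<infinity>n. 2 * c2\<^sup>2 * ((cmod (b n))\<^sup>2 + (G n)\<^sup>2))"
        by (rule infsum_mono[OF sbG' sbG bG])
      also have "\<dots> = 2 * c2\<^sup>2 * ((\<Sum>\<^sub>\<infinity>n. (cmod (b n))\<^sup>2) + g)"
        by (simp only: infsum_cmult_right' infsum_add[OF sb sG] g_def)
      also have "\<dots> \<le> 2 * c2\<^sup>2 * ((Bb + 1) * g)"
        using b_sum by (intro mult_left_mono) (auto simp: distrib_right)
      finally show ?thesis .
    qed
    have a_sum: "(\<Sum>\<^sub>\<infinity>n. (cmod (a n))\<^sup>2) \<le> Ba * g"
    proof -
      have "(\<Sum>\<^sub>\<infinity>n. (cmod (a n))\<^sup>2) \<le> (\<Sum>\<^sub>\<infinity>n. (c2 * (cmod (b n) + G n))\<^sup>2) / (1 - r)\<^sup>2"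
        using l2_recurrence[OF sa sbG' step_a \<rho>(2)] by (simp add: r_def)
      also have "\<dots> \<le> 2 * c2\<^sup>2 * ((Bb + 1) * g) / (1 - r)\<^sup>2" by (rule divide_right_mono[OF bG_sum]) simp
      finally show ?thesis by (simp add: Ba_def mult.assoc)
    qed
    have sR: "(\<lambda>n. 3 * c3\<^sup>2 * ((cmod (a n))\<^sup>2 + (cmod (b n))\<^sup>2 + (G n)\<^sup>2)) summable_on UNIV"
      by (intro summable_on_cmult_right summable_on_add sa sb sG)
    have "(L2_norm (cell x0 n) U)\<^sup>2 \<le> 3 * c3\<^sup>2 * ((cmod (a n))\<^sup>2 + (cmod (b n))\<^sup>2 + (G n)\<^sup>2)" for n
    proof -
      have "(L2_norm (cell x0 n) U)\<^sup>2 \<le> (c3 * (cmod (a n) + cmod (b n) + G n))\<^sup>2" by (intro power_mono U_le) simp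
      also have "\<dots> \<le> c3\<^sup>2 * (3 * ((cmod (a n))\<^sup>2 + (cmod (b n))\<^sup>2 + (G n)\<^sup>2))"
        unfolding power_mult_distrib by (intro mult_left_mono sum_sq_le3) simp
      finally show ?thesis by (simp only: mult_ac)
    qed
    then have "(L2_norm UNIV U)\<^sup>2 \<le> (\<Sum>\<^sub>\<infinity>n. 3 * c3\<^sup>2 * ((cmod (a n))\<^sup>2 + (cmod (b n))\<^sup>2 + (G n)\<^sup>2))"
      unfolding L2_cells(2)[OF L(1), of x0, symmetric] by (intro infsum_mono L2_cells(1) L sR)
    also have "\<dots> = 3 * c3\<^sup>2 * ((\<Sum>\<^sub>\<infinity>n. (cmod (a n))\<^sup>2) + (\<Sum>\<^sub>\<infinity>n. (cmod (b n))\<^sup>2) + g)"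
      by (simp only: infsum_cmult_right' infsum_add[OF summable_on_add[OF sa sb] sG] infsum_add[OF sa sb] g_def)
    also have "\<dots> \<le> 3 * c3\<^sup>2 * ((Ba + Bb + 1) * g)"
      using a_sum b_sum by (intro mult_left_mono) (auto simp: distrib_right)
    also have "\<dots> \<le> 3 * c3\<^sup>2 * ((Ba + Bb + 1) * ((L2_norm UNIV f)\<^sup>2 + (\<Sum>n\<in>J. (h n)\<^sup>2)))"
      by (intro mult_left_mono g) (simp_all add: Ba_def Bb_def)
    finally show "(L2_norm UNIV U)\<^sup>2 \<le> 3 * c3\<^sup>2 * (Ba + Bb + 1) * ((L2_norm UNIV f)\<^sup>2 +
         (\<Sum>n\<in>J. (cmod (U (x0 + of_int n)) + cmod (V (x0 + of_int n)) +
                  (cmod (U (x0 + of_int n + 1)) + cmod (V (x0 + of_int n + 1))) + L2_norm (cell x0 n) U)\<^sup>2))"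
      by (simp add: h_def y_def u_def v_def mult.assoc add.assoc)
  qed
qed

end

section \<open>Completeness and the energy bound on the line\<close>

lemma borel_measurable_L2_UNIV: "u \<in> L2 UNIV \<Longrightarrow> u \<in> borel_measurable lborel"
  using L2_measurable[of u UNIV] by simp

text \<open>
  A subsequence converges almost everywhere, and Fatou's lemma passes to the limit in the Cauchy
  condition.
\<close>

lemma L2_complete:
  fixes u :: "nat \<Rightarrow> real \<Rightarrow> complex"
  assumes u: "\<And>n. u n \<in> L2 UNIV"
    and C: "\<And>e. 0 < e \<Longrightarrow> \<exists>N. \<forall>m\<ge>N. \<forall>n\<ge>N. L2_norm UNIV (\<lambda>x. u m x - u n x) < e"
  obtains g where "g \<in> L2 UNIV" "(\<lambda>n. L2_norm UNIV (\<lambda>x. u n x - g x)) \<longlonglongrightarrow> 0"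
proof -
  have [measurable]: "u n \<in> borel_measurable borel" for n using borel_measurable_L2_UNIV[OF u] by simp
  \<comment> \<open>A positive square-integrable weight turns \<open>L\<^sub>2\<close> Cauchy sequences into \<open>L\<^sub>1\<close> Cauchy sequences.\<close>
  obtain h :: "real \<Rightarrow> ennreal" where h: "h \<in> borel_measurable lborel" "integral\<^sup>N lborel h \<noteq> \<infinity>"
    "\<And>x. 0 < h x \<and> h x < \<infinity>"
    using sigma_finite_measure.Ex_finite_integrable_function[OF sigma_finite_lborel] by auto
  define w where "w = (\<lambda>x. complex_of_real (sqrt (enn2real (h x))))"
  have hr: "enn2real (h x) > 0" "ennreal (enn2real (h x)) = h x" for x
    using h(3)[of x] by (simp_all add: enn2real_positive_iff)
  have w: "w \<in> L2 UNIV"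
  proof (rule L2I)
    show "(\<lambda>x. indicator UNIV x *\<^sub>R w x) \<in> borel_measurable lborel" using h(1) by (simp add: w_def)
    have "integrable lborel (\<lambda>x. enn2real (h x))"
    proof (rule integrableI_bounded)
      have "(\<integral>\<^sup>+ x. ennreal (norm (enn2real (h x))) \<partial>lborel) = integral\<^sup>N lborel h"
        using hr by (intro nn_integral_cong) simp
      then show "(\<integral>\<^sup>+ x. ennreal (norm (enn2real (h x))) \<partial>lborel) < \<infinity>" using h(2) by (simp add: less_top)
    qed (use h(1) in measurable)
    then show "set_integrable lborel UNIV (\<lambda>x. (cmod (w x))\<^sup>2)"
      by (simp add: set_integrable_def w_def)
  qed
  have w0: "w x \<noteq> 0" for x using hr(1)[of x] by (simp add: w_def)
  define s where "s = (\<lambda>n x. u n x * w x)"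
  have s_int: "integrable lborel (s n)" for n
    using L2_mult_integrable[OF u w] by (simp add: s_def set_integrable_def)
  have Cs: "\<exists>N. \<forall>i\<ge>N. \<forall>j\<ge>N. (LINT x|lborel. norm (s i x - s j x)) < e" if "e > 0" for e
  proof -
    have w1: "0 < L2_norm UNIV w + 1" by (simp add: add_nonneg_pos)
    obtain N where N: "\<forall>m\<ge>N. \<forall>n\<ge>N. L2_norm UNIV (\<lambda>x. u m x - u n x) < e / (L2_norm UNIV w + 1)"
      using C[OF divide_pos_pos[OF \<open>e > 0\<close> w1]] by blast
    have "(LINT x|lborel. norm (s i x - s j x)) < e" if "i \<ge> N" "j \<ge> N" for i j
    proof -
      have "(LINT x|lborel. norm (s i x - s j x)) = (LINT x:UNIV|lborel. cmod (u i x - u j x) * cmod (w x))"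
        by (simp add: s_def set_lebesgue_integral_def left_diff_distrib[symmetric] norm_mult)
      also have "\<dots> \<le> L2_norm UNIV (\<lambda>x. u i x - u j x) * L2_norm UNIV w"
        by (rule L2_cauchy_schwarz[OF L2_diff(1)[OF u u] w])
      also have "\<dots> \<le> L2_norm UNIV (\<lambda>x. u i x - u j x) * (L2_norm UNIV w + 1)"
        by (intro mult_left_mono) auto
      also have "\<dots> < e"
      proof -
        have "L2_norm UNIV (\<lambda>x. u i x - u j x) < e / (L2_norm UNIV w + 1)" using N that by blast
        moreover have "0 < L2_norm UNIV w + 1" by (simp add: add_nonneg_pos)
        ultimately show ?thesis by (simp only: pos_less_divide_eq)
      qed
      finally show ?thesis .
    qed
    then show ?thesis by blast
  qed
  obtain r where r: "strict_mono r" "AE x in lborel. Cauchy (\<lambda>i. s (r i) x)"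
    by (rule cauchy_L1_AE_cauchy_subseq[OF s_int Cs])
  define g where "g = (\<lambda>x. lim (\<lambda>i. u (r i) x))"
  have gm[measurable]: "g \<in> borel_measurable borel" unfolding g_def by measurable
  have lim: "AE x in lborel. (\<lambda>i. u (r i) x) \<longlonglongrightarrow> g x"
    using r(2)
  proof eventually_elim
    case (elim x)
    then obtain l where "(\<lambda>i. s (r i) x) \<longlonglongrightarrow> l" using Cauchy_convergent_iff convergent_def by blast
    then have "(\<lambda>i. s (r i) x / w x) \<longlonglongrightarrow> l / w x" using w0[of x] by (intro tendsto_intros) auto
    then have "(\<lambda>i. u (r i) x) \<longlonglongrightarrow> l / w x" using w0[of x] by (simp add: s_def)
    then show ?case unfolding g_def using limI by metis
  qed
  have est: "integrable lborel (\<lambda>x. (cmod (u m x - g x))\<^sup>2) \<and> (LINT x|lborel. (cmod (u m x - g x))\<^sup>2) \<le> e\<^sup>2"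
    if e: "e > 0" and N: "\<forall>m\<ge>N. \<forall>n\<ge>N. L2_norm UNIV (\<lambda>x. u m x - u n x) < e" and m: "m \<ge> N" for e N m
  proof -
    have "(\<integral>\<^sup>+ x. ennreal ((cmod (u m x - g x))\<^sup>2) \<partial>lborel)
        = (\<integral>\<^sup>+ x. liminf (\<lambda>k. ennreal ((cmod (u m x - u (r k) x))\<^sup>2)) \<partial>lborel)"
    proof (rule nn_integral_cong_AE)
      show "AE x in lborel. ennreal ((cmod (u m x - g x))\<^sup>2) = liminf (\<lambda>k. ennreal ((cmod (u m x - u (r k) x))\<^sup>2))"
        using lim
      proof eventually_elim
        case (elim x)
        have "(\<lambda>k. ennreal ((cmod (u m x - u (r k) x))\<^sup>2)) \<longlonglongrightarrow> ennreal ((cmod (u m x - g x))\<^sup>2)"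
          by (intro tendsto_ennrealI tendsto_intros elim)
        then show ?case by (intro lim_imp_Liminf[symmetric]) auto
      qed
    qed
    also have "\<dots> \<le> liminf (\<lambda>k. (\<integral>\<^sup>+ x. ennreal ((cmod (u m x - u (r k) x))\<^sup>2) \<partial>lborel))"
      by (rule nn_integral_liminf) measurable
    also have "\<dots> \<le> liminf (\<lambda>k::nat. ennreal (e\<^sup>2))"
    proof (rule Liminf_mono, rule eventually_sequentiallyI[of N])
      fix k assume "N \<le> k"
      then have k: "N \<le> r k" using seq_suble[OF r(1), of k] by simp
      have d: "(\<lambda>x. u m x - u (r k) x) \<in> L2 UNIV" by (rule L2_diff(1)[OF u u])
      have "(\<integral>\<^sup>+ x. ennreal ((cmod (u m x - u (r k) x))\<^sup>2) \<partial>lborel) = ennreal ((L2_norm UNIV (\<lambda>x. u m x - u (r k) x))\<^sup>2)"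
        using L2_sq_integrable[OF d] unfolding L2_norm_sq
        by (subst nn_integral_eq_integral) (simp_all add: set_integrable_def set_lebesgue_integral_def)
      also have "\<dots> \<le> ennreal (e\<^sup>2)"
      proof -
        have "L2_norm UNIV (\<lambda>x. u m x - u (r k) x) < e" using N m k by blast
        then show ?thesis by (intro ennreal_leI power_mono) auto
      qed
      finally show "(\<integral>\<^sup>+ x. ennreal ((cmod (u m x - u (r k) x))\<^sup>2) \<partial>lborel) \<le> ennreal (e\<^sup>2)" .
    qed
    also have "\<dots> = ennreal (e\<^sup>2)" by (rule Liminf_const) simp
    finally have le: "(\<integral>\<^sup>+ x. ennreal ((cmod (u m x - g x))\<^sup>2) \<partial>lborel) \<le> ennreal (e\<^sup>2)" .
    have i: "integrable lborel (\<lambda>x. (cmod (u m x - g x))\<^sup>2)"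
    proof (rule integrableI_bounded)
      show "(\<integral>\<^sup>+ x. ennreal (norm ((cmod (u m x - g x))\<^sup>2)) \<partial>lborel) < \<infinity>"
        using le_less_trans[OF le] by simp
    qed measurable
    then show ?thesis
      using le by (subst (asm) nn_integral_eq_integral) (simp_all add: ennreal_le_iff)
  qed
  obtain N1 where N1: "\<forall>m\<ge>N1. \<forall>n\<ge>N1. L2_norm UNIV (\<lambda>x. u m x - u n x) < 1" using C[of 1] by auto
  have d: "(\<lambda>x. u N1 x - g x) \<in> L2 UNIV"
    using est[OF _ N1, of N1] by (intro L2I) (simp_all add: set_integrable_def)
  have "(\<lambda>x. u N1 x - (u N1 x - g x)) \<in> L2 UNIV" by (rule L2_diff(1)[OF u d])
  then have g: "g \<in> L2 UNIV" by simp
  have "(\<lambda>n. L2_norm UNIV (\<lambda>x. u n x - g x)) \<longlonglongrightarrow> 0"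
  proof (rule LIMSEQ_I)
    fix e :: real assume e: "e > 0"
    obtain N where N: "\<forall>m\<ge>N. \<forall>n\<ge>N. L2_norm UNIV (\<lambda>x. u m x - u n x) < e / 2" using C[of "e / 2"] e by auto
    have "norm (L2_norm UNIV (\<lambda>x. u n x - g x) - 0) < e" if "n \<ge> N" for n
    proof -
      have "(L2_norm UNIV (\<lambda>x. u n x - g x))\<^sup>2 \<le> (e / 2)\<^sup>2"
        using est[OF _ N that] e by (simp add: L2_norm_sq set_lebesgue_integral_def)
      then have "L2_norm UNIV (\<lambda>x. u n x - g x) \<le> e / 2" by (rule power2_le_imp_le) (use e in simp)
      then show ?thesis using e by (simp add: abs_of_nonneg)
    qed
    then show "\<exists>no. \<forall>n\<ge>no. norm (L2_norm UNIV (\<lambda>x. u n x - g x) - 0) < e" by blast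
  qed
  then show ?thesis using g that by blast
qed

lemma integral_of_vanishing_primitive:
  assumes W: "antideriv UNIV W w" and i: "set_integrable lborel UNIV w"
    and l: "(\<lambda>n. W (real n)) \<longlonglongrightarrow> 0" "(\<lambda>n. W (- real n)) \<longlonglongrightarrow> 0"
  shows "(LINT x:UNIV|lborel. w x) = 0"
proof -
  have U: "(\<Union>N. {- real N..real N}) = UNIV"
  proof -
    have "y \<in> (\<Union>N. {- real N..real N})" for y
    proof -
      obtain n where "\<bar>y\<bar> \<le> real n" using real_arch_simple by blast
      then have "y \<in> {- real n..real n}" by auto
      then show ?thesis by blast
    qed
    then show ?thesis by blast
  qed
  have "(\<lambda>N. LINT t:{- real N..real N}|lborel. w t) \<longlonglongrightarrow> (LINT t:(\<Union>N. {- real N..real N})|lborel. w t)"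
    by (rule set_integral_cont_up) (auto simp: incseq_def U i)
  moreover have "(LINT t:{- real N..real N}|lborel. w t) = W (real N) - W (- real N)" for N
    by (rule antideriv_diff_eq[OF W, symmetric]) auto
  moreover have "(\<lambda>N. W (real N) - W (- real N)) \<longlonglongrightarrow> 0 - 0" by (intro tendsto_intros l)
  ultimately show ?thesis using LIMSEQ_unique by (simp add: U)
qed

lemma zero_ext_L2:
  assumes "g \<in> L2 Q" "Q \<in> sets borel"
  shows "zero_ext Q g \<in> L2 UNIV" "L2_norm UNIV (zero_ext Q g) = L2_norm Q g"
proof -
  have e1: "(\<lambda>x. indicator UNIV x *\<^sub>R zero_ext Q g x) = (\<lambda>x. indicator Q x *\<^sub>R g x)"
    by (auto simp: zero_ext_def indicator_def)
  have e2: "(\<lambda>x. indicator UNIV x *\<^sub>R (cmod (zero_ext Q g x))\<^sup>2) = (\<lambda>x. indicator Q x *\<^sub>R (cmod (g x))\<^sup>2)"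
    by (auto simp: zero_ext_def indicator_def)
  show "zero_ext Q g \<in> L2 UNIV"
  proof (rule L2I)
    show "(\<lambda>x. indicator UNIV x *\<^sub>R zero_ext Q g x) \<in> borel_measurable lborel"
      unfolding e1 by (rule L2_measurable[OF assms(1)])
    show "set_integrable lborel UNIV (\<lambda>x. (cmod (zero_ext Q g x))\<^sup>2)"
      unfolding set_integrable_def e2 using L2_sq_integrable[OF assms(1)] by (simp only: set_integrable_def)
  qed
  show "L2_norm UNIV (zero_ext Q g) = L2_norm Q g"
    unfolding L2_norm_def set_lebesgue_integral_def e2 ..
qed

lemma L2_real_mult:
  assumes u: "u \<in> L2 UNIV" and m: "a \<in> borel_measurable borel" and b: "\<And>x. \<bar>a x\<bar> \<le> B"
  shows "(\<lambda>x. of_real (a x) * u x) \<in> L2 UNIV" "L2_norm UNIV (\<lambda>x. of_real (a x) * u x) \<le> B * L2_norm UNIV u"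
proof -
  have B: "0 \<le> B" using order_trans[OF abs_ge_zero b[of 0]] .
  have ms: "(\<lambda>x. indicator UNIV x *\<^sub>R (of_real (a x) * u x)) \<in> borel_measurable lborel"
    using m borel_measurable_L2_UNIV[OF u] by simp
  have le: "AE x in lborel. x \<in> UNIV \<longrightarrow> cmod (of_real (a x) * u x) \<le> B * cmod (u x)"
    using b by (intro AE_I2) (simp add: norm_mult mult_right_mono)
  show "(\<lambda>x. of_real (a x) * u x) \<in> L2 UNIV" "L2_norm UNIV (\<lambda>x. of_real (a x) * u x) \<le> B * L2_norm UNIV u"
    by (rule L2_bounded_by[OF ms u le B])+
qed

text \<open>
  A function of \<open>W\<^sub>2\<^sup>2(\<real>)\<close> together with its continuously differentiable representative \<open>U\<close>, the
  derivative \<open>U1\<close> of the latter and a density \<open>u2\<close> of \<open>U1\<close>.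
\<close>

definition represents :: "(real \<Rightarrow> complex) \<Rightarrow> (real \<Rightarrow> complex) \<Rightarrow> (real \<Rightarrow> complex) \<Rightarrow> (real \<Rightarrow> complex) \<Rightarrow> bool" where
  "represents u U U1 u2 \<longleftrightarrow> antideriv UNIV U U1 \<and> antideriv UNIV U1 u2 \<and> (AE x in lborel. u x = U x) \<and>
     u \<in> L2 UNIV \<and> U \<in> L2 UNIV \<and> U1 \<in> L2 UNIV \<and> u2 \<in> L2 UNIV"

lemma W2_2_represents:
  assumes "u \<in> W2 2 UNIV" obtains U U1 u2 where "represents u U U1 u2"
  by (rule W2_2_primitives[OF _ _ assms]) (auto simp: represents_def intro: that)

locale regular_sturm_liouville = periodic_sturm_liouville +
  fixes p' :: "real \<Rightarrow> real" and p1 pm :: real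
  assumes p_primitive: "antideriv UNIV (\<lambda>x. of_real (p x)) (\<lambda>x. of_real (p' x))"
    and p'_meas: "p' \<in> borel_measurable borel" and p'_bound: "\<And>x. \<bar>p' x\<bar> \<le> p1" and p_upper: "\<And>x. p x \<le> pm"
begin

lemma p_meas: "p \<in> borel_measurable borel" by (rule borel_measurable_continuous_onI[OF p_cont])

lemma p_abs: "\<bar>p x\<bar> \<le> pm" using p_pos[of x] p_upper[of x] by simp

definition flux :: "(real \<Rightarrow> complex) \<Rightarrow> real \<Rightarrow> complex" where "flux U1 = (\<lambda>x. of_real (p x) * U1 x)"

definition flux_deriv :: "(real \<Rightarrow> complex) \<Rightarrow> (real \<Rightarrow> complex) \<Rightarrow> real \<Rightarrow> complex" where
  "flux_deriv U1 u2 = (\<lambda>x. of_real (p' x) * U1 x + of_real (p x) * u2 x)"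

lemma flux_primitive: "antideriv UNIV U1 u2 \<Longrightarrow> antideriv UNIV (flux U1) (flux_deriv U1 u2)"
  unfolding flux_def flux_deriv_def by (rule antideriv_mult[OF p_primitive]) auto

lemma flux_L2: "U1 \<in> L2 UNIV \<Longrightarrow> flux U1 \<in> L2 UNIV" "U1 \<in> L2 UNIV \<Longrightarrow> L2_norm UNIV (flux U1) \<le> pm * L2_norm UNIV U1"
  unfolding flux_def by (rule L2_real_mult[OF _ p_meas p_abs]; assumption)+

lemma flux_deriv_L2: "U1 \<in> L2 UNIV \<Longrightarrow> u2 \<in> L2 UNIV \<Longrightarrow> flux_deriv U1 u2 \<in> L2 UNIV"
  unfolding flux_deriv_def by (intro L2_add(1) L2_real_mult[OF _ p_meas p_abs] L2_real_mult[OF _ p'_meas p'_bound])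

lemma second_deriv_bound:
  assumes "U1 \<in> L2 UNIV" "u2 \<in> L2 UNIV"
  shows "p0 * L2_norm UNIV u2 \<le> L2_norm UNIV (flux_deriv U1 u2) + p1 * L2_norm UNIV U1"
proof -
  let ?v = "\<lambda>x. flux_deriv U1 u2 x - of_real (p' x) * U1 x"
  note p'U = L2_real_mult[OF assms(1) p'_meas p'_bound]
  have v: "?v \<in> L2 UNIV" by (rule L2_diff(1)[OF flux_deriv_L2[OF assms] p'U(1)])
  have "L2_norm UNIV u2 \<le> (1 / p0) * L2_norm UNIV ?v"
  proof (rule L2_bounded_by(2)[OF L2_measurable[OF assms(2)] v])
    show "AE x in lborel. x \<in> UNIV \<longrightarrow> cmod (u2 x) \<le> 1 / p0 * cmod (flux_deriv U1 u2 x - of_real (p' x) * U1 x)"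
    proof (rule AE_I2, rule impI)
      fix x
      have "p0 * cmod (u2 x) \<le> p x * cmod (u2 x)" by (intro mult_right_mono p_lower) simp
      also have "\<dots> = cmod (flux_deriv U1 u2 x - of_real (p' x) * U1 x)"
        using p_pos[of x] by (simp add: flux_deriv_def norm_mult)
      finally show "cmod (u2 x) \<le> 1 / p0 * cmod (flux_deriv U1 u2 x - of_real (p' x) * U1 x)"
        using p0 by (simp add: field_simps)
    qed
  qed (use p0 in simp)
  then have "p0 * L2_norm UNIV u2 \<le> L2_norm UNIV ?v" using p0 by (simp add: field_simps)
  also have "\<dots> \<le> L2_norm UNIV (flux_deriv U1 u2) + p1 * L2_norm UNIV U1"
    using L2_diff(2)[OF flux_deriv_L2[OF assms] p'U(1)] p'U(2) by linarith
  finally show ?thesis .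
qed

lemma sol_of_primitive:
  assumes "antideriv UNIV U U1" "antideriv UNIV U1 u2"
  shows "sol \<mu> UNIV U (flux U1) (\<lambda>x. (of_real (q x) - \<mu>) * U x - flux_deriv U1 u2 x)"
proof -
  have "(\<lambda>x. flux U1 x / of_real (p x)) = U1" using p_pos by (auto simp: flux_def less_imp_neq[symmetric])
  then show ?thesis using assms(1) flux_primitive[OF assms(2)] by (simp add: sol_def)
qed

lemma residual_L2:
  assumes "U \<in> L2 UNIV" "U1 \<in> L2 UNIV" "u2 \<in> L2 UNIV"
  shows "(\<lambda>x. (of_real (q x) - \<mu>) * U x - flux_deriv U1 u2 x) \<in> L2 UNIV"
    "L2_norm UNIV (\<lambda>x. (of_real (q x) - \<mu>) * U x) \<le> (q1 + cmod \<mu>) * L2_norm UNIV U"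
proof -
  note qU = L2_real_mult[OF assms(1) q_meas q_bound] and mU = L2_cmult[OF assms(1), of \<mu>]
  have e: "(\<lambda>x. (of_real (q x) - \<mu>) * U x) = (\<lambda>x. of_real (q x) * U x - \<mu> * U x)" by (auto simp: left_diff_distrib)
  show "(\<lambda>x. (of_real (q x) - \<mu>) * U x - flux_deriv U1 u2 x) \<in> L2 UNIV"
    unfolding left_diff_distrib
    by (intro L2_diff(1) qU mU flux_deriv_L2 assms)
  show "L2_norm UNIV (\<lambda>x. (of_real (q x) - \<mu>) * U x) \<le> (q1 + cmod \<mu>) * L2_norm UNIV U"
    unfolding e distrib_right using L2_diff(2)[OF qU(1) mU(1)] qU(2) mU(2) by linarith
qed

text \<open>
  Integration of the flux derivative against the conjugate of \<open>U\<close>. The boundary terms disappear along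
  the integers, where the values of \<open>U\<close> and of its flux are square summable.
\<close>

lemma energy_bound:
  assumes U: "antideriv UNIV U U1" "antideriv UNIV U1 u2" and L: "U \<in> L2 UNIV" "U1 \<in> L2 UNIV" "u2 \<in> L2 UNIV"
  shows "p0 * (L2_norm UNIV U1)\<^sup>2 \<le> L2_norm UNIV (flux_deriv U1 u2) * L2_norm UNIV U"
proof -
  let ?V = "flux U1" and ?d = "flux_deriv U1 u2"
  have W: "antideriv UNIV (\<lambda>x. ?V x * cnj (U x)) (\<lambda>x. ?d x * cnj (U x) + ?V x * cnj (U1 x))"
    by (rule antideriv_mult[OF flux_primitive[OF U(2)] antideriv_cnj[OF U(1)]]) simp
  have i1: "set_integrable lborel UNIV (\<lambda>x. ?d x * cnj (U x))"
    by (rule L2_mult_integrable[OF flux_deriv_L2[OF L(2,3)] L2_cnj(1)[OF L(1)]])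
  have i2: "set_integrable lborel UNIV (\<lambda>x. ?V x * cnj (U1 x))"
    by (rule L2_mult_integrable[OF flux_L2(1)[OF L(2)] L2_cnj(1)[OF L(2)]])
  have ss: "(\<lambda>n. (cmod (U (0 + of_int n)) + cmod (?V (0 + of_int n)))\<^sup>2) summable_on UNIV"
    by (rule sol_sample_summable[of "{}", OF _ L(1) flux_L2(1)[OF L(2)] residual_L2(1)[OF L, of 0]
          sol_subset[OF sol_of_primitive[OF U]]]) simp_all
  have lim: "(\<lambda>n. ?V (of_int (k n)) * cnj (U (of_int (k n)))) \<longlonglongrightarrow> 0" if k: "inj k" for k :: "nat \<Rightarrow> int"
  proof -
    have "(\<lambda>n. (cmod (U (of_int n)) + cmod (?V (of_int n)))\<^sup>2) summable_on (range k)"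
      by (rule summable_on_subset_banach[of _ UNIV]) (use ss in simp_all)
    then have "summable (\<lambda>n. (cmod (U (of_int (k n))) + cmod (?V (of_int (k n))))\<^sup>2)"
      by (subst (asm) summable_on_reindex[OF k], subst (asm) comp_def, subst (asm) summable_on_UNIV_nonneg_real_iff) auto
    then have l: "(\<lambda>n. (cmod (U (of_int (k n))) + cmod (?V (of_int (k n))))\<^sup>2) \<longlonglongrightarrow> 0" by (rule summable_LIMSEQ_zero)
    have "norm (?V x * cnj (U x)) \<le> (cmod (U x) + cmod (?V x))\<^sup>2" for x
      by (simp add: norm_mult power2_sum)
    then show ?thesis by (intro Lim_null_comparison[OF _ l]) (simp add: always_eventually)
  qed
  have "(LINT x:UNIV|lborel. ?d x * cnj (U x) + ?V x * cnj (U1 x)) = 0"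
    using lim[of int] lim[of "\<lambda>n. - int n"]
    by (intro integral_of_vanishing_primitive[OF W set_integral_add(1)[OF i1 i2]]) (auto simp: inj_def)
  then have "(LINT x:UNIV|lborel. ?V x * cnj (U1 x)) = - (LINT x:UNIV|lborel. ?d x * cnj (U x))"
    using set_integral_add(2)[OF i1 i2] by (simp add: eq_neg_iff_add_eq_0 add.commute)
  moreover have "(LINT x:UNIV|lborel. ?V x * cnj (U1 x)) = of_real (LINT x:UNIV|lborel. p x * (cmod (U1 x))\<^sup>2)"
  proof -
    have "?V x * cnj (U1 x) = of_real (p x * (cmod (U1 x))\<^sup>2)" for x
      by (simp only: flux_def of_real_mult complex_norm_square mult.assoc)
    then show ?thesis by (simp only: set_integral_complex_of_real)
  qed
  ultimately have "\<bar>LINT x:UNIV|lborel. p x * (cmod (U1 x))\<^sup>2\<bar> = cmod (LINT x:UNIV|lborel. ?d x * cnj (U x))"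
    by (metis norm_minus_cancel norm_of_real)
  also have "\<dots> \<le> (LINT x:UNIV|lborel. cmod (?d x) * cmod (cnj (U x)))"
    using set_integral_norm_bound[OF i1] by (simp add: norm_mult)
  also have "\<dots> \<le> L2_norm UNIV ?d * L2_norm UNIV U"
    using L2_cauchy_schwarz[OF flux_deriv_L2[OF L(2,3)] L2_cnj(1)[OF L(1)]] L2_cnj(2)[OF L(1)] by simp
  finally have "(LINT x:UNIV|lborel. p x * (cmod (U1 x))\<^sup>2) \<le> L2_norm UNIV ?d * L2_norm UNIV U" by linarith
  moreover have "p0 * (L2_norm UNIV U1)\<^sup>2 \<le> (LINT x:UNIV|lborel. p x * (cmod (U1 x))\<^sup>2)"
  proof -
    have "set_integrable lborel UNIV (\<lambda>x. cmod (?V x * cnj (U1 x)))" by (rule set_integrable_norm[OF i2])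
    moreover have "cmod (?V x * cnj (U1 x)) = p x * (cmod (U1 x))\<^sup>2" for x
      using p_pos[of x] by (simp add: flux_def norm_mult power2_eq_square)
    ultimately have i: "set_integrable lborel UNIV (\<lambda>x. p x * (cmod (U1 x))\<^sup>2)" by simp
    have "(LINT x:UNIV|lborel. p0 * (cmod (U1 x))\<^sup>2) \<le> (LINT x:UNIV|lborel. p x * (cmod (U1 x))\<^sup>2)"
      by (rule set_integral_mono[OF set_integrable_mult_right[OF L2_sq_integrable[OF L(2)]] i])
         (intro mult_right_mono p_lower, simp)
    then show ?thesis by (simp add: L2_norm_sq)
  qed
  ultimately show ?thesis by linarith
qed

end

section \<open>A priori bounds for the perturbed operator\<close>

lemma represents_restrict:
  assumes R: "represents u U U1 u2" and Q: "is_interval Q" "open Q"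
  shows "zero_ext Q u \<in> W2 2 Q"
    "W2_norm 2 Q (zero_ext Q u) = sqrt ((L2_norm Q U)\<^sup>2 + (L2_norm Q U1)\<^sup>2 + (L2_norm Q u2)\<^sup>2)"
    "W2_norm 2 Q (zero_ext Q u) \<le> L2_norm UNIV U + L2_norm UNIV U1 + L2_norm UNIV u2"
proof -
  have a: "antideriv Q U U1" "antideriv Q U1 u2"
    using R antideriv_subset[OF _ subset_UNIV] unfolding represents_def by blast+
  have Qb: "Q \<in> sets borel" using Q by simp
  have L: "h \<in> L2 UNIV \<Longrightarrow> h \<in> L2 Q" "h \<in> L2 UNIV \<Longrightarrow> L2_norm Q h \<le> L2_norm UNIV h" for h
    using L2_subset[OF _ subset_UNIV Qb] by blast+
  have Ls: "u \<in> L2 UNIV" "U \<in> L2 UNIV" "U1 \<in> L2 UNIV" "u2 \<in> L2 UNIV" using R by (simp_all add: represents_def)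
  have eq: "(\<lambda>x. indicator Q x *\<^sub>R zero_ext Q u x) = (\<lambda>x. indicator Q x *\<^sub>R u x)"
    by (auto simp: zero_ext_def indicator_def)
  have m: "(\<lambda>x. indicator Q x *\<^sub>R zero_ext Q u x) \<in> borel_measurable lborel"
    unfolding eq by (rule L2_measurable[OF L(1)[OF Ls(1)]])
  have "AE x in lborel. u x = U x" using R by (simp add: represents_def)
  then have e: "AE x in lborel. x \<in> Q \<longrightarrow> zero_ext Q u x = U x"
    by eventually_elim (simp add: zero_ext_def)
  show "zero_ext Q u \<in> W2 2 Q"
    by (rule W2_2_I[OF Q a L(1)[OF Ls(2)] L(1)[OF Ls(3)] L(1)[OF Ls(4)] m e])
  show eq: "W2_norm 2 Q (zero_ext Q u) = sqrt ((L2_norm Q U)\<^sup>2 + (L2_norm Q U1)\<^sup>2 + (L2_norm Q u2)\<^sup>2)"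
    by (rule W2_norm_2_eq[OF Q a m e])
  have "W2_norm 2 Q (zero_ext Q u) \<le> L2_norm Q U + L2_norm Q U1 + L2_norm Q u2"
    unfolding eq by (rule real_le_lsqrt) (auto simp: power2_sum algebra_simps mult_nonneg_nonneg intro!: add_nonneg_nonneg)
  then show "W2_norm 2 Q (zero_ext Q u) \<le> L2_norm UNIV U + L2_norm UNIV U1 + L2_norm UNIV u2"
    using L(2)[OF Ls(2)] L(2)[OF Ls(3)] L(2)[OF Ls(4)] by linarith
qed

text \<open>
  This is what makes families that are bounded in the Sobolev norm equicontinuous.
\<close>

lemma holder_half:
  assumes W: "antideriv UNIV W w" and w: "w \<in> L2 UNIV" and B: "L2_norm UNIV w \<le> B"
  shows "cmod (W x - W y) \<le> B * sqrt \<bar>x - y\<bar>"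
proof -
  have *: "cmod (W y - W x) \<le> B * sqrt (y - x)" if "x \<le> y" for x y
  proof -
    note wI = L2_subset[OF w subset_UNIV, of "{x..y}"]
    have "cmod (W y - W x) \<le> (LINT t:{x..y}|lborel. cmod (w t))"
      by (rule antideriv_norm_le[OF W]) (use that in auto)
    also have "\<dots> \<le> sqrt (y - x) * L2_norm {x..y} w"
      by (rule L2_imp_integrable_Icc(2)[OF wI(1) that]) simp
    also have "\<dots> \<le> sqrt (y - x) * B" using wI(2) B that by (intro mult_left_mono) auto
    finally show ?thesis by (simp add: mult.commute)
  qed
  show ?thesis
  proof (cases "x \<le> y")
    case True then show ?thesis using *[of x y] by (simp add: norm_minus_commute)
  next
    case False then show ?thesis using *[of y x] by simp
  qed
qed

text \<open>
  Here \<open>K'\<close>, \<open>Z\<close>, \<open>X\<close> and \<open>D\<close> stand for the norms of \<open>U\<close>, \<open>U'\<close>, \<open>U''\<close> and \<open>(p U')'\<close>, and \<open>e\<close> for the size of the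
  perturbation. As \<open>e \<le> p0 / 2\<close>, the term with \<open>X\<close> is absorbed, so \<open>D\<close> grows at most linearly in \<open>Z\<close>;
  but \<open>Z\<^sup>2\<close> grows at most linearly in \<open>D\<close>.
\<close>

lemma a_priori_arithmetic:
  fixes D X Z K K' a e p0 p1 :: real
  assumes "0 \<le> D" "0 \<le> X" "0 \<le> Z" "0 \<le> K'" "K' \<le> K" "0 \<le> a" "0 \<le> e" "e \<le> p0 / 2" "0 < p0" "0 \<le> p1"
    and D: "D \<le> a + e * (K' + Z + X)" and X: "p0 * X \<le> D + p1 * Z" and Z: "p0 * Z\<^sup>2 \<le> D * K'"
  defines "\<alpha> \<equiv> 2 * (a + e * K)" and "\<beta> \<equiv> 2 * e + p1"
  shows "Z \<le> 1 + K * (\<alpha> + \<beta>) / p0" "D \<le> \<alpha> + \<beta> * (1 + K * (\<alpha> + \<beta>) / p0)"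
proof -
  have K: "0 \<le> K" using assms by linarith
  have ab: "0 \<le> \<alpha>" "0 \<le> \<beta>" using assms K by (simp_all add: \<alpha>_def \<beta>_def)
  have "e * X \<le> (p0 / 2) * X" using assms by (intro mult_right_mono) auto
  then have eX: "e * X \<le> (D + p1 * Z) / 2" using X by simp
  have "e * K' \<le> e * K" using assms by (intro mult_left_mono) auto
  then have Dle: "D \<le> \<alpha> + \<beta> * Z" using D eX by (simp add: \<alpha>_def \<beta>_def algebra_simps)
  show Zle: "Z \<le> 1 + K * (\<alpha> + \<beta>) / p0"
  proof (cases "Z \<le> 1")
    case True
    have "0 \<le> K * (\<alpha> + \<beta>) / p0" using K ab assms by simp
    then show ?thesis using True by linarith
  next
    case False
    have "p0 * Z\<^sup>2 \<le> D * K" using Z assms mult_left_mono[of K' K D] by linarith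
    also have "\<dots> \<le> (\<alpha> * Z + \<beta> * Z) * K"
    proof (intro mult_right_mono K)
      have "\<alpha> * 1 \<le> \<alpha> * Z" using False ab by (intro mult_left_mono) auto
      then show "D \<le> \<alpha> * Z + \<beta> * Z" using Dle by simp
    qed
    finally have "(p0 * Z) * Z \<le> (K * (\<alpha> + \<beta>)) * Z" by (simp add: power2_eq_square algebra_simps)
    then have "p0 * Z \<le> K * (\<alpha> + \<beta>)" using False by (simp only: mult_le_cancel_right)
    then have "Z \<le> K * (\<alpha> + \<beta>) / p0" using assms by (simp add: field_simps)
    then show ?thesis by simp
  qed
  show "D \<le> \<alpha> + \<beta> * (1 + K * (\<alpha> + \<beta>) / p0)"
    using Dle mult_left_mono[OF Zle ab(2)] by linarith
qed

context regular_sturm_liouville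
begin

lemma H0_AE:
  assumes R: "represents u U U1 u2"
  shows "AE x in lborel. H0 p q u x = - flux_deriv U1 u2 x + of_real (q x) * U x"
    "H0 p q u \<in> borel_measurable lborel"
proof -
  have U: "antideriv UNIV U U1" and U1: "antideriv UNIV U1 u2" and e: "AE x in lborel. x \<in> UNIV \<longrightarrow> u x = U x"
    and mu: "u \<in> borel_measurable lborel"
    using R borel_measurable_L2_UNIV by (auto simp: represents_def)
  have mu': "(\<lambda>x. indicator UNIV x *\<^sub>R u x) \<in> borel_measurable lborel" using mu by simp
  note w = wderiv_of_primitive[OF _ _ U mu' e, simplified]
  have m2: "(\<lambda>x. indicator UNIV x *\<^sub>R (of_real (p x) * wderiv UNIV u x)) \<in> borel_measurable lborel"
    using w(3) p_meas by simp
  have e2: "AE x in lborel. x \<in> UNIV \<longrightarrow> of_real (p x) * wderiv UNIV u x = flux U1 x"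
    using w(2) by eventually_elim (simp add: flux_def)
  note d = wderiv_of_primitive[OF _ _ flux_primitive[OF U1] m2 e2, simplified]
  show "AE x in lborel. H0 p q u x = - flux_deriv U1 u2 x + of_real (q x) * U x"
    using d(2) e by eventually_elim (simp add: H0_def div_op_def)
  show "H0 p q u \<in> borel_measurable lborel"
    unfolding H0_def div_op_def using d(3) q_meas mu by simp
qed

text \<open>
  The function \<open>(H\<^sub>\<epsilon> - \<mu>) u\<close> for \<open>H\<^sub>\<epsilon> = H\<^sub>0 - \<epsilon> T\<close>.
\<close>

definition residual :: "real set \<Rightarrow> real \<Rightarrow> ((real \<Rightarrow> complex) \<Rightarrow> real \<Rightarrow> complex) \<Rightarrow> complex \<Rightarrow> (real \<Rightarrow> complex) \<Rightarrow> real \<Rightarrow> complex" where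
  "residual Q \<epsilon> T \<mu> u = (\<lambda>x. H_pert p q Q \<epsilon> T u x - \<mu> * u x)"

lemma residual_AE:
  assumes R: "represents u U U1 u2"
  shows "AE x in lborel. residual Q \<epsilon> T \<mu> u x =
    (of_real (q x) - \<mu>) * U x - flux_deriv U1 u2 x - of_real \<epsilon> * zero_ext Q (T (zero_ext Q u)) x"
proof -
  have "AE x in lborel. u x = U x" using R by (simp add: represents_def)
  then show ?thesis using H0_AE(1)[OF R]
    by eventually_elim (simp add: residual_def H_pert_def algebra_simps)
qed

lemma residual_in_L2:
  assumes R: "represents u U U1 u2" and Q: "Q \<in> sets borel" and T: "T (zero_ext Q u) \<in> L2 Q"
  shows "residual Q \<epsilon> T \<mu> u \<in> L2 UNIV"
proof (rule L2_cong_AE(1))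
  have L: "u \<in> L2 UNIV" "U \<in> L2 UNIV" "U1 \<in> L2 UNIV" "u2 \<in> L2 UNIV" using R by (simp_all add: represents_def)
  note z = zero_ext_L2(1)[OF T Q]
  show "(\<lambda>x. (of_real (q x) - \<mu>) * U x - flux_deriv U1 u2 x - of_real \<epsilon> * zero_ext Q (T (zero_ext Q u)) x) \<in> L2 UNIV"
    by (rule L2_diff(1)[OF residual_L2(1)[OF L(2-4)] L2_cmult(1)[OF z]])
  show "(\<lambda>x. indicator UNIV x *\<^sub>R residual Q \<epsilon> T \<mu> u x) \<in> borel_measurable lborel"
    unfolding residual_def H_pert_def
    using H0_AE(2)[OF R] borel_measurable_L2_UNIV[OF z] borel_measurable_L2_UNIV[OF L(1)] by simp
  show "AE x in lborel. x \<in> UNIV \<longrightarrow> residual Q \<epsilon> T \<mu> u x =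
    (of_real (q x) - \<mu>) * U x - flux_deriv U1 u2 x - of_real \<epsilon> * zero_ext Q (T (zero_ext Q u)) x"
    using residual_AE[OF R] by simp
qed

lemma residual_flux_bound:
  assumes R: "represents u U U1 u2" and Q: "is_interval Q" "open Q" and \<epsilon>: "0 \<le> \<epsilon>"
    and T: "T (zero_ext Q u) \<in> L2 Q" "L2_norm Q (T (zero_ext Q u)) \<le> M * W2_norm 2 Q (zero_ext Q u)" and M: "0 \<le> M"
  shows "L2_norm UNIV (flux_deriv U1 u2) \<le> (q1 + cmod \<mu>) * L2_norm UNIV U + L2_norm UNIV (residual Q \<epsilon> T \<mu> u)
     + \<epsilon> * M * (L2_norm UNIV U + L2_norm UNIV U1 + L2_norm UNIV u2)"
proof -
  have L: "U \<in> L2 UNIV" "U1 \<in> L2 UNIV" "u2 \<in> L2 UNIV" using R by (simp_all add: represents_def)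
  have Qb: "Q \<in> sets borel" using Q by simp
  note f = residual_in_L2[of u U U1 u2 Q T \<epsilon> \<mu>, OF R Qb T(1)] and z = zero_ext_L2[OF T(1) Qb]
  note ez = L2_cmult[OF z(1), of "of_real \<epsilon>"]
  have e: "(\<lambda>x. (of_real (q x) - \<mu>) * U x) = (\<lambda>x. of_real (q x) * U x - \<mu> * U x)" by (auto simp: left_diff_distrib)
  have qU: "(\<lambda>x. (of_real (q x) - \<mu>) * U x) \<in> L2 UNIV"
    unfolding e by (intro L2_diff(1) L2_real_mult[OF L(1) q_meas q_bound] L2_cmult L)
  note d1 = L2_diff[OF qU f] 
  note d2 = L2_diff[OF d1(1) ez(1)]
  have "L2_norm UNIV (flux_deriv U1 u2) = L2_norm UNIV (\<lambda>x. (of_real (q x) - \<mu>) * U x - residual Q \<epsilon> T \<mu> u x - of_real \<epsilon> * zero_ext Q (T (zero_ext Q u)) x)"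
  proof (rule L2_cong_AE(2)[OF d2(1) L2_measurable[OF flux_deriv_L2[OF L(2,3)]]])
    show "AE x in lborel. x \<in> UNIV \<longrightarrow> flux_deriv U1 u2 x =
      (of_real (q x) - \<mu>) * U x - residual Q \<epsilon> T \<mu> u x - of_real \<epsilon> * zero_ext Q (T (zero_ext Q u)) x"
      using residual_AE[OF R, of Q \<epsilon> T \<mu>] by eventually_elim simp
  qed
  also have "\<dots> \<le> (q1 + cmod \<mu>) * L2_norm UNIV U + L2_norm UNIV (residual Q \<epsilon> T \<mu> u) + \<epsilon> * L2_norm Q (T (zero_ext Q u))"
    using d2(2) d1(2) ez(2) residual_L2(2)[OF L, of \<mu>] z(2) \<epsilon> by simp
  also have "\<epsilon> * L2_norm Q (T (zero_ext Q u)) \<le> \<epsilon> * (M * (L2_norm UNIV U + L2_norm UNIV U1 + L2_norm UNIV u2))"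
    using represents_restrict(3)[OF R Q] M by (intro mult_left_mono[OF _ \<epsilon>] order_trans[OF T(2)] mult_left_mono) auto
  finally show ?thesis by (simp add: mult.assoc)
qed

text \<open>
  Away from \<open>Q\<close> the perturbation is invisible, and the residual is the source of the periodic system.
\<close>

lemma residual_sol:
  assumes R: "represents u U U1 u2" and Q: "Q \<in> sets borel" and T: "T (zero_ext Q u) \<in> L2 Q"
    and S: "is_interval S" "S \<in> sets borel" "S \<inter> Q = {}"
  shows "sol \<mu> S U (flux U1) (residual Q \<epsilon> T \<mu> u)"
proof -
  have A: "antideriv UNIV U U1" "antideriv UNIV U1 u2" and L: "U \<in> L2 UNIV" using R by (simp_all add: represents_def)
  note s = sol_subset[OF sol_of_primitive[OF A, of \<mu>] subset_UNIV[of S]]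
  have "antideriv S (flux U1) (\<lambda>x. (of_real (q x) - \<mu>) * U x - residual Q \<epsilon> T \<mu> u x)"
  proof (rule antideriv_cong_AE[OF _ S(1) _ S(2)])
    show "antideriv S (flux U1) (flux_deriv U1 u2)"
      by (rule antideriv_subset[OF flux_primitive[OF A(2)] subset_UNIV])
    have m: "(\<lambda>x. (of_real (q x) - \<mu>) * U x - residual Q \<epsilon> T \<mu> u x) \<in> borel_measurable lborel"
      using q_meas borel_measurable_L2_UNIV[OF L] borel_measurable_L2_UNIV[OF residual_in_L2[of u U U1 u2 Q T \<epsilon> \<mu>, OF R Q T]] by simp
    show "set_borel_measurable lborel S (\<lambda>x. (of_real (q x) - \<mu>) * U x - residual Q \<epsilon> T \<mu> u x)"
      unfolding set_borel_measurable_def by (rule borel_measurable_scaleR[OF _ m]) (use S(2) in simp)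
    show "AE x in lborel. x \<in> S \<longrightarrow> flux_deriv U1 u2 x = (of_real (q x) - \<mu>) * U x - residual Q \<epsilon> T \<mu> u x"
      using residual_AE[OF R, of Q \<epsilon> T \<mu>]
      by eventually_elim (use S(3) in \<open>auto simp: zero_ext_def\<close>)
  qed
  then show ?thesis using s by (simp add: sol_def)
qed

end

section \<open>Singular sequences\<close>

lemma (in regular_sturm_liouville) represents_pointwise_bound:
  assumes R: "represents u U U1 u2" and b: "L2_norm UNIV U \<le> K" "L2_norm UNIV U1 \<le> B" "L2_norm UNIV (flux_deriv U1 u2) \<le> B'"
  shows "cmod (U x) + cmod (flux U1 x) \<le> exp (growth 0) * (K + pm * B + (q1 * K + B'))"
proof -
  have A: "antideriv UNIV U U1" "antideriv UNIV U1 u2" and L: "U \<in> L2 UNIV" "U1 \<in> L2 UNIV" "u2 \<in> L2 UNIV"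
    using R by (simp_all add: represents_def)
  let ?f = "\<lambda>x. (of_real (q x) - 0) * U x - flux_deriv U1 u2 x"
  let ?c = "{x..x+1}"
  have f: "?f \<in> L2 UNIV" by (rule residual_L2(1)[OF L])
  have le: "L2_norm ?c h \<le> L2_norm UNIV h" if "h \<in> L2 UNIV" for h
    by (rule L2_subset(2)[OF that]) auto
  have "cmod (U x) + cmod (flux U1 x) \<le> exp (growth 0) * (L2_norm ?c U + L2_norm ?c (flux U1) + L2_norm ?c ?f)"
    by (rule sol_pointwise_bound[OF sol_subset[OF sol_of_primitive[OF A]] L2_subset(1)[OF f]]) auto
  also have "\<dots> \<le> exp (growth 0) * (K + pm * B + (q1 * K + B'))"
  proof (intro mult_left_mono add_mono)
    show "L2_norm ?c U \<le> K" using le[OF L(1)] b(1) by simp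
    have "pm * L2_norm UNIV U1 \<le> pm * B" using b(2) p_pos[of 0] p_upper[of 0] by (intro mult_left_mono) auto
    then show "L2_norm ?c (flux U1) \<le> pm * B" using le[OF flux_L2(1)[OF L(2)]] flux_L2(2)[OF L(2)] by linarith
    have qU: "(\<lambda>x. (of_real (q x) - 0) * U x) \<in> L2 UNIV" using L2_real_mult(1)[OF L(1) q_meas q_bound] by simp
    have "L2_norm UNIV ?f \<le> q1 * L2_norm UNIV U + L2_norm UNIV (flux_deriv U1 u2)"
      using L2_diff(2)[OF qU flux_deriv_L2[OF L(2,3)]] residual_L2(2)[OF L, of 0] by simp
    also have "\<dots> \<le> q1 * K + B'" using b q1_nonneg by (intro add_mono mult_left_mono) auto
    finally show "L2_norm ?c ?f \<le> q1 * K + B'" using le[OF f] by linarith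
  qed simp
  finally show ?thesis .
qed

lemma finite_cells_meeting_interval: "finite {n. cell x0 n \<inter> {l<..<r} \<noteq> {}}"
proof (rule finite_subset)
  show "{n. cell x0 n \<inter> {l<..<r} \<noteq> {}} \<subseteq> {\<lfloor>l - x0\<rfloor> - 1..\<lceil>r - x0\<rceil>}"
  proof
    fix n assume "n \<in> {n. cell x0 n \<inter> {l<..<r} \<noteq> {}}"
    then obtain x where "x0 + of_int n \<le> x" "x \<le> x0 + of_int n + 1" "l < x" "x < r" by auto
    then have "of_int n \<le> r - x0" "l - x0 - 1 \<le> of_int n" by linarith+
    then show "n \<in> {\<lfloor>l - x0\<rfloor> - 1..\<lceil>r - x0\<rceil>}" by (simp add: floor_le_iff le_ceiling_iff) linarith
  qed
qed simp

text \<open>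
  Off the unit circle, the singular sequences of Glazman's criterion are compact: local ellipticity
  and Arzela-Ascoli handle the support of the perturbation, the dichotomy handles the rest.
\<close>

lemma (in regular_sturm_liouville) cont_spectrum_imp_no_hyperbolic_multiplier:
  assumes Q: "Q = {l<..<r}" and \<epsilon>: "0 \<le> \<epsilon>" and M: "0 \<le> M" "\<epsilon> * M \<le> p0 / 2"
    and T: "\<And>u. u \<in> W2 2 Q \<Longrightarrow> T u \<in> L2 Q" "\<And>u. u \<in> W2 2 Q \<Longrightarrow> L2_norm Q (T u) \<le> M * W2_norm 2 Q u"
    and \<mu>: "\<mu> \<in> cont_spectrum (W2 2 UNIV) (H_pert p q Q \<epsilon> T)"
    and m: "multiplier \<mu> x0 \<phi> \<psi> \<rho>" "\<rho> \<noteq> 0"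
  shows "cmod \<rho> = 1"
proof (rule ccontr)
  assume \<rho>1: "cmod \<rho> \<noteq> 1"
  have Qi: "is_interval Q" "open Q" "Q \<in> sets borel" by (simp_all add: Q is_interval_oo)
  obtain u Mu where u: "\<And>n. u n \<in> W2 2 UNIV" and Mu: "\<And>n. L2_norm UNIV (u n) \<le> Mu"
    and nc: "\<not> (\<exists>r g. strict_mono r \<and> g \<in> L2 UNIV \<and> (\<lambda>n. L2_norm UNIV (\<lambda>x. u (r n) x - g x)) \<longlonglongrightarrow> 0)"
    and lim: "(\<lambda>n. L2_norm UNIV (residual Q \<epsilon> T \<mu> (u n))) \<longlonglongrightarrow> 0"
    using \<mu> unfolding cont_spectrum_def residual_def by blast
  have "\<forall>n. \<exists>U U1 u2. represents (u n) U U1 u2" using W2_2_represents[OF u] by metis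
  then obtain U U1 u2 where R: "\<And>n. represents (u n) (U n) (U1 n) (u2 n)" by metis
  have A: "antideriv UNIV (U n) (U1 n)" "antideriv UNIV (U1 n) (u2 n)"
    and L: "u n \<in> L2 UNIV" "U n \<in> L2 UNIV" "U1 n \<in> L2 UNIV" "u2 n \<in> L2 UNIV"
    and uU: "AE x in lborel. u n x = U n x" for n
    using R[of n] by (simp_all add: represents_def)
  have UM: "L2_norm UNIV (U n) \<le> Mu" for n
  proof -
    have "L2_norm UNIV (U n) = L2_norm UNIV (u n)"
      by (rule L2_cong_AE(2)[OF L(1) L2_measurable[OF L(2)]]) (use uU[of n] in \<open>auto elim!: eventually_mono\<close>)
    then show ?thesis using Mu by simp
  qed
  define f where "f = (\<lambda>n. residual Q \<epsilon> T \<mu> (u n))"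
  note W = represents_restrict[OF R Qi(1,2)]
  have fL: "f n \<in> L2 UNIV" for n
    unfolding f_def by (rule residual_in_L2[where T = T, OF R Qi(3) T(1)[OF W(1)]])
  obtain Kf where Kf: "\<And>n. L2_norm UNIV (f n) \<le> Kf"
    using convergent_imp_Bseq[OF convergentI[OF lim]] unfolding f_def Bseq_def by (auto simp: abs_of_nonneg)
  define d where "d = (\<lambda>n. flux_deriv (U1 n) (u2 n))"
  have dL: "d n \<in> L2 UNIV" for n unfolding d_def by (rule flux_deriv_L2[OF L(3,4)])
  have p1: "0 \<le> p1" using order_trans[OF abs_ge_zero p'_bound[of 0]] .
  define a0 where "a0 = (q1 + cmod \<mu>) * Mu + Kf"
  have Mu0: "0 \<le> Mu" and Kf0: "0 \<le> Kf" using order_trans[OF L2_norm_nonneg Mu] order_trans[OF L2_norm_nonneg Kf] by blast+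
  have a0: "0 \<le> a0" using q1_nonneg Mu0 Kf0 by (simp add: a0_def)
  have dle: "L2_norm UNIV (d n) \<le> a0 + \<epsilon> * M * (L2_norm UNIV (U n) + L2_norm UNIV (U1 n) + L2_norm UNIV (u2 n))" for n
  proof -
    have "(q1 + cmod \<mu>) * L2_norm UNIV (U n) \<le> (q1 + cmod \<mu>) * Mu"
      using UM q1_nonneg by (intro mult_left_mono) auto
    then show ?thesis
      using residual_flux_bound[where T = T and \<mu> = \<mu>, OF R[of n] Qi(1,2) \<epsilon> T(1)[OF W(1)] T(2)[OF W(1)] M(1)] Kf[of n]
      unfolding f_def d_def a0_def by linarith
  qed
  have "\<exists>B B'. \<forall>n. L2_norm UNIV (U1 n) \<le> B \<and> L2_norm UNIV (d n) \<le> B'"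
  proof (intro exI allI conjI)
    fix n
    have dn: "flux_deriv (U1 n) (u2 n) = d n" by (simp add: d_def)
    note * = a_priori_arithmetic[OF L2_norm_nonneg L2_norm_nonneg L2_norm_nonneg L2_norm_nonneg UM a0
        mult_nonneg_nonneg[OF \<epsilon> M(1)] M(2) p0 p1 dle[of n]
        second_deriv_bound[OF L(3,4)[of n], unfolded dn] energy_bound[OF A[of n] L(2-4)[of n], unfolded dn]]
    show "L2_norm UNIV (U1 n) \<le> 1 + Mu * (2 * (a0 + \<epsilon> * M * Mu) + (2 * (\<epsilon> * M) + p1)) / p0" using *(1) by simp
    show "L2_norm UNIV (d n) \<le> 2 * (a0 + \<epsilon> * M * Mu) + (2 * (\<epsilon> * M) + p1) * (1 + Mu * (2 * (a0 + \<epsilon> * M * Mu) + (2 * (\<epsilon> * M) + p1)) / p0)"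
      using *(2) by simp
  qed
  then obtain B B' where B: "\<And>n. L2_norm UNIV (U1 n) \<le> B" "\<And>n. L2_norm UNIV (d n) \<le> B'" by blast
  have B0: "0 \<le> B" "0 \<le> B'" using order_trans[OF L2_norm_nonneg B(1)] order_trans[OF L2_norm_nonneg B(2)] by blast+
  define V where "V = (\<lambda>n. flux (U1 n))"
  have Vp: "antideriv UNIV (V n) (d n)" for n unfolding V_def d_def by (rule flux_primitive[OF A(2)])
  have VL: "V n \<in> L2 UNIV" for n unfolding V_def by (rule flux_L2(1)[OF L(3)])
  define F where "F = (\<lambda>n x. (U n x, V n x))"
  \<comment> \<open>Cells have length 1, so this interval contains every cell that meets \<open>Q\<close>.\<close>
  define S where "S = {l - 1..r + 1}"
  define b where "b = B + B' + 1"
  have b0: "b > 0" using B0 by (simp add: b_def)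
  obtain g k where k: "strict_mono (k :: nat \<Rightarrow> nat)"
    and g: "\<And>e. 0 < e \<Longrightarrow> \<exists>N. \<forall>n x. n \<ge> N \<and> x \<in> S \<longrightarrow> norm (F (k n) x - g x) < e"
  proof (rule Arzela_Ascoli[of S F "exp (growth 0) * (Mu + pm * B + (q1 * Mu + B'))"])
    show "compact S" by (simp add: S_def)
    show "norm (F n x) \<le> exp (growth 0) * (Mu + pm * B + (q1 * Mu + B'))" for n x
      using represents_pointwise_bound[OF R[of n] UM[of n] B(1)[of n] B(2)[of n, unfolded d_def], of x] norm_Pair_le[of "U n x" "V n x"]
      unfolding F_def V_def by linarith
    fix x e :: real assume e: "0 < e"
    show "\<exists>d>0. \<forall>n y. y \<in> S \<and> norm (x - y) < d \<longrightarrow> norm (F n x - F n y) < e"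
    proof (intro exI[of _ "(e / b)\<^sup>2"] conjI allI impI)
      show "0 < (e / b)\<^sup>2" using e b0 by simp
      fix n y assume y: "y \<in> S \<and> norm (x - y) < (e / b)\<^sup>2"
      then have "sqrt \<bar>x - y\<bar> < e / b" using e b0 by (intro real_less_lsqrt) auto
      then have s: "b * sqrt \<bar>x - y\<bar> < e" using b0 by (simp add: pos_less_divide_eq mult.commute)
      have "norm (F n x - F n y) \<le> cmod (U n x - U n y) + cmod (V n x - V n y)"
        unfolding F_def using norm_Pair_le[of "U n x - U n y" "V n x - V n y"] by simp
      also have "\<dots> \<le> B * sqrt \<bar>x - y\<bar> + B' * sqrt \<bar>x - y\<bar>"
        by (intro add_mono holder_half[OF A(1) L(3) B(1)] holder_half[OF Vp dL B(2)])
      also have "\<dots> \<le> b * sqrt \<bar>x - y\<bar>" by (simp add: b_def algebra_simps)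
      finally show "norm (F n x - F n y) < e" using s by linarith
    qed
  qed (rule that)
  have close: "\<exists>N. \<forall>m\<ge>N. \<forall>n\<ge>N. \<forall>x\<in>S. cmod (U (k m) x - U (k n) x) \<le> e \<and> cmod (V (k m) x - V (k n) x) \<le> e" if "0 < e" for e
  proof -
    obtain N where N: "\<And>n x. n \<ge> N \<Longrightarrow> x \<in> S \<Longrightarrow> norm (F (k n) x - g x) < e / 2" using g[of "e / 2"] \<open>0 < e\<close> by auto
    have "cmod (U (k m) x - U (k n) x) \<le> e \<and> cmod (V (k m) x - V (k n) x) \<le> e" if "m \<ge> N" "n \<ge> N" "x \<in> S" for m n x
    proof -
      have "norm (F (k m) x - F (k n) x) < e"
        using N[OF that(1,3)] N[OF that(2,3)] norm_triangle_ineq4[of "F (k m) x - g x" "F (k n) x - g x"] by simp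
      then show ?thesis
        using norm_fst_le[of "U (k m) x - U (k n) x" "V (k m) x - V (k n) x"] norm_snd_le[of "V (k m) x - V (k n) x" "U (k m) x - U (k n) x"]
        by (simp add: F_def)
    qed
    then show ?thesis by blast
  qed
  define J where "J = {n. cell x0 n \<inter> Q \<noteq> {}}"
  have J: "finite J" unfolding J_def Q by (rule finite_cells_meeting_interval)
  have JS: "cell x0 n \<subseteq> S" if "n \<in> J" for n
  proof -
    have "cell x0 n \<inter> Q \<noteq> {}" using that by (simp only: J_def mem_Collect_eq not_False_eq_True)
    then obtain x where "x \<in> cell x0 n" "x \<in> Q" by blast
    then show ?thesis by (auto simp: S_def Q)
  qed
  have solJ: "sol \<mu> (cell x0 n) (U i) (V i) (f i)" if "n \<notin> J" for n i
    unfolding V_def f_def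
    by (rule residual_sol[where T = T, OF R Qi(3) T(1)[OF W(1)]]) (use that in \<open>auto simp: J_def is_interval_cc\<close>)
  show False
  proof (rule dichotomy_estimate[OF m \<rho>1])
    fix C assume C: "C \<ge> 0" and est: "\<And>U V f J. finite J \<Longrightarrow> U \<in> L2 UNIV \<Longrightarrow> V \<in> L2 UNIV \<Longrightarrow> f \<in> L2 UNIV \<Longrightarrow>
       (\<And>n. n \<notin> J \<Longrightarrow> sol \<mu> (cell x0 n) U V f) \<Longrightarrow>
       (L2_norm UNIV U)\<^sup>2 \<le> C * ((L2_norm UNIV f)\<^sup>2 +
         (\<Sum>n\<in>J. (cmod (U (x0 + of_int n)) + cmod (V (x0 + of_int n)) +
                  (cmod (U (x0 + of_int n + 1)) + cmod (V (x0 + of_int n + 1))) + L2_norm (cell x0 n) U)\<^sup>2))"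
  have Cauchy: "\<exists>N. \<forall>i\<ge>N. \<forall>j\<ge>N. L2_norm UNIV (\<lambda>x. U (k i) x - U (k j) x) < e" if e: "0 < e" for e
  proof -
    \<comment> \<open>The constant in \<open>C * ((2 \<eta>)\<^sup>2 + card J * (5 \<eta>)\<^sup>2) = c \<eta>\<^sup>2\<close>, the bound for the squared distance obtained below.\<close>
    define c where "c = C * (4 + real (card J) * 25)"
    have c: "0 \<le> c" using C by (simp add: c_def)
    define \<eta> where "\<eta> = e / sqrt (c + 1)"
    have \<eta>: "\<eta> > 0" using e c by (simp add: \<eta>_def)
    obtain N1 where N1: "\<And>i j x. i \<ge> N1 \<Longrightarrow> j \<ge> N1 \<Longrightarrow> x \<in> S \<Longrightarrow>
        cmod (U (k i) x - U (k j) x) \<le> \<eta> \<and> cmod (V (k i) x - V (k j) x) \<le> \<eta>" using close[OF \<eta>] by blast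
    obtain N2 where N2: "\<And>n. n \<ge> N2 \<Longrightarrow> L2_norm UNIV (f n) < \<eta>"
      using LIMSEQ_D[OF lim \<eta>] by (auto simp: f_def abs_of_nonneg)
    have "L2_norm UNIV (\<lambda>x. U (k i) x - U (k j) x) < e" if i: "i \<ge> max N1 N2" and j: "j \<ge> max N1 N2" for i j
    proof -
      let ?U = "\<lambda>x. U (k i) x - U (k j) x" and ?V = "\<lambda>x. V (k i) x - V (k j) x" and ?f = "\<lambda>x. f (k i) x - f (k j) x"
      have cl: "cmod (?U x) \<le> \<eta>" "cmod (?V x) \<le> \<eta>" if "x \<in> S" for x using N1[of i j x] that i j by auto
      have ki: "N2 \<le> k i" "N2 \<le> k j" using seq_suble[OF k, of i] seq_suble[OF k, of j] i j by auto
      have fn: "L2_norm UNIV ?f \<le> 2 * \<eta>"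
        using L2_diff(2)[OF fL fL, of "k i" "k j"] N2[OF ki(1)] N2[OF ki(2)] by linarith
      have "(L2_norm UNIV ?U)\<^sup>2 \<le> C * ((L2_norm UNIV ?f)\<^sup>2 +
         (\<Sum>n\<in>J. (cmod (?U (x0 + of_int n)) + cmod (?V (x0 + of_int n)) +
                  (cmod (?U (x0 + of_int n + 1)) + cmod (?V (x0 + of_int n + 1))) + L2_norm (cell x0 n) ?U)\<^sup>2))"
        by (rule est[OF J L2_diff(1)[OF L(2) L(2)] L2_diff(1)[OF VL VL] L2_diff(1)[OF fL fL] sol_diff[OF solJ solJ]])
      also have "\<dots> \<le> C * ((2 * \<eta>)\<^sup>2 + (\<Sum>n\<in>J. (5 * \<eta>)\<^sup>2))"
      proof (intro mult_left_mono[OF _ C] add_mono sum_mono power_mono)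
        fix n assume n: "n \<in> J"
        have "x0 + of_int n \<in> S" "x0 + of_int n + 1 \<in> S" using JS[OF n] by auto
        moreover have "L2_norm (cell x0 n) ?U \<le> \<eta>"
          using JS[OF n] cl(1)
          by (intro L2_norm_cell_le continuous_on_subset[OF antideriv_continuous_on[OF antideriv_diff[OF A(1) A(1)]]]) auto
        ultimately show "cmod (?U (x0 + of_int n)) + cmod (?V (x0 + of_int n)) +
                  (cmod (?U (x0 + of_int n + 1)) + cmod (?V (x0 + of_int n + 1))) + L2_norm (cell x0 n) ?U \<le> 5 * \<eta>"
          using cl[of "x0 + of_int n"] cl[of "x0 + of_int n + 1"] by linarith
      qed (auto intro: fn add_nonneg_nonneg)
      also have "\<dots> = c * \<eta>\<^sup>2" by (simp add: c_def power_mult_distrib algebra_simps)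
      also have "\<dots> < e\<^sup>2"
      proof -
        have "\<eta>\<^sup>2 = e\<^sup>2 / (c + 1)" using c by (simp add: \<eta>_def power_divide)
        then have "c * \<eta>\<^sup>2 = (c / (c + 1)) * e\<^sup>2" by simp
        also have "\<dots> < 1 * e\<^sup>2" using e c by (intro mult_strict_right_mono) auto
        finally show ?thesis by simp
      qed
      finally show ?thesis by (rule power2_less_imp_less) (use e in simp)
    qed
    then show ?thesis by blast
  qed
  obtain G where G: "G \<in> L2 UNIV" "(\<lambda>n. L2_norm UNIV (\<lambda>x. U (k n) x - G x)) \<longlonglongrightarrow> 0"
    by (rule L2_complete[of "\<lambda>n. U (k n)", OF L(2) Cauchy])
  have eq: "L2_norm UNIV (\<lambda>x. u (k n) x - G x) = L2_norm UNIV (\<lambda>x. U (k n) x - G x)" for n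
  proof (rule L2_cong_AE(2)[OF L2_diff(1)[OF L(2) G(1)] L2_measurable[OF L2_diff(1)[OF L(1) G(1)]]])
    show "AE x in lborel. x \<in> UNIV \<longrightarrow> u (k n) x - G x = U (k n) x - G x"
      using uU[of "k n"] by eventually_elim simp
  qed
  have "(\<lambda>n. L2_norm UNIV (\<lambda>x. u (k n) x - G x)) \<longlonglongrightarrow> 0" unfolding eq by (rule G(2))
  then show False using nc k G(1) by blast
  qed
qed

section \<open>Piecewise smooth coefficients\<close>

lemma locally_finite_countable:
  assumes "locally_finite_set B" shows "countable B"
proof -
  have "B = (\<Union>n. B \<inter> {- real n..real n})"
  proof -
    have "x \<in> (\<Union>n. B \<inter> {- real n..real n})" if "x \<in> B" for x
    proof -
      obtain n where "\<bar>x\<bar> \<le> real n" using real_arch_simple by blast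
      then have "x \<in> B \<inter> {- real n..real n}" using that by auto
      then show ?thesis by blast
    qed
    then show ?thesis by blast
  qed
  moreover have "countable (\<Union>n. B \<inter> {- real n..real n})"
    using assms unfolding locally_finite_set_def by (intro countable_UN[OF countableI_type] countable_finite) auto
  ultimately show ?thesis by simp
qed

lemma piecewise_cont_measurable:
  assumes "piecewise_cont f" shows "f \<in> borel_measurable borel"
proof -
  obtain B where B: "locally_finite_set B" "\<And>x. x \<notin> B \<Longrightarrow> isCont f x"
    using assms unfolding piecewise_cont_def by blast
  show ?thesis
    by (rule borel_measurable_continuous_countable_exceptions[OF locally_finite_countable[OF B(1)]])
       (use B(2) in \<open>simp add: continuous_at_imp_continuous_on\<close>)
qed

text \<open>
  One-sided limits at every point give local bounds, which bisection combines.
\<close>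

lemma piecewise_cont_bounded:
  assumes f: "piecewise_cont f" and ab: "a \<le> b"
  shows "\<exists>C. \<forall>x\<in>{a..b}. \<bar>f x\<bar> \<le> C"
proof (rule Bolzano[OF ab, where P = "\<lambda>a b. \<exists>C. \<forall>x\<in>{a..b}. \<bar>f x\<bar> \<le> C"])
  fix a b c :: real
  assume "\<exists>C. \<forall>x\<in>{a..b}. \<bar>f x\<bar> \<le> C" "\<exists>C. \<forall>x\<in>{b..c}. \<bar>f x\<bar> \<le> C" "a \<le> b" "b \<le> c"
  then obtain C D where CD: "\<And>x. x \<in> {a..b} \<Longrightarrow> \<bar>f x\<bar> \<le> C" "\<And>x. x \<in> {b..c} \<Longrightarrow> \<bar>f x\<bar> \<le> D" by blast
  have "\<bar>f x\<bar> \<le> max C D" if "x \<in> {a..c}" for x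
    using CD(1)[of x] CD(2)[of x] that by (cases "x \<le> b") auto
  then show "\<exists>C. \<forall>x\<in>{a..c}. \<bar>f x\<bar> \<le> C" by blast
next
  fix x :: real
  obtain l1 l2 where l: "(f \<longlongrightarrow> l1) (at_left x)" "(f \<longlongrightarrow> l2) (at_right x)"
  proof -
    obtain B where B: "\<And>x. x \<notin> B \<Longrightarrow> isCont f x"
      "\<And>x. x \<in> B \<Longrightarrow> (\<exists>l. (f \<longlongrightarrow> l) (at_left x)) \<and> (\<exists>l. (f \<longlongrightarrow> l) (at_right x))"
      using f unfolding piecewise_cont_def by blast
    show ?thesis
    proof (cases "x \<in> B")
      case True then show ?thesis using B(2) that by blast
    next
      case False
      then have "(f \<longlongrightarrow> f x) (at x)" using B(1) by (simp add: isCont_def)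
      then have "(f \<longlongrightarrow> f x) (at_left x)" "(f \<longlongrightarrow> f x) (at_right x)" by (simp_all add: filterlim_at_split)
      then show ?thesis by (rule that)
    qed
  qed
  have "eventually (\<lambda>y. \<bar>f y\<bar> < \<bar>l1\<bar> + 1) (at_left x)"
    using order_tendstoD(2)[OF tendsto_rabs[OF l(1)], of "\<bar>l1\<bar> + 1"] by simp
  then obtain d1 where d1: "d1 < x" "\<And>y. d1 < y \<Longrightarrow> y < x \<Longrightarrow> \<bar>f y\<bar> < \<bar>l1\<bar> + 1"
    unfolding eventually_at_left_field by blast
  have "eventually (\<lambda>y. \<bar>f y\<bar> < \<bar>l2\<bar> + 1) (at_right x)"
    using order_tendstoD(2)[OF tendsto_rabs[OF l(2)], of "\<bar>l2\<bar> + 1"] by simp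
  then obtain d2 where d2: "d2 > x" "\<And>y. x < y \<Longrightarrow> y < d2 \<Longrightarrow> \<bar>f y\<bar> < \<bar>l2\<bar> + 1"
    unfolding eventually_at_right_field by blast
  show "\<exists>d>0. \<forall>a b. a \<le> x \<and> x \<le> b \<and> b - a < d \<longrightarrow> (\<exists>C. \<forall>x\<in>{a..b}. \<bar>f x\<bar> \<le> C)"
  proof (rule exI[of _ "min (x - d1) (d2 - x)"], intro conjI allI impI)
    show "0 < min (x - d1) (d2 - x)" using d1 d2 by simp
    fix a b assume ab: "a \<le> x \<and> x \<le> b \<and> b - a < min (x - d1) (d2 - x)"
    have "\<bar>f y\<bar> \<le> max (\<bar>f x\<bar>) (max (\<bar>l1\<bar> + 1) (\<bar>l2\<bar> + 1))" if y: "y \<in> {a..b}" for y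
    proof (cases y x rule: linorder_cases)
      case less
      then have "\<bar>f y\<bar> < \<bar>l1\<bar> + 1" using ab y by (intro d1(2)) auto
      then show ?thesis by simp
    next
      case greater
      then have "\<bar>f y\<bar> < \<bar>l2\<bar> + 1" using ab y by (intro d2(2)) auto
      then show ?thesis by simp
    qed simp
    then show "\<exists>C. \<forall>x\<in>{a..b}. \<bar>f x\<bar> \<le> C" by blast
  qed
qed

lemma piecewise_cont_diff_primitive:
  assumes f: "piecewise_cont_diff f"
  obtains B g where "locally_finite_set B" "g \<in> borel_measurable borel" "piecewise_cont g"
    "\<forall>x. x \<notin> B \<longrightarrow> (f has_real_derivative g x) (at x)"
    "antideriv UNIV (\<lambda>x. of_real (f x)) (\<lambda>x. of_real (g x))"
proof -
  obtain B g where B: "locally_finite_set B" "piecewise_cont g" "\<And>x. x \<notin> B \<Longrightarrow> (f has_real_derivative g x) (at x)"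
    and c: "continuous_on UNIV f"
    using f unfolding piecewise_cont_diff_def by blast
  have gm: "g \<in> borel_measurable borel" by (rule piecewise_cont_measurable[OF B(2)])
  have "antideriv UNIV (\<lambda>x. of_real (f x)) (\<lambda>x. of_real (g x))"
    unfolding antideriv_def
  proof (intro ballI impI)
    fix x y :: real assume xy: "x \<le> y"
    obtain C where C: "\<And>t. t \<in> {x..y} \<Longrightarrow> \<bar>g t\<bar> \<le> C" using piecewise_cont_bounded[OF B(2) xy] by blast
    have i: "set_integrable lborel {x..y} g"
      unfolding set_integrable_def
    proof (rule integrableI_bounded_set_indicator[where B = C])
      show "AE t in lborel. t \<in> {x..y} \<longrightarrow> norm (g t) \<le> C" using C by (intro AE_I2) auto
    qed (use gm xy in auto)
    have "(g has_integral (f y - f x)) {x..y}"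
    proof (rule fundamental_theorem_of_calculus_interior_strong[OF _ xy])
      show "finite (B \<inter> {x..y})" using B(1) by (simp add: locally_finite_set_def)
      show "(f has_vector_derivative g t) (at t)" if "t \<in> {x<..<y} - B \<inter> {x..y}" for t
        using B(3)[of t] that by (auto simp: has_real_derivative_iff_has_vector_derivative)
      show "continuous_on {x..y} f" by (rule continuous_on_subset[OF c]) simp
    qed
    then have e: "f y - f x = (LINT t:{x..y}|lborel. g t)"
      using set_borel_integral_eq_integral(2)[OF i] by (simp add: integral_unique)
    have ic: "set_integrable lborel {x..y} (\<lambda>t. complex_of_real (g t))"
      using i unfolding set_integrable_def
      by (simp add: scaleR_conv_of_real flip: of_real_mult)
    show "set_integrable lborel {x..y} (\<lambda>t. complex_of_real (g t)) \<and>
      complex_of_real (f y) - complex_of_real (f x) = (LINT t:{x..y}|lborel. complex_of_real (g t))"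
      using ic by (simp add: set_integral_complex_of_real e[symmetric])
  qed
  then show ?thesis using B gm that by blast
qed

lemma periodic_bounded:
  fixes h :: "real \<Rightarrow> real"
  assumes h: "\<And>x. h (x + 1) = h x" and C: "\<And>x. x \<in> {0..1} \<Longrightarrow> \<bar>h x\<bar> \<le> C"
  shows "\<bar>h x\<bar> \<le> C"
proof -
  have "h x = h (frac x)" using periodic_int[where h = h, OF h, of "frac x" "\<lfloor>x\<rfloor>"] by (simp add: frac_def)
  then show ?thesis using C[of "frac x"] frac_ge_0[of x] frac_lt_1[of x] by simp
qed

text \<open>
  Off the translates of the exceptional points the derivative is periodic, so its bound on one period
  holds almost everywhere. Truncation at this bound gives a density that is bounded everywhere.
\<close>

lemma periodic_piecewise_cont_diff_primitive:
  assumes f: "piecewise_cont_diff f" and per: "\<And>x. f (x + 1) = f x"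
  obtains f' C where "f' \<in> borel_measurable borel" "\<forall>x. \<bar>f' x\<bar> \<le> C"
    "antideriv UNIV (\<lambda>x. of_real (f x)) (\<lambda>x. of_real (f' x))"
proof -
  obtain B g where B: "locally_finite_set B" and gm: "g \<in> borel_measurable borel" and g: "piecewise_cont g"
    and D': "\<forall>x. x \<notin> B \<longrightarrow> (f has_real_derivative g x) (at x)"
    and A: "antideriv UNIV (\<lambda>x. of_real (f x)) (\<lambda>x. of_real (g x))"
    by (rule piecewise_cont_diff_primitive[OF f])
  note D = D'[rule_format]
  obtain C where C: "\<And>x. x \<in> {0..1} \<Longrightarrow> \<bar>g x\<bar> \<le> C" using piecewise_cont_bounded[OF g zero_le_one] by blast
  have C0: "0 \<le> C" using order_trans[OF abs_ge_zero C[of 0]] by simp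
  define f' where "f' = (\<lambda>x. if \<bar>g x\<bar> \<le> C then g x else 0)"
  have m: "f' \<in> borel_measurable borel" unfolding f'_def using gm by measurable
  \<comment> \<open>All translates of exceptional points.\<close>
  define N where "N = (\<Union>n::int. (\<lambda>x. x + of_int n) ` B)"
  have N: "countable N" unfolding N_def by (intro countable_UN countable_image locally_finite_countable[OF B]) auto
  have "f' x = g x" if x: "x \<notin> N" for x
  proof -
    have nB: "x - of_int n \<notin> B" for n
    proof
      assume "x - of_int n \<in> B"
      then have "(x - of_int n) + of_int n \<in> N" unfolding N_def by blast
      then show False using x by simp
    qed
    have "(f has_real_derivative g x) (at x)" using D[of x] nB[of 0] by simp
    moreover have "((\<lambda>y. f (y + of_int (- \<lfloor>x\<rfloor>))) has_real_derivative g (x + of_int (- \<lfloor>x\<rfloor>))) (at x)"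
      by (rule DERIV_shift[THEN iffD1], rule D) (use nB[of "\<lfloor>x\<rfloor>"] in simp)
    then have "(f has_real_derivative g (x + of_int (- \<lfloor>x\<rfloor>))) (at x)"
      by (simp only: periodic_int[where h = f, OF per])
    ultimately have "g x = g (x + of_int (- \<lfloor>x\<rfloor>))" by (rule DERIV_unique)
    also have "x + of_int (- \<lfloor>x\<rfloor>) = frac x" by (simp add: frac_def)
    finally have "\<bar>g x\<bar> \<le> C" using C[of "frac x"] frac_ge_0[of x] frac_lt_1[of x] by simp
    then show ?thesis by (simp add: f'_def)
  qed
  moreover have "AE x in lborel. x \<notin> N" by (rule AE_not_in[OF countable_imp_null_set_lborel[OF N]])
  ultimately have "AE x in lborel. x \<in> UNIV \<longrightarrow> complex_of_real (g x) = of_real (f' x)"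
    by (auto elim!: eventually_mono)
  then have "antideriv UNIV (\<lambda>x. of_real (f x)) (\<lambda>x. of_real (f' x))"
    by (rule antideriv_cong_AE[OF A, rotated 3]) (use m in \<open>auto simp: set_borel_measurable_def\<close>)
  moreover have "\<bar>f' x\<bar> \<le> C" for x using C0 by (simp add: f'_def)
  ultimately show ?thesis using m that by blast
qed

text \<open>
  The supremum in \<open>max_abs_deriv\<close> is taken over a bounded set of numbers, hence is an actual bound: on
  \<open>[l, r]\<close> only finitely many exceptional points can contribute. The bound on \<open>a\<close> itself comes from
  integrating from \<open>l\<close>, where \<open>a\<close> vanishes by continuity.
\<close>

lemma max_abs_deriv_bound:
  assumes a: "piecewise_cont_diff a" and z: "\<And>x. x \<notin> {l..r} \<Longrightarrow> a x = 0" and lr: "l < r"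
  obtains a' where "a' \<in> borel_measurable borel" "antideriv UNIV (\<lambda>x. of_real (a x)) (\<lambda>x. of_real (a' x))"
    "AE x in lborel. x \<in> {l..r} \<longrightarrow> \<bar>a' x\<bar> \<le> max_abs_deriv {l..r} a"
    "\<forall>x\<in>{l..r}. \<bar>a x\<bar> \<le> (r - l) * max_abs_deriv {l..r} a"
    "0 \<le> max_abs_deriv {l..r} a"
proof -
  obtain B g where B: "locally_finite_set B" and gm: "g \<in> borel_measurable borel" and g: "piecewise_cont g"
    and D': "\<forall>x. x \<notin> B \<longrightarrow> (a has_real_derivative g x) (at x)"
    and A: "antideriv UNIV (\<lambda>x. of_real (a x)) (\<lambda>x. of_real (g x))"
    by (rule piecewise_cont_diff_primitive[OF a])
  note D = D'[rule_format]
  define m where "m = max_abs_deriv {l..r} a"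
  obtain C where C: "\<And>x. x \<in> {l..r} \<Longrightarrow> \<bar>g x\<bar> \<le> C" using piecewise_cont_bounded[OF g less_imp_le[OF lr]] by blast
  have bdd: "bdd_above ((\<lambda>x. \<bar>deriv a x\<bar>) ` {x \<in> {l..r}. a differentiable (at x)})"
  proof (rule bdd_above_mono)
    show "bdd_above ((\<lambda>x. \<bar>g x\<bar>) ` {l..r} \<union> (\<lambda>x. \<bar>deriv a x\<bar>) ` (B \<inter> {l..r}))"
    proof -
      have "bdd_above ((\<lambda>x. \<bar>g x\<bar>) ` {l..r})" by (rule bdd_aboveI2) (rule C)
      moreover have "finite (B \<inter> {l..r})" using B by (simp add: locally_finite_set_def)
      then have "bdd_above ((\<lambda>x. \<bar>deriv a x\<bar>) ` (B \<inter> {l..r}))" by (intro bdd_above_finite finite_imageI)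
      ultimately show ?thesis by simp
    qed
    show "(\<lambda>x. \<bar>deriv a x\<bar>) ` {x \<in> {l..r}. a differentiable (at x)} \<subseteq> (\<lambda>x. \<bar>g x\<bar>) ` {l..r} \<union> (\<lambda>x. \<bar>deriv a x\<bar>) ` (B \<inter> {l..r})"
    proof (rule image_subsetI)
      fix x assume "x \<in> {x \<in> {l..r}. a differentiable (at x)}"
      then have x: "x \<in> {l..r}" by simp
      show "\<bar>deriv a x\<bar> \<in> (\<lambda>x. \<bar>g x\<bar>) ` {l..r} \<union> (\<lambda>x. \<bar>deriv a x\<bar>) ` (B \<inter> {l..r})"
      proof (cases "x \<in> B")
        case False
        then have "deriv a x = g x" using D DERIV_imp_deriv by blast
        then show ?thesis using x by auto
      qed (use x in blast)
    qed
  qed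
  have gle: "\<bar>g x\<bar> \<le> m" if "x \<notin> B" "x \<in> {l..r}" for x
  proof -
    have "deriv a x = g x" "a differentiable (at x)" using D[OF that(1)] DERIV_imp_deriv real_differentiable_def by blast+
    then have eq: "\<bar>g x\<bar> = \<bar>deriv a x\<bar>" and mem: "x \<in> {x \<in> {l..r}. a differentiable (at x)}" using that by auto
    show ?thesis unfolding eq m_def max_abs_deriv_def by (rule cSUP_upper[OF mem bdd])
  qed
  have "AE x in lborel. x \<notin> B"
    by (rule AE_not_in[OF countable_imp_null_set_lborel[OF locally_finite_countable[OF B]]])
  then have ae: "AE x in lborel. x \<in> {l..r} \<longrightarrow> \<bar>g x\<bar> \<le> m" by eventually_elim (use gle in blast)
  have "infinite ({l..r} - B)"
  proof
    assume "finite ({l..r} - B)"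
    moreover have "finite ({l..r} \<inter> B)" using B by (simp add: locally_finite_set_def inf_commute)
    ultimately have "finite (({l..r} - B) \<union> ({l..r} \<inter> B))" by blast
    moreover have "({l..r} - B) \<union> ({l..r} \<inter> B) = {l..r}" by blast
    ultimately show False using lr infinite_Icc[of l r] by simp
  qed
  then obtain y where "y \<in> {l..r} - B" by (metis finite.emptyI ex_in_conv)
  then have m0: "0 \<le> m" using order_trans[OF abs_ge_zero gle[of y]] by blast
  have al: "a l = 0"
  proof -
    have "continuous_on UNIV a" using a by (simp add: piecewise_cont_diff_def)
    then have "isCont a l" by (simp add: continuous_on_eq_continuous_at)
    then have "(a \<longlongrightarrow> a l) (at_left l)" by (simp add: isCont_def filterlim_at_split)
    moreover have "(a \<longlongrightarrow> 0) (at_left l)"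
      by (rule tendsto_eventually) (use z in \<open>auto simp: eventually_at_left_field intro!: exI[of _ "l - 1"]\<close>)
    ultimately show ?thesis by (rule tendsto_unique[OF trivial_limit_at_left_real])
  qed
  have "\<bar>a x\<bar> \<le> (r - l) * m" if x: "x \<in> {l..r}" for x
  proof -
    have gi: "set_integrable lborel {l..x} (\<lambda>t. cmod (of_real (g t)))"
      by (rule set_integrable_norm[OF antideriv_integrable[OF A]]) auto
    have mi: "set_integrable lborel {l..x} (\<lambda>t. m)"
      unfolding set_integrable_def by (rule borel_integrable_compact) auto
    have "\<bar>a x\<bar> = cmod (of_real (a x) - of_real (a l))" by (simp add: al)
    also have "\<dots> \<le> (LINT t:{l..x}|lborel. cmod (of_real (g t)))"
      by (rule antideriv_norm_le[OF A]) (use x in auto)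
    also have "\<dots> \<le> (LINT t:{l..x}|lborel. m)"
      by (rule set_integral_mono_AE[OF gi mi]) (use ae x in \<open>auto elim!: eventually_mono\<close>)
    also have "\<dots> = (x - l) * m" using x by (simp add: set_lebesgue_integral_def)
    also have "\<dots> \<le> (r - l) * m" using x m0 by (intro mult_right_mono) auto
    finally show ?thesis .
  qed
  then show ?thesis using that[OF gm A] ae m0 unfolding m_def by blast
qed

section \<open>Solutions with zero Cauchy data\<close>

lemma L2_norm_sq_Icc_integral:
  assumes c: "continuous_on {a..b} U"
  shows "(L2_norm {a..b} U)\<^sup>2 = integral {a..b} (\<lambda>x. (cmod (U x))\<^sup>2)"
proof -
  have "set_integrable lborel {a..b} (\<lambda>x. (cmod (U x))\<^sup>2)" by (rule L2_sq_integrable[OF continuous_imp_L2_Icc[OF c]])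
  then show ?thesis unfolding L2_norm_sq by (rule set_borel_integral_eq_integral(2))
qed

lemma pairing_bound:
  assumes u: "u \<in> L2 S" and v: "v \<in> L2 S"
  shows "cmod (LINT x:S|lborel. u x * v x) \<le> L2_norm S u * L2_norm S v"
proof -
  have "cmod (LINT x:S|lborel. u x * v x) \<le> (LINT x:S|lborel. cmod (u x * v x))"
    by (rule set_integral_norm_bound[OF L2_mult_integrable[OF u v]])
  also have "\<dots> \<le> L2_norm S u * L2_norm S v" using L2_cauchy_schwarz[OF u v] by (simp add: norm_mult)
  finally show ?thesis .
qed

lemma L2_norm_sq_pairing:
  assumes "u \<in> L2 S" shows "(LINT x:S|lborel. u x * cnj (u x)) = of_real ((L2_norm S u)\<^sup>2)"
  by (simp only: complex_norm_square[symmetric] set_integral_complex_of_real L2_norm_sq)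

text \<open>
  A solution with zero Cauchy data, driven by a source controlled by its own \<open>L\<^sub>2\<close> norm on initial
  segments, vanishes.
\<close>

lemma local_control_imp_zero:
  assumes lr: "l < r" and U: "antideriv {l..r} U U1" and U1: "antideriv {l..r} U1 u2" and u2: "u2 \<in> L2 {l..r}"
    and z: "U l = 0" "U1 l = 0"
    and K: "0 \<le> K" "\<And>d. l < d \<Longrightarrow> d \<le> r \<Longrightarrow> (L2_norm {l..d} u2)\<^sup>2 \<le> K * ((L2_norm {l..d} U)\<^sup>2 + (L2_norm {l..d} U1)\<^sup>2)"
    and x: "x \<in> {l..r}"
  shows "U x = 0"
proof -
  define E where "E = (\<lambda>x. (cmod (U x))\<^sup>2 + (cmod (U1 x))\<^sup>2)"
  note cU = antideriv_continuous_on_Icc[OF U] and cU1 = antideriv_continuous_on_Icc[OF U1]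
  have cE: "continuous_on {l..r} E" unfolding E_def by (intro continuous_intros cU cU1)
  define C where "C = (r - l) * (1 + K)"
  have C: "0 \<le> C" using lr K by (simp add: C_def)
  have key: "E d \<le> 0 + C * integral {l..d} E" if d: "d \<in> {l..r}" for d
  proof (cases "d = l")
    case True then show ?thesis by (simp add: E_def z)
  next
    case False
    then have ld: "l < d" "d \<le> r" using d by auto
    have sub: "{l..d} \<subseteq> {l..r}" using ld by auto
    have c: "continuous_on {l..d} U" "continuous_on {l..d} U1" using cU cU1 sub continuous_on_subset by blast+
    have iE: "integral {l..d} E = (L2_norm {l..d} U)\<^sup>2 + (L2_norm {l..d} U1)\<^sup>2"
      unfolding E_def L2_norm_sq_Icc_integral[OF c(1)] L2_norm_sq_Icc_integral[OF c(2)]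
      by (intro Henstock_Kurzweil_Integration.integral_add integrable_continuous_interval continuous_intros c)
    have u2d: "u2 \<in> L2 {l..d}" by (rule L2_subset(1)[OF u2 sub]) simp
    have p: "(cmod (W d))\<^sup>2 \<le> (r - l) * (L2_norm {l..d} w)\<^sup>2"
      if W: "antideriv {l..r} W w" "w \<in> L2 {l..d}" "W l = 0" for W w
    proof -
      have "cmod (W d) \<le> (LINT t:{l..d}|lborel. cmod (w t))"
        using antideriv_norm_le[OF W(1), of l d] ld W(3) by simp
      also have "\<dots> \<le> sqrt (d - l) * L2_norm {l..d} w" by (rule L2_imp_integrable_Icc(2)[OF W(2)]) (use ld in simp)
      finally have "(cmod (W d))\<^sup>2 \<le> (sqrt (d - l) * L2_norm {l..d} w)\<^sup>2" by (rule power_mono) simp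
      also have "\<dots> = (d - l) * (L2_norm {l..d} w)\<^sup>2" using ld by (simp add: power_mult_distrib)
      also have "\<dots> \<le> (r - l) * (L2_norm {l..d} w)\<^sup>2" using ld by (intro mult_right_mono) auto
      finally show ?thesis .
    qed
    have 1: "(cmod (U d))\<^sup>2 \<le> (r - l) * integral {l..d} E"
      using p[OF U continuous_imp_L2_Icc[OF c(2)] z(1)] lr iE
      by (elim order_trans) (intro mult_left_mono, auto)
    have "(cmod (U1 d))\<^sup>2 \<le> (r - l) * (L2_norm {l..d} u2)\<^sup>2" by (rule p[OF U1 u2d z(2)])
    also have "\<dots> \<le> (r - l) * (K * integral {l..d} E)" using K(2)[OF ld] lr by (intro mult_left_mono) (auto simp: iE)
    finally show ?thesis using 1 by (simp add: E_def C_def algebra_simps)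
  qed
  have "E x \<le> 0 * exp (C * (x - l))" by (rule gronwall[OF cE C key x])
  then have "(cmod (U x))\<^sup>2 + (cmod (U1 x))\<^sup>2 \<le> 0" by (simp add: E_def)
  then have "(cmod (U x))\<^sup>2 \<le> 0" using zero_le_power2[of "cmod (U1 x)"] by linarith
  then show ?thesis by simp
qed

lemma weighted_square_integral:
  fixes q :: "real \<Rightarrow> real"
  assumes U: "U \<in> L2 S" and q: "q \<in> borel_measurable borel" "\<And>x. \<bar>q x\<bar> \<le> q1"
  shows "set_integrable lborel S (\<lambda>x. q x * (cmod (U x))\<^sup>2)"
    "\<bar>LINT x:S|lborel. q x * (cmod (U x))\<^sup>2\<bar> \<le> q1 * (L2_norm S U)\<^sup>2"
proof -
  have i0: "set_integrable lborel S (\<lambda>x. q1 * (cmod (U x))\<^sup>2)"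
    by (rule set_integrable_mult_right[OF L2_sq_integrable[OF U]])
  have le: "\<bar>q x * (cmod (U x))\<^sup>2\<bar> \<le> q1 * (cmod (U x))\<^sup>2" for x
    using q(2)[of x] by (simp add: abs_mult mult_right_mono)
  show i: "set_integrable lborel S (\<lambda>x. q x * (cmod (U x))\<^sup>2)"
    unfolding set_integrable_def
  proof (rule Bochner_Integration.integrable_bound[OF i0[unfolded set_integrable_def]])
    have "(\<lambda>x. q x * (indicator S x *\<^sub>R (cmod (U x))\<^sup>2)) \<in> borel_measurable lborel"
      using q(1) borel_measurable_integrable[OF L2_sq_integrable[OF U, unfolded set_integrable_def]]
      by (intro borel_measurable_times) simp_all
    then show "(\<lambda>x. indicator S x *\<^sub>R (q x * (cmod (U x))\<^sup>2)) \<in> borel_measurable lborel"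
      by (simp add: mult.left_commute)
    show "AE x in lborel. norm (indicator S x *\<^sub>R (q x * (cmod (U x))\<^sup>2)) \<le> norm (indicator S x *\<^sub>R (q1 * (cmod (U x))\<^sup>2))"
    proof (rule AE_I2)
      fix x
      show "norm (indicator S x *\<^sub>R (q x * (cmod (U x))\<^sup>2)) \<le> norm (indicator S x *\<^sub>R (q1 * (cmod (U x))\<^sup>2))"
        using order_trans[OF le[of x] abs_ge_self] by (auto simp: indicator_def)
    qed
  qed
  have "\<bar>LINT x:S|lborel. q x * (cmod (U x))\<^sup>2\<bar> \<le> (LINT x:S|lborel. \<bar>q x * (cmod (U x))\<^sup>2\<bar>)"
    using set_integral_norm_bound[OF i] by simp
  also have "\<dots> \<le> (LINT x:S|lborel. q1 * (cmod (U x))\<^sup>2)"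
    by (rule set_integral_mono[OF set_integrable_abs[OF i] i0 le])
  finally show "\<bar>LINT x:S|lborel. q x * (cmod (U x))\<^sup>2\<bar> \<le> q1 * (L2_norm S U)\<^sup>2" by (simp add: L2_norm_sq)
qed

text \<open>
  Green's formula: the equation is integrated against the conjugate of \<open>U\<close>, which vanishes at both ends.
\<close>

lemma pairing_identity:
  fixes P q :: "real \<Rightarrow> real" and U U1 F :: "real \<Rightarrow> complex"
  assumes lr: "l < r" and U: "antideriv {l..r} U U1"
    and V: "antideriv {l..r} (\<lambda>x. of_real (P x) * U1 x) (\<lambda>x. (of_real (q x) - \<mu>) * U x - F x)"
    and Pc: "continuous_on {l..r} P" and U1c: "continuous_on {l..r} U1"
    and q: "q \<in> borel_measurable borel" "\<And>x. \<bar>q x\<bar> \<le> q1"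
    and F: "F \<in> L2 {l..r}" and z: "U l = 0" "U r = 0"
  shows "of_real (LINT x:{l..r}|lborel. P x * (cmod (U1 x))\<^sup>2) + of_real (LINT x:{l..r}|lborel. q x * (cmod (U x))\<^sup>2)
      - \<mu> * of_real ((L2_norm {l..r} U)\<^sup>2) = (LINT x:{l..r}|lborel. F x * cnj (U x))"
proof -
  let ?I = "{l..r}"
  note cU = antideriv_continuous_on_Icc[OF U]
  have UL: "U \<in> L2 ?I" and U1L: "U1 \<in> L2 ?I" by (intro continuous_imp_L2_Icc cU U1c)+
  have m: "antideriv ?I (\<lambda>x. of_real (P x) * U1 x * cnj (U x))
    (\<lambda>x. ((of_real (q x) - \<mu>) * U x - F x) * cnj (U x) + of_real (P x) * U1 x * cnj (U1 x))"
    by (rule antideriv_mult[OF V antideriv_cnj[OF U]]) simp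
  have i1: "set_integrable lborel ?I (\<lambda>x. P x * (cmod (U1 x))\<^sup>2)"
    unfolding set_integrable_def by (intro borel_integrable_compact continuous_intros Pc U1c) simp
  have i2: "set_integrable lborel ?I (\<lambda>x. q x * (cmod (U x))\<^sup>2)" by (rule weighted_square_integral(1)[OF UL q])
  have i3: "set_integrable lborel ?I (\<lambda>x. U x * cnj (U x))" by (rule L2_mult_integrable[OF UL L2_cnj(1)[OF UL]])
  have i4: "set_integrable lborel ?I (\<lambda>x. F x * cnj (U x))" by (rule L2_mult_integrable[OF F L2_cnj(1)[OF UL]])
  have c: "set_integrable lborel ?I (\<lambda>x. complex_of_real (h x))" if "set_integrable lborel ?I h" for h
    using that unfolding set_integrable_def by (simp add: scaleR_conv_of_real flip: of_real_mult)
  have e: "((of_real (q x) - \<mu>) * U x - F x) * cnj (U x) + of_real (P x) * U1 x * cnj (U1 x) =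
    (of_real (P x * (cmod (U1 x))\<^sup>2) + of_real (q x * (cmod (U x))\<^sup>2)) - (\<mu> * (U x * cnj (U x)) + F x * cnj (U x))" for x
    by (simp only: of_real_mult complex_norm_square) (simp add: algebra_simps)
  have "0 = (LINT x:?I|lborel. (of_real (P x * (cmod (U1 x))\<^sup>2) + of_real (q x * (cmod (U x))\<^sup>2)) - (\<mu> * (U x * cnj (U x)) + F x * cnj (U x)))"
    using antideriv_diff_eq[OF m, of l r] lr z unfolding e by simp
  also have "\<dots> = (LINT x:?I|lborel. of_real (P x * (cmod (U1 x))\<^sup>2) + of_real (q x * (cmod (U x))\<^sup>2)) - (LINT x:?I|lborel. \<mu> * (U x * cnj (U x)) + F x * cnj (U x))"
    by (intro set_integral_diff(2) set_integral_add(1) c i1 i2 set_integrable_mult_right i3 i4)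
  also have "(LINT x:?I|lborel. of_real (P x * (cmod (U1 x))\<^sup>2) + of_real (q x * (cmod (U x))\<^sup>2)) =
    complex_of_real (LINT x:?I|lborel. P x * (cmod (U1 x))\<^sup>2) + of_real (LINT x:?I|lborel. q x * (cmod (U x))\<^sup>2)"
    using set_integral_add(2)[OF c[OF i1] c[OF i2]] by (simp only: set_integral_complex_of_real)
  also have "(LINT x:?I|lborel. \<mu> * (U x * cnj (U x)) + F x * cnj (U x)) = \<mu> * of_real ((L2_norm ?I U)\<^sup>2) + (LINT x:?I|lborel. F x * cnj (U x))"
    using set_integral_add(2)[OF set_integrable_mult_right[of \<mu>, OF i3] i4] by (simp only: set_integral_mult_right L2_norm_sq_pairing[OF UL])
  finally show ?thesis by (simp add: algebra_simps)
qed

section \<open>Estimates uniform in the spectral parameter\<close>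

lemma L2_norm_sq_le_sup:
  assumes c: "continuous_on {a..b} U" and ab: "a \<le> b" and B: "\<And>x. x \<in> {a..b} \<Longrightarrow> (cmod (U x))\<^sup>2 \<le> B"
  shows "(L2_norm {a..b} U)\<^sup>2 \<le> (b - a) * B"
proof -
  have i: "set_integrable lborel {a..b} (\<lambda>x. B)" unfolding set_integrable_def by (rule borel_integrable_compact) auto
  have "(L2_norm {a..b} U)\<^sup>2 \<le> (LINT x:{a..b}|lborel. B)"
    unfolding L2_norm_sq by (rule set_integral_mono[OF L2_sq_integrable[OF continuous_imp_L2_Icc[OF c]] i B])
  then show ?thesis using ab by (simp add: set_lebesgue_integral_def)
qed

lemma antideriv_of_real_continuous:
  assumes "antideriv {l..r} (\<lambda>x. of_real (P x)) g" shows "continuous_on {l..r} P"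
  using continuous_on_Re[OF antideriv_continuous_on_Icc[OF assms]] by simp

lemma L2_norm_zero_imp_zero:
  assumes c: "continuous_on {l..r} U" and z: "L2_norm {l..r} U = 0" and ends: "U l = 0" "U r = 0" and x: "x \<in> {l..r}"
  shows "U x = 0"
proof (cases "x \<in> {l<..<r}")
  case True
  have "AE x in lborel. x \<in> {l..r} \<longrightarrow> U x = 0" using z L2_null_iff[OF continuous_imp_L2_Icc[OF c]] by simp
  then have ae: "AE x in lborel. x \<in> {l<..<r} \<longrightarrow> U x = 0" by eventually_elim auto
  show ?thesis
    by (rule continuous_AE_zero_imp_zero[OF _ continuous_on_subset[OF c] ae True]) auto
next
  case False
  then have "x = l \<or> x = r" using x by auto
  then show ?thesis using ends by auto
qed

text \<open>
  The energy \<open>|V|\<^sup>2 + \<Lambda> P |U|\<^sup>2\<close> is chosen so that the large parameter \<open>\<Lambda>\<close> cancels from its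
  derivative up to a multiple of the energy itself.
\<close>

lemma energy_gronwall:
  fixes P P' q :: "real \<Rightarrow> real" and U U1 X :: "real \<Rightarrow> complex" and \<Lambda> :: real
  defines "V \<equiv> \<lambda>x. of_real (P x) * U1 x"
  assumes lr: "l < r" and U: "antideriv {l..r} U U1" and V: "antideriv {l..r} V (\<lambda>x. X x - of_real \<Lambda> * U x)"
    and P: "antideriv {l..r} (\<lambda>x. of_real (P x)) (\<lambda>x. of_real (P' x))"
    and c0: "0 < c0" "\<And>x. x \<in> {l..r} \<Longrightarrow> c0 \<le> P x"
    and c2: "0 \<le> c2" "AE x in lborel. x \<in> {l..r} \<longrightarrow> \<bar>P' x\<bar> \<le> c2"
    and U1c: "continuous_on {l..r} U1" and \<Lambda>: "1 \<le> \<Lambda>"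
    and b: "0 \<le> b" and h: "set_integrable lborel {l..r} h" "\<And>x. x \<in> {l..r} \<Longrightarrow> 0 \<le> h x"
    and X: "\<And>x. x \<in> {l..r} \<Longrightarrow> 2 * (cmod (X x) * cmod (V x)) \<le> b * ((cmod (U x))\<^sup>2 + (cmod (V x))\<^sup>2) + h x"
    and z: "U l = 0" "U1 l = 0" and x: "x \<in> {l..r}"
  shows "c0 * (cmod (U x))\<^sup>2 \<le> (LINT t:{l..r}|lborel. h t) * exp ((b * (1 / c0 + 1) + c2 / c0) * (r - l))"
    "c0\<^sup>2 * (cmod (U1 x))\<^sup>2 \<le> (LINT t:{l..r}|lborel. h t) * exp ((b * (1 / c0 + 1) + c2 / c0) * (r - l))"
proof -
  define k where "k = b * (1 / c0 + 1) + c2 / c0"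
  have k: "0 \<le> k" using b c0 c2 by (simp add: k_def)
  define H where "H = (LINT t:{l..r}|lborel. h t)"
  have H: "0 \<le> H" unfolding H_def by (rule set_integral_nonneg'[OF h(2)])
  note cU = antideriv_continuous_on_Icc[OF U] and cP = antideriv_of_real_continuous[OF P]
  have cV: "continuous_on {l..r} V" unfolding V_def by (intro continuous_intros cP U1c)
  define E where "E = (\<lambda>x. (cmod (V x))\<^sup>2 + \<Lambda> * (P x * (cmod (U x))\<^sup>2))"
  have cE: "continuous_on {l..r} E" unfolding E_def by (intro continuous_intros cU cV cP)
  define W where "W = (\<lambda>x. X x - of_real \<Lambda> * U x)"
  define e where "e = (\<lambda>x. (W x * cnj (V x) + V x * cnj (W x)) +
     of_real \<Lambda> * (of_real (P' x) * (U x * cnj (U x)) + of_real (P x) * (U1 x * cnj (U x) + U x * cnj (U1 x))))"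
  have A: "antideriv {l..r} (\<lambda>x. V x * cnj (V x) + of_real \<Lambda> * (of_real (P x) * (U x * cnj (U x)))) e"
    unfolding e_def
    using V U P by (intro antideriv_add antideriv_mult antideriv_cmult antideriv_cnj) (simp_all add: W_def)
  have Ec: "V x * cnj (V x) + of_real \<Lambda> * (of_real (P x) * (U x * cnj (U x))) = of_real (E x)" for x
    by (simp only: E_def complex_norm_square[symmetric] of_real_add of_real_mult)
  have e_eq: "e x = X x * cnj (V x) + V x * cnj (X x) + of_real (\<Lambda> * P' x) * (U x * cnj (U x))" for x
    unfolding e_def W_def V_def by (simp add: algebra_simps)
  have E_bounds: "c0 * (\<Lambda> * (cmod (U x))\<^sup>2) \<le> E x" "c0 * (cmod (U x))\<^sup>2 \<le> E x" "(cmod (V x))\<^sup>2 \<le> E x" if "x \<in> {l..r}" for x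
  proof -
    have 1: "c0 * (cmod (U x))\<^sup>2 \<le> P x * (cmod (U x))\<^sup>2" using c0(2)[OF that] by (intro mult_right_mono) auto
    then have 2: "\<Lambda> * (c0 * (cmod (U x))\<^sup>2) \<le> \<Lambda> * (P x * (cmod (U x))\<^sup>2)" using \<Lambda> by (intro mult_left_mono) auto
    have 3: "1 * (c0 * (cmod (U x))\<^sup>2) \<le> \<Lambda> * (c0 * (cmod (U x))\<^sup>2)" using \<Lambda> c0(1) by (intro mult_right_mono) auto
    have 4: "0 \<le> c0 * (cmod (U x))\<^sup>2" using c0(1) by simp
    have 5: "0 \<le> (cmod (V x))\<^sup>2" by simp
    have 6: "c0 * (\<Lambda> * (cmod (U x))\<^sup>2) = \<Lambda> * (c0 * (cmod (U x))\<^sup>2)" by (rule mult.left_commute)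
    show "c0 * (\<Lambda> * (cmod (U x))\<^sup>2) \<le> E x" "c0 * (cmod (U x))\<^sup>2 \<le> E x" "(cmod (V x))\<^sup>2 \<le> E x"
      using 2 3 4 5 6 unfolding E_def by linarith+
  qed
  have e_le: "cmod (e x) \<le> k * E x + h x" if x: "x \<in> {l..r}" and p: "\<bar>P' x\<bar> \<le> c2" for x
  proof -
    have "cmod (e x) \<le> cmod (X x * cnj (V x)) + cmod (V x * cnj (X x)) + cmod (of_real (\<Lambda> * P' x) * (U x * cnj (U x)))"
      unfolding e_eq by (intro order_trans[OF norm_triangle_ineq] add_mono norm_triangle_ineq order_refl)
    also have "\<dots> = 2 * (cmod (X x) * cmod (V x)) + \<bar>P' x\<bar> * (\<Lambda> * (cmod (U x))\<^sup>2)"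
      using \<Lambda> by (simp add: norm_mult abs_mult power2_eq_square mult_ac)
    also have "\<dots> \<le> (b * ((cmod (U x))\<^sup>2 + (cmod (V x))\<^sup>2) + h x) + c2 * (\<Lambda> * (cmod (U x))\<^sup>2)"
      using X[OF x] p \<Lambda> by (intro add_mono mult_right_mono) auto
    also have "\<dots> \<le> (b * (E x / c0 + E x) + h x) + c2 * (E x / c0)"
    proof -
      have "(cmod (U x))\<^sup>2 \<le> E x / c0" "\<Lambda> * (cmod (U x))\<^sup>2 \<le> E x / c0"
        using E_bounds(1,2)[OF x] c0(1) by (simp_all add: pos_le_divide_eq mult.commute)
      then show ?thesis using E_bounds(3)[OF x] b c2(1) by (intro add_mono mult_left_mono order_refl) auto
    qed
    also have "\<dots> = k * E x + h x" by (simp add: k_def algebra_simps)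
    finally show ?thesis .
  qed
  have key: "E y \<le> H + k * integral {l..y} E" if y: "y \<in> {l..r}" for y
  proof -
    have sub: "{l..y} \<subseteq> {l..r}" using y by auto
    have iE: "set_integrable lborel {l..y} E"
      unfolding set_integrable_def by (rule borel_integrable_compact[OF _ continuous_on_subset[OF cE sub]]) simp
    have ih: "set_integrable lborel {l..y} h" by (rule set_integrable_subset[OF h(1)]) (use sub in auto)
    have ie: "set_integrable lborel {l..y} (\<lambda>x. cmod (e x))"
      by (rule set_integrable_norm[OF antideriv_integrable[OF A]]) (use y in auto)
    have El: "E l = 0" by (simp add: E_def V_def z)
    have "E y \<le> cmod (of_real (E y) - of_real (E l))" by (simp add: El)
    also have "\<dots> \<le> (LINT x:{l..y}|lborel. cmod (e x))"
      using antideriv_norm_le[OF A, of l y] y unfolding Ec by simp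
    also have "\<dots> \<le> (LINT x:{l..y}|lborel. k * E x + h x)"
    proof (rule set_integral_mono_AE[OF ie])
      show "set_integrable lborel {l..y} (\<lambda>x. k * E x + h x)"
        by (intro set_integral_add(1) set_integrable_mult_right iE ih)
      show "AE x \<in> {l..y} in lborel. cmod (e x) \<le> k * E x + h x"
        using c2(2) by eventually_elim (use e_le sub in auto)
    qed
    also have "\<dots> = k * integral {l..y} E + (LINT x:{l..y}|lborel. h x)"
      using set_integral_add(2)[OF set_integrable_mult_right[of k, OF iE] ih] set_borel_integral_eq_integral(2)[OF iE] by simp
    also have "(LINT x:{l..y}|lborel. h x) \<le> H"
      unfolding H_def by (rule set_integral_mono_set[OF h(1) sub]) (use h(2) in auto)
    finally show ?thesis by simp
  qed
  have "E x \<le> H * exp (k * (x - l))" by (rule gronwall[OF cE k key x])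
  also have "\<dots> \<le> H * exp (k * (r - l))" using H k x by (intro mult_left_mono) (auto intro!: mult_left_mono)
  finally have Ex: "E x \<le> H * exp (k * (r - l))" .
  show "c0 * (cmod (U x))\<^sup>2 \<le> (LINT t:{l..r}|lborel. h t) * exp ((b * (1 / c0 + 1) + c2 / c0) * (r - l))"
    using E_bounds(2)[OF x] Ex by (simp add: H_def k_def)
  have "c0\<^sup>2 \<le> (P x)\<^sup>2" using c0(1) c0(2)[OF x] by (intro power_mono) auto
  then have "c0\<^sup>2 * (cmod (U1 x))\<^sup>2 \<le> (P x)\<^sup>2 * (cmod (U1 x))\<^sup>2" by (intro mult_right_mono) auto
  also have "\<dots> = (cmod (V x))\<^sup>2" by (simp add: V_def norm_mult power_mult_distrib)
  finally show "c0\<^sup>2 * (cmod (U1 x))\<^sup>2 \<le> (LINT t:{l..r}|lborel. h t) * exp ((b * (1 / c0 + 1) + c2 / c0) * (r - l))"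
    using E_bounds(3)[OF x] Ex by (simp add: H_def k_def)
qed

text \<open>
  The smallness required of \<open>\<epsilon>\<close> does not involve \<open>\<mu>\<close>. Pairing the equation with \<open>U\<close> shows two
  things: the form is coercive when \<open>Re \<mu>\<close> is far below the spectrum, and \<open>Im \<mu>\<close> is of the order of
  \<open>\<epsilon>\<close>. For the other \<open>\<mu>\<close> the imaginary part is thus counted with the source, and the energy estimate
  for the real part gives \<open>N\<^sup>2 \<le> c N\<^sup>2\<close> with \<open>c < 1\<close>, where \<open>N\<close> is the first-order Sobolev norm of \<open>U\<close>.
\<close>

lemma first_order_perturbation_imp_zero:
  fixes P P' q :: "real \<Rightarrow> real" and U U1 F :: "real \<Rightarrow> complex" and \<mu> :: complex
  assumes lr: "l < r" and U: "antideriv {l..r} U U1"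
    and V: "antideriv {l..r} (\<lambda>x. of_real (P x) * U1 x) (\<lambda>x. (of_real (q x) - \<mu>) * U x - of_real \<epsilon> * F x)"
    and P: "antideriv {l..r} (\<lambda>x. of_real (P x)) (\<lambda>x. of_real (P' x))"
    and c0: "0 < c0" "\<And>x. x \<in> {l..r} \<Longrightarrow> c0 \<le> P x"
    and c2: "0 \<le> c2" "AE x in lborel. x \<in> {l..r} \<longrightarrow> \<bar>P' x\<bar> \<le> c2"
    and U1c: "continuous_on {l..r} U1"
    and q: "q \<in> borel_measurable borel" "\<And>x. \<bar>q x\<bar> \<le> q1"
    and F: "F \<in> L2 {l..r}" "(L2_norm {l..r} F)\<^sup>2 \<le> M\<^sup>2 * ((L2_norm {l..r} U)\<^sup>2 + (L2_norm {l..r} U1)\<^sup>2)"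
    and M: "0 \<le> M" and \<epsilon>: "0 \<le> \<epsilon>" and z: "U l = 0" "U r = 0" "U1 l = 0"
    and small1: "\<epsilon> * M < min c0 1"
    and small2: "4 * (\<epsilon> * M)\<^sup>2 * exp (((2 * q1 + 3) * (1 / c0 + 1) + c2 / c0) * (r - l)) * ((r - l) * (1 / c0 + 1 / c0\<^sup>2)) < 1"
    and x: "x \<in> {l..r}"
  shows "U x = 0"
proof -
  let ?I = "{l..r}"
  note cU = antideriv_continuous_on_Icc[OF U] and cP = antideriv_of_real_continuous[OF P]
  have UL: "U \<in> L2 ?I" and U1L: "U1 \<in> L2 ?I" by (intro continuous_imp_L2_Icc cU U1c)+
  have q1: "0 \<le> q1" using order_trans[OF abs_ge_zero q(2)[of 0]] .
  define A where "A = (L2_norm ?I U)\<^sup>2"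
  define A1 where "A1 = (L2_norm ?I U1)\<^sup>2"
  define N where "N = sqrt (A + A1)"
  have nn: "0 \<le> A" "0 \<le> A1" "0 \<le> N" and N2: "N\<^sup>2 = A + A1" by (simp_all add: A_def A1_def N_def)
  have UN: "L2_norm ?I U \<le> N" unfolding N_def A_def using nn by (intro real_le_rsqrt) simp
  have FN: "L2_norm ?I F \<le> M * N"
    by (rule power2_le_imp_le) (use F(2) M nn in \<open>simp_all add: power_mult_distrib N2 A_def A1_def\<close>)
  note \<epsilon>F = L2_cmult[OF F(1), of "of_real \<epsilon>"]
  define J where "J = (LINT x:?I|lborel. (of_real \<epsilon> * F x) * cnj (U x))"
  have J: "cmod J \<le> \<epsilon> * M * N * L2_norm ?I U"
  proof -
    have "cmod J \<le> L2_norm ?I (\<lambda>x. of_real \<epsilon> * F x) * L2_norm ?I (\<lambda>x. cnj (U x))"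
      unfolding J_def by (rule pairing_bound[OF \<epsilon>F(1) L2_cnj(1)[OF UL]])
    also have "\<dots> \<le> (\<epsilon> * (M * N)) * L2_norm ?I U"
      unfolding L2_cnj(2)[OF UL] using \<epsilon>F(2) FN \<epsilon>
      by (intro mult_right_mono order_trans[OF \<epsilon>F(2)]) (auto intro!: mult_left_mono)
    finally show ?thesis by (simp add: mult.assoc)
  qed
  have "\<epsilon> * M * N * L2_norm ?I U \<le> \<epsilon> * M * N * N" using UN \<epsilon> M nn by (intro mult_left_mono) auto
  then have J2: "cmod J \<le> \<epsilon> * M * N\<^sup>2" using J by (simp add: power2_eq_square)
  define B1 where "B1 = (LINT x:?I|lborel. P x * (cmod (U1 x))\<^sup>2)"
  define B2 where "B2 = (LINT x:?I|lborel. q x * (cmod (U x))\<^sup>2)"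
  have id: "of_real B1 + of_real B2 - \<mu> * of_real A = J"
    unfolding B1_def B2_def A_def J_def
    by (rule pairing_identity[OF lr U V cP U1c q \<epsilon>F(1) z(1,2)])
  have re: "B1 + B2 - Re \<mu> * A = Re J" using arg_cong[OF id, of Re] by simp
  have im: "- (Im \<mu> * A) = Im J" using arg_cong[OF id, of Im] by simp
  have B1: "c0 * A1 \<le> B1"
  proof -
    have i: "set_integrable lborel ?I (\<lambda>x. P x * (cmod (U1 x))\<^sup>2)"
      unfolding set_integrable_def by (intro borel_integrable_compact continuous_intros cP U1c) simp
    have "(LINT x:?I|lborel. c0 * (cmod (U1 x))\<^sup>2) \<le> B1"
      unfolding B1_def by (rule set_integral_mono[OF set_integrable_mult_right[OF L2_sq_integrable[OF U1L]] i])
        (use c0(2) in \<open>auto intro: mult_right_mono\<close>)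
    then show ?thesis by (simp add: A1_def L2_norm_sq)
  qed
  have B2: "\<bar>B2\<bar> \<le> q1 * A" unfolding B2_def A_def by (rule weighted_square_integral(2)[OF UL q])
  have "N = 0"
  proof (cases "Re \<mu> \<le> - (q1 + 1)")
    case True
    \<comment> \<open>Far below the spectrum the quadratic form is coercive.\<close>
    have "Re \<mu> * A \<le> - (q1 + 1) * A" using True nn by (intro mult_right_mono) auto
    then have "c0 * A1 + A \<le> Re J" using re B1 B2 by (simp add: algebra_simps abs_le_iff)
    also have "\<dots> \<le> \<epsilon> * M * (A + A1)" using complex_Re_le_cmod[of J] J2 by (simp add: N2)
    finally have le: "c0 * A1 + A \<le> \<epsilon> * M * (A + A1)" .
    have "min c0 1 * (A + A1) \<le> c0 * A1 + A"
      using mult_right_mono[of "min c0 1" 1 A] mult_right_mono[of "min c0 1" c0 A1] nn by (simp add: distrib_left)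
    then have "(min c0 1 - \<epsilon> * M) * (A + A1) \<le> 0" using le by (simp add: left_diff_distrib)
    then have "A + A1 \<le> 0" using small1 by (simp add: mult_le_0_iff)
    then show ?thesis using nn by (simp add: N_def)
  next
    case False
    \<comment> \<open>The shift by \<open>q1 + 2\<close> makes the parameter at least 1 and is compensated in \<open>X\<close> below.\<close>
    define \<Lambda> where "\<Lambda> = Re \<mu> + q1 + 2"
    have \<Lambda>: "1 \<le> \<Lambda>" using False by (simp add: \<Lambda>_def)
    \<comment> \<open>The imaginary part of the spectral parameter is itself of the order of the perturbation.\<close>
    have nu: "(Im \<mu>)\<^sup>2 * A \<le> (\<epsilon> * M)\<^sup>2 * N\<^sup>2"
    proof (cases "L2_norm ?I U = 0")
      case False
      then have p: "0 < L2_norm ?I U" using L2_norm_nonneg[of ?I U] by linarith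
      have "\<bar>Im \<mu>\<bar> * A \<le> \<epsilon> * M * N * L2_norm ?I U"
        using J abs_Im_le_cmod[of J] nn unfolding im[symmetric] by (simp add: abs_mult)
      then have "(\<bar>Im \<mu>\<bar> * L2_norm ?I U) * L2_norm ?I U \<le> (\<epsilon> * M * N) * L2_norm ?I U"
        by (simp add: A_def power2_eq_square)
      then have "\<bar>Im \<mu>\<bar> * L2_norm ?I U \<le> \<epsilon> * M * N" using p by (simp only: mult_le_cancel_right_pos)
      then have "(\<bar>Im \<mu>\<bar> * L2_norm ?I U)\<^sup>2 \<le> (\<epsilon> * M * N)\<^sup>2" by (intro power_mono) auto
      then show ?thesis by (simp add: A_def power_mult_distrib)
    qed (simp add: A_def)
    define X where "X = (\<lambda>x. of_real (q x + q1 + 2) * U x - (\<i> * of_real (Im \<mu>) * U x + of_real \<epsilon> * F x))"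
    have Veq: "(of_real (q x) - \<mu>) * U x - of_real \<epsilon> * F x = X x - of_real \<Lambda> * U x" for x
      by (subst complex_eq[of \<mu>]) (simp add: X_def \<Lambda>_def algebra_simps)
    define h where "h = (\<lambda>x. 2 * (Im \<mu>)\<^sup>2 * (cmod (U x))\<^sup>2 + 2 * \<epsilon>\<^sup>2 * (cmod (F x))\<^sup>2)"
    have ih: "set_integrable lborel ?I h"
      unfolding h_def by (intro set_integral_add(1) set_integrable_mult_right L2_sq_integrable UL F)
    have Hle: "(LINT t:?I|lborel. h t) \<le> 4 * (\<epsilon> * M)\<^sup>2 * N\<^sup>2"
    proof -
      have "(LINT t:?I|lborel. h t) = 2 * (Im \<mu>)\<^sup>2 * A + 2 * \<epsilon>\<^sup>2 * (L2_norm ?I F)\<^sup>2"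
        unfolding h_def using set_integral_add(2)[OF set_integrable_mult_right[of "2 * (Im \<mu>)\<^sup>2", OF L2_sq_integrable[OF UL]]
          set_integrable_mult_right[of "2 * \<epsilon>\<^sup>2", OF L2_sq_integrable[OF F(1)]]]
        by (simp only: set_integral_mult_right L2_norm_sq[symmetric] A_def)
      also have "2 * \<epsilon>\<^sup>2 * (L2_norm ?I F)\<^sup>2 \<le> 2 * \<epsilon>\<^sup>2 * (M\<^sup>2 * N\<^sup>2)"
        using F(2) by (intro mult_left_mono) (simp_all add: N2 A_def A1_def)
      also have "2 * (Im \<mu>)\<^sup>2 * A + 2 * \<epsilon>\<^sup>2 * (M\<^sup>2 * N\<^sup>2) \<le> 4 * (\<epsilon> * M)\<^sup>2 * N\<^sup>2"
        using nu by (simp add: power_mult_distrib mult_ac)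
      finally show ?thesis by simp
    qed
    have Xle: "2 * (cmod (X x) * cmod (of_real (P x) * U1 x)) \<le> (2 * q1 + 3) * ((cmod (U x))\<^sup>2 + (cmod (of_real (P x) * U1 x))\<^sup>2) + h x" for x
    proof -
      define v where "v = cmod (of_real (P x) * U1 x)"
      define u where "u = cmod (U x)"
      define w where "w = \<bar>Im \<mu>\<bar> * u + \<epsilon> * cmod (F x)"
      have v: "0 \<le> v" "0 \<le> u" "0 \<le> w" using \<epsilon> by (simp_all add: v_def u_def w_def)
      have "cmod (X x) \<le> cmod (of_real (q x + q1 + 2) * U x) + cmod (\<i> * of_real (Im \<mu>) * U x + of_real \<epsilon> * F x)"
        unfolding X_def by (rule norm_triangle_ineq4)
      also have "cmod (of_real (q x + q1 + 2) * U x) \<le> (2 * q1 + 2) * u"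
        unfolding norm_mult norm_of_real u_def using q(2)[of x] by (intro mult_right_mono) auto
      also have "cmod (\<i> * of_real (Im \<mu>) * U x + of_real \<epsilon> * F x) \<le> w"
        using norm_triangle_ineq[of "\<i> * of_real (Im \<mu>) * U x" "of_real \<epsilon> * F x"] \<epsilon> by (simp add: norm_mult w_def u_def)
      finally have "cmod (X x) \<le> (2 * q1 + 2) * u + w" by simp
      then have "2 * (cmod (X x) * v) \<le> 2 * (((2 * q1 + 2) * u + w) * v)" using v by (intro mult_left_mono mult_right_mono) auto
      also have "\<dots> = (2 * q1 + 2) * (2 * u * v) + 2 * w * v" by (simp add: algebra_simps)
      also have "\<dots> \<le> (2 * q1 + 2) * (u\<^sup>2 + v\<^sup>2) + (w\<^sup>2 + v\<^sup>2)"
        using q1 by (intro add_mono mult_left_mono sum_squares_bound) auto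
      also have "w\<^sup>2 \<le> h x"
        using sum_sq_le2[of "\<bar>Im \<mu>\<bar> * u" "\<epsilon> * cmod (F x)"] by (simp add: w_def h_def u_def power_mult_distrib)
      finally have "2 * (cmod (X x) * v) \<le> (2 * q1 + 2) * (u\<^sup>2 + v\<^sup>2) + (h x + v\<^sup>2)" by simp
      also have "\<dots> \<le> (2 * q1 + 3) * (u\<^sup>2 + v\<^sup>2) + h x" by (simp add: algebra_simps)
      finally show ?thesis by (simp add: u_def v_def)
    qed
    define G where "G = 4 * (\<epsilon> * M)\<^sup>2 * N\<^sup>2 * exp (((2 * q1 + 3) * (1 / c0 + 1) + c2 / c0) * (r - l))"
    have est: "c0 * (cmod (U y))\<^sup>2 \<le> G" "c0\<^sup>2 * (cmod (U1 y))\<^sup>2 \<le> G" if y: "y \<in> ?I" for y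
    proof -
      have b: "0 \<le> 2 * q1 + 3" using q1 by simp
      have h0: "0 \<le> h x" for x by (simp add: h_def)
      note eg = energy_gronwall[where P = P and h = h and X = X, OF lr U V[unfolded Veq] P c0 c2 U1c \<Lambda> b ih h0 Xle z(1) z(3) y]
      have "(LINT t:?I|lborel. h t) * exp (((2 * q1 + 3) * (1 / c0 + 1) + c2 / c0) * (r - l)) \<le> G"
        unfolding G_def by (intro mult_right_mono Hle) simp
      then show "c0 * (cmod (U y))\<^sup>2 \<le> G" "c0\<^sup>2 * (cmod (U1 y))\<^sup>2 \<le> G" using eg by simp_all
    qed
    have "A \<le> (r - l) * (G / c0)" unfolding A_def
      by (rule L2_norm_sq_le_sup[OF cU]) (use lr est(1) c0(1) in \<open>simp_all add: pos_le_divide_eq mult.commute\<close>)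
    moreover have "A1 \<le> (r - l) * (G / c0\<^sup>2)" unfolding A1_def
      by (rule L2_norm_sq_le_sup[OF U1c]) (use lr est(2) c0(1) in \<open>simp_all add: pos_le_divide_eq mult.commute\<close>)
    ultimately have "N\<^sup>2 \<le> (4 * (\<epsilon> * M)\<^sup>2 * exp (((2 * q1 + 3) * (1 / c0 + 1) + c2 / c0) * (r - l)) * ((r - l) * (1 / c0 + 1 / c0\<^sup>2))) * N\<^sup>2"
      by (simp add: N2 G_def algebra_simps)
    moreover have "(4 * (\<epsilon> * M)\<^sup>2 * exp (((2 * q1 + 3) * (1 / c0 + 1) + c2 / c0) * (r - l)) * ((r - l) * (1 / c0 + 1 / c0\<^sup>2))) * N\<^sup>2 < 1 * N\<^sup>2"
      if "N \<noteq> 0" using small2 that by (intro mult_strict_right_mono) auto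
    ultimately show ?thesis by (cases "N = 0") auto
  qed
  then have "L2_norm ?I U = 0" using UN L2_norm_nonneg[of ?I U] by linarith
  then show ?thesis by (rule L2_norm_zero_imp_zero[OF cU _ z(1,2) x])
qed

section \<open>Eigenfunctions of the perturbed operator\<close>

lemma L2_norm_Ioo_Icc:
  assumes "h \<in> L2 UNIV" shows "L2_norm {a<..<b} h = L2_norm {a..b} h"
proof -
  have [measurable]: "h \<in> borel_measurable borel" using borel_measurable_L2_UNIV[OF assms] by simp
  have "(LINT x:{a<..<b}|lborel. (cmod (h x))\<^sup>2) = (LINT x:{a..b}|lborel. (cmod (h x))\<^sup>2)"
    unfolding set_lebesgue_integral_def
  proof (rule integral_cong_AE)
    show "AE x in lborel. indicator {a<..<b} x *\<^sub>R (cmod (h x))\<^sup>2 = indicator {a..b} x *\<^sub>R (cmod (h x))\<^sup>2"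
      using AE_lborel_singleton[of a] AE_lborel_singleton[of b] by eventually_elim (auto simp: indicator_def)
  qed measurable
  then show ?thesis by (simp add: L2_norm_def)
qed

lemma L2_norm_le_sum3:
  assumes w: "w \<in> L2 S" and L: "f \<in> L2 S" "g \<in> L2 S" "h \<in> L2 S" and nn: "0 \<le> a" "0 \<le> b" "0 \<le> c"
    and le: "AE x in lborel. x \<in> S \<longrightarrow> cmod (w x) \<le> a * cmod (f x) + b * cmod (g x) + c * cmod (h x)"
  shows "L2_norm S w \<le> a * L2_norm S f + b * L2_norm S g + c * L2_norm S h"
proof -
  have n: "(\<lambda>x. of_real (cmod (u x))) \<in> L2 S" "L2_norm S (\<lambda>x. of_real (cmod (u x))) = L2_norm S u" if "u \<in> L2 S" for u
  proof -
    have eq: "(\<lambda>x. indicator S x *\<^sub>R complex_of_real (cmod (u x))) = (\<lambda>x. of_real (cmod (indicator S x *\<^sub>R u x)))"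
      by (auto simp: indicator_def)
    have "(\<lambda>x. indicator S x *\<^sub>R complex_of_real (cmod (u x))) \<in> borel_measurable lborel"
      unfolding eq using L2_measurable[OF that] by measurable
    then show "(\<lambda>x. of_real (cmod (u x))) \<in> L2 S" using L2_sq_integrable[OF that] by (intro L2I) simp_all
    show "L2_norm S (\<lambda>x. of_real (cmod (u x))) = L2_norm S u" by (simp add: L2_norm_def)
  qed
  note cf = L2_cmult[OF n(1)[OF L(1)], of "of_real a"] and cg = L2_cmult[OF n(1)[OF L(2)], of "of_real b"]
    and ch = L2_cmult[OF n(1)[OF L(3)], of "of_real c"]
  note s1 = L2_add[OF cf(1) cg(1)]
  note s2 = L2_add[OF s1(1) ch(1)]
  have e: "AE x in lborel. x \<in> S \<longrightarrow> cmod (w x) \<le> 1 * cmod (of_real a * of_real (cmod (f x)) + of_real b * of_real (cmod (g x)) + of_real c * of_real (cmod (h x)))"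
    using le
  proof eventually_elim
    case (elim x)
    have "of_real a * of_real (cmod (f x)) + of_real b * of_real (cmod (g x)) + of_real c * of_real (cmod (h x)) =
       complex_of_real (a * cmod (f x) + b * cmod (g x) + c * cmod (h x))" by simp
    moreover have "0 \<le> a * cmod (f x) + b * cmod (g x) + c * cmod (h x)" using nn by simp
    ultimately show ?case using elim by (simp only: norm_of_real abs_of_nonneg mult_1)
  qed
  have "L2_norm S w \<le> 1 * L2_norm S (\<lambda>x. of_real a * of_real (cmod (f x)) + of_real b * of_real (cmod (g x)) + of_real c * of_real (cmod (h x)))"
    by (rule L2_bounded_by(2)[OF L2_measurable[OF w] s2(1) e]) simp
  also have "\<dots> \<le> a * L2_norm S f + b * L2_norm S g + c * L2_norm S h"
    using s2(2) s1(2) cf(2) cg(2) ch(2) nn by (simp add: n(2)[OF L(1)] n(2)[OF L(2)] n(2)[OF L(3)])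
  finally show ?thesis .
qed

context regular_sturm_liouville
begin

lemma sol_null_source:
  assumes s: "sol \<mu> S U V f" and f: "AE x in lborel. f x = 0" and S: "is_interval S" "S \<in> sets borel" and U: "U \<in> L2 UNIV"
  shows "sol \<mu> S U V (\<lambda>_. 0)"
proof -
  have "antideriv S V (\<lambda>x. (of_real (q x) - \<mu>) * U x - 0)"
  proof (rule antideriv_cong_AE[OF _ S(1) _ S(2)])
    show "antideriv S V (\<lambda>x. (of_real (q x) - \<mu>) * U x - f x)" using s by (simp add: sol_def)
    have "(\<lambda>x. (of_real (q x) - \<mu>) * U x - 0) \<in> borel_measurable lborel"
      using q_meas borel_measurable_L2_UNIV[OF U] by simp
    then show "set_borel_measurable lborel S (\<lambda>x. (of_real (q x) - \<mu>) * U x - 0)"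
      unfolding set_borel_measurable_def by (intro borel_measurable_scaleR) (use S(2) in simp_all)
    show "AE x in lborel. x \<in> S \<longrightarrow> (of_real (q x) - \<mu>) * U x - f x = (of_real (q x) - \<mu>) * U x - 0"
      using f by eventually_elim simp
  qed
  then show ?thesis using s by (simp add: sol_def)
qed

text \<open>
  If the Cauchy data at an end of \<open>Q\<close> were not zero, the eigenfunction would be a decaying solution on
  a half-line and yield a multiplier off the unit circle, which excludes \<open>\<mu>\<close> from the continuous spectrum.
\<close>

lemma eigenfunction_zero_outside:
  assumes Q: "Q = {l<..<r}" and \<epsilon>: "0 \<le> \<epsilon>" and M: "0 \<le> M" "\<epsilon> * M \<le> p0 / 2"
    and T: "\<And>u. u \<in> W2 2 Q \<Longrightarrow> T u \<in> L2 Q" "\<And>u. u \<in> W2 2 Q \<Longrightarrow> L2_norm Q (T u) \<le> M * W2_norm 2 Q u"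
    and \<mu>: "\<mu> \<in> cont_spectrum (W2 2 UNIV) (H_pert p q Q \<epsilon> T)"
    and R: "represents u U U1 u2" and f: "AE x in lborel. residual Q \<epsilon> T \<mu> u x = 0"
    and x: "x \<notin> Q"
  shows "U x = 0" "U1 x = 0"
proof -
  have Qi: "is_interval Q" "open Q" "Q \<in> sets borel" by (simp_all add: Q is_interval_oo)
  have L: "U \<in> L2 UNIV" "U1 \<in> L2 UNIV" using R by (simp_all add: represents_def)
  note VL = flux_L2(1)[OF L(2)]
  have Tu: "T (zero_ext Q u) \<in> L2 Q" by (rule T(1)[OF represents_restrict(1)[OF R Qi(1,2)]])
  have half: "U x = 0 \<and> flux U1 x = 0"
    if \<tau>: "\<tau> = 1 \<or> \<tau> = (- 1 :: int)" and S: "{x. 0 \<le> of_int \<tau> * (x - e)} \<inter> Q = {}" and xS: "0 \<le> of_int \<tau> * (x - e)" for \<tau> e x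
  proof -
    define S where "S = {x. 0 \<le> of_int \<tau> * (x - e)}"
    have S_cases: "S = {e..} \<or> S = {..e}" using \<tau> by (auto simp: S_def)
    then have Si: "is_interval S" "S \<in> sets borel" by (auto simp: is_interval_ci is_interval_ic)
    have s: "sol \<mu> S U (flux U1) (\<lambda>_. 0)"
      by (rule sol_null_source[OF residual_sol[where T = T, OF R Qi(3) Tu Si] f Si L(1)]) (use S in \<open>simp add: S_def\<close>)
    have e0: "U e = 0 \<and> flux U1 e = 0"
    proof (rule ccontr)
      assume "\<not> (U e = 0 \<and> flux U1 e = 0)"
      then have nz: "U e \<noteq> 0 \<or> flux U1 e \<noteq> 0" by blast
      obtain x0 \<rho> where m: "multiplier \<mu> x0 U (flux U1) \<rho>" "\<rho> \<noteq> 0" "cmod \<rho> \<noteq> 1"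
        by (rule half_line_multiplier[OF \<tau> s[unfolded S_def] L(1) VL nz])
      show False using cont_spectrum_imp_no_hyperbolic_multiplier[OF Q \<epsilon> M T \<mu> m(1,2)] m(3) by simp
    qed
    have "{min e x..max e x} \<subseteq> S" using xS \<tau> by (auto simp: S_def)
    note s' = sol_subset[OF s this]
    show ?thesis
      using sol_unique[OF s', of e x] e0 by simp
  qed
  have "U x = 0 \<and> flux U1 x = 0"
  proof (cases "r \<le> x")
    case True
    then show ?thesis by (intro half[of 1 r]) (auto simp: Q)
  next
    case False
    then have "x \<le> l" using x by (auto simp: Q)
    then show ?thesis by (intro half[of "- 1" l]) (auto simp: Q)
  qed
  then show "U x = 0" "U1 x = 0" using p_pos[of x] by (auto simp: flux_def)
qed

text \<open>
  On every initial segment of \<open>Q\<close> the second derivative in \<open>\<epsilon> T u\<close> is absorbed by \<open>p u''\<close>, so that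
  the second derivative is controlled by the lower ones on the same segment.
\<close>

lemma eigenfunction_zero_of_local_bound:
  assumes lr: "l < r" and Q: "Q = {l<..<r}" and \<epsilon>: "0 \<le> \<epsilon>" and C: "0 \<le> C" "\<epsilon> * C \<le> p0 / 2"
    and R: "represents u U U1 u2" and f: "AE x in lborel. residual Q \<epsilon> T \<mu> u x = 0"
    and Tu: "T (zero_ext Q u) \<in> L2 Q"
    and loc: "\<And>c d. c < d \<Longrightarrow> {c<..<d} \<subseteq> Q \<Longrightarrow> L2_norm {c<..<d} (T (zero_ext Q u)) \<le> C * W2_norm 2 {c<..<d} (zero_ext Q u)"
    and z: "U l = 0" "U1 l = 0" and x: "x \<in> {l..r}"
  shows "U x = 0"
proof -
  have Qi: "is_interval Q" "open Q" "Q \<in> sets borel" by (simp_all add: Q is_interval_oo)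
  have A: "antideriv UNIV U U1" "antideriv UNIV U1 u2" and L: "u \<in> L2 UNIV" "U \<in> L2 UNIV" "U1 \<in> L2 UNIV" "u2 \<in> L2 UNIV"
    and uU: "AE x in lborel. u x = U x"
    using R by (simp_all add: represents_def)
  have p1: "0 \<le> p1" using order_trans[OF abs_ge_zero p'_bound[of 0]] .
  define g where "g = T (zero_ext Q u)"
  define k where "k = q1 + cmod \<mu> + p1 + p0 / 2"
  have k: "0 \<le> k" using q1_nonneg p1 p0 by (simp add: k_def)
  define K where "K = 2 * (2 * k / p0)\<^sup>2"
  show ?thesis
  proof (rule local_control_imp_zero[OF lr antideriv_subset[OF A(1) subset_UNIV] antideriv_subset[OF A(2) subset_UNIV] _ z _ _ x])
    show "u2 \<in> L2 {l..r}" by (rule L2_subset(1)[OF L(4)]) auto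
    show "0 \<le> K" by (simp add: K_def)
    fix d assume d: "l < d" "d \<le> r"
    define S where "S = {l<..<d}"
    have S: "is_interval S" "open S" "S \<in> sets borel" "S \<subseteq> Q" using d by (auto simp: S_def Q is_interval_oo)
    have LS: "h \<in> L2 UNIV \<Longrightarrow> h \<in> L2 S" for h by (rule L2_subset(1)[OF _ subset_UNIV S(3)])
    have gS: "g \<in> L2 S" unfolding g_def by (rule L2_subset(1)[OF Tu S(4,3)])
    have eq: "(\<lambda>x. indicator S x *\<^sub>R zero_ext Q u x) = (\<lambda>x. indicator S x *\<^sub>R u x)"
      using S(4) by (auto simp: zero_ext_def indicator_def fun_eq_iff)
    have mS: "(\<lambda>x. indicator S x *\<^sub>R zero_ext Q u x) \<in> borel_measurable lborel"
      unfolding eq by (rule L2_measurable[OF LS[OF L(1)]])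
    have eS: "AE x in lborel. x \<in> S \<longrightarrow> zero_ext Q u x = U x"
      using uU by eventually_elim (use S(4) in \<open>auto simp: zero_ext_def\<close>)
    have "W2_norm 2 S (zero_ext Q u) = sqrt ((L2_norm S U)\<^sup>2 + (L2_norm S U1)\<^sup>2 + (L2_norm S u2)\<^sup>2)"
      by (rule W2_norm_2_eq[OF S(1,2) antideriv_subset[OF A(1) subset_UNIV] antideriv_subset[OF A(2) subset_UNIV] mS eS])
    also have "\<dots> \<le> L2_norm S U + L2_norm S U1 + L2_norm S u2"
      by (rule real_le_lsqrt) (auto simp: power2_sum algebra_simps mult_nonneg_nonneg intro!: add_nonneg_nonneg)
    finally have W: "W2_norm 2 S (zero_ext Q u) \<le> L2_norm S U + L2_norm S U1 + L2_norm S u2" .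
    have "L2_norm S g \<le> C * W2_norm 2 S (zero_ext Q u)"
      unfolding g_def S_def by (rule loc) (use d in \<open>auto simp: Q\<close>)
    also have "\<dots> \<le> C * (L2_norm S U + L2_norm S U1 + L2_norm S u2)" by (rule mult_left_mono[OF W C(1)])
    finally have g: "L2_norm S g \<le> C * (L2_norm S U + L2_norm S U1 + L2_norm S u2)" .
    have pw: "AE x in lborel. x \<in> S \<longrightarrow> cmod (u2 x) \<le> ((q1 + cmod \<mu>) / p0) * cmod (U x) + (p1 / p0) * cmod (U1 x) + (\<epsilon> / p0) * cmod (g x)"
      using residual_AE[OF R, of Q \<epsilon> T \<mu>] f
    proof eventually_elim
      case (elim x)
      show ?case
      proof
        assume xS: "x \<in> S"
        have "of_real (p x) * u2 x = (of_real (q x) - \<mu>) * U x - of_real (p' x) * U1 x - of_real \<epsilon> * g x"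
          using elim xS S(4) by (auto simp: zero_ext_def g_def flux_deriv_def algebra_simps)
        then have "cmod (of_real (p x) * u2 x) \<le> cmod ((of_real (q x) - \<mu>) * U x) + cmod (of_real (p' x) * U1 x) + cmod (of_real \<epsilon> * g x)"
          using norm_triangle_ineq4[of "(of_real (q x) - \<mu>) * U x" "of_real (p' x) * U1 x"]
            norm_triangle_ineq4[of "(of_real (q x) - \<mu>) * U x - of_real (p' x) * U1 x" "of_real \<epsilon> * g x"] by simp
        also have "\<dots> \<le> (q1 + cmod \<mu>) * cmod (U x) + p1 * cmod (U1 x) + \<epsilon> * cmod (g x)"
        proof (intro add_mono)
          have "cmod (of_real (q x) - \<mu>) \<le> q1 + cmod \<mu>"
            using norm_triangle_ineq4[of "of_real (q x)" \<mu>] q_bound[of x] by simp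
          then show "cmod ((of_real (q x) - \<mu>) * U x) \<le> (q1 + cmod \<mu>) * cmod (U x)" by (simp add: norm_mult mult_right_mono)
          show "cmod (of_real (p' x) * U1 x) \<le> p1 * cmod (U1 x)" using p'_bound[of x] by (simp add: norm_mult mult_right_mono)
          show "cmod (of_real \<epsilon> * g x) \<le> \<epsilon> * cmod (g x)" using \<epsilon> by (simp add: norm_mult)
        qed
        finally have "p x * cmod (u2 x) \<le> (q1 + cmod \<mu>) * cmod (U x) + p1 * cmod (U1 x) + \<epsilon> * cmod (g x)"
          using p_pos[of x] by (simp add: norm_mult)
        moreover have "p0 * cmod (u2 x) \<le> p x * cmod (u2 x)" by (intro mult_right_mono p_lower) simp
        ultimately have "cmod (u2 x) \<le> ((q1 + cmod \<mu>) * cmod (U x) + p1 * cmod (U1 x) + \<epsilon> * cmod (g x)) / p0"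
          using p0 by (simp add: pos_le_divide_eq mult.commute)
        then show "cmod (u2 x) \<le> ((q1 + cmod \<mu>) / p0) * cmod (U x) + (p1 / p0) * cmod (U1 x) + (\<epsilon> / p0) * cmod (g x)"
          by (simp add: add_divide_distrib distrib_right)
      qed
    qed
    have "L2_norm S u2 \<le> ((q1 + cmod \<mu>) / p0) * L2_norm S U + (p1 / p0) * L2_norm S U1 + (\<epsilon> / p0) * L2_norm S g"
      using q1_nonneg p1 p0 \<epsilon> by (intro L2_norm_le_sum3[OF LS[OF L(4)] LS[OF L(2)] LS[OF L(3)] gS _ _ _ pw]) auto
    then have "p0 * L2_norm S u2 \<le> (q1 + cmod \<mu>) * L2_norm S U + p1 * L2_norm S U1 + \<epsilon> * L2_norm S g"
      using p0 by (simp add: field_simps)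
    also have "\<epsilon> * L2_norm S g \<le> (p0 / 2) * (L2_norm S U + L2_norm S U1 + L2_norm S u2)"
    proof -
      have "\<epsilon> * L2_norm S g \<le> \<epsilon> * (C * (L2_norm S U + L2_norm S U1 + L2_norm S u2))" by (rule mult_left_mono[OF g \<epsilon>])
      also have "\<dots> = (\<epsilon> * C) * (L2_norm S U + L2_norm S U1 + L2_norm S u2)" by simp
      also have "\<dots> \<le> (p0 / 2) * (L2_norm S U + L2_norm S U1 + L2_norm S u2)" by (rule mult_right_mono[OF C(2)]) simp
      finally show ?thesis .
    qed
    finally have "(p0 / 2) * L2_norm S u2 \<le> (q1 + cmod \<mu> + p0 / 2) * L2_norm S U + (p1 + p0 / 2) * L2_norm S U1"
      by (simp add: algebra_simps)
    also have "\<dots> \<le> k * L2_norm S U + k * L2_norm S U1"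
      using q1_nonneg p1 by (intro add_mono mult_right_mono) (simp_all add: k_def)
    finally have "L2_norm S u2 \<le> (2 * k / p0) * (L2_norm S U + L2_norm S U1)"
      using p0 by (simp add: field_simps)
    then have "(L2_norm S u2)\<^sup>2 \<le> ((2 * k / p0) * (L2_norm S U + L2_norm S U1))\<^sup>2" by (intro power_mono) simp_all
    also have "\<dots> \<le> (2 * k / p0)\<^sup>2 * (2 * ((L2_norm S U)\<^sup>2 + (L2_norm S U1)\<^sup>2))"
      unfolding power_mult_distrib[of "2 * k / p0"] by (intro mult_left_mono sum_sq_le2) simp
    finally show "(L2_norm {l..d} u2)\<^sup>2 \<le> K * ((L2_norm {l..d} U)\<^sup>2 + (L2_norm {l..d} U1)\<^sup>2)"
      unfolding K_def S_def L2_norm_Ioo_Icc[OF L(2)] L2_norm_Ioo_Icc[OF L(3)] L2_norm_Ioo_Icc[OF L(4)] by (simp only: mult_ac)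
  qed
qed

text \<open>
  The second-order part of the perturbation joins the leading coefficient, which becomes \<open>p + \<epsilon> a\<close>.
  This stays above \<open>p0 / 2\<close> with a derivative bounded by \<open>p1 + 1\<close>, and only a first-order
  perturbation is left.
\<close>

lemma eigenfunction_zero_of_divergence_form:
  assumes lr: "l < r" and Q: "Q = {l<..<r}" and \<epsilon>: "0 \<le> \<epsilon>" and M: "0 \<le> M"
    and a: "piecewise_cont_diff a" "\<And>x. x \<notin> {l..r} \<Longrightarrow> a x = 0"
    and a_small: "\<epsilon> * max_abs_deriv {l..r} a \<le> 1" "\<epsilon> * max_abs_deriv {l..r} a * (r - l) \<le> p0 / 2"
    and R: "represents u U U1 u2" and f: "AE x in lborel. residual Q \<epsilon> T \<mu> u x = 0"
    and Tu: "T (zero_ext Q u) \<in> L2 Q"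
    and T: "AE x in lborel. x \<in> Q \<longrightarrow> T (zero_ext Q u) x = div_op Q a (zero_ext Q u) x + Tt (zero_ext Q u) x"
    and Tt: "\<And>w. w \<in> W2 1 Q \<Longrightarrow> Tt w \<in> L2 Q" "\<And>w. w \<in> W2 1 Q \<Longrightarrow> L2_norm Q (Tt w) \<le> M * W2_norm 1 Q w"
    and small1: "\<epsilon> * M < min (p0 / 2) 1"
    and small2: "4 * (\<epsilon> * M)\<^sup>2 * exp (((2 * q1 + 3) * (1 / (p0 / 2) + 1) + (p1 + 1) / (p0 / 2)) * (r - l)) *
       ((r - l) * (1 / (p0 / 2) + 1 / (p0 / 2)\<^sup>2)) < 1"
    and z: "U l = 0" "U r = 0" "U1 l = 0" and x: "x \<in> {l..r}"
  shows "U x = 0"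
proof -
  have Qi: "is_interval Q" "open Q" "Q \<in> sets borel" by (simp_all add: Q is_interval_oo)
  have A: "antideriv UNIV U U1" "antideriv UNIV U1 u2" and L: "u \<in> L2 UNIV" "U \<in> L2 UNIV" "U1 \<in> L2 UNIV" "u2 \<in> L2 UNIV"
    and uU: "AE x in lborel. u x = U x"
    using R by (simp_all add: represents_def)
  have p1: "0 \<le> p1" using order_trans[OF abs_ge_zero p'_bound[of 0]] .
  define w where "w = zero_ext Q u"
  obtain a' where a'm: "a' \<in> borel_measurable borel"
    and a'p: "antideriv UNIV (\<lambda>x. of_real (a x)) (\<lambda>x. of_real (a' x))"
    and a'b: "AE x in lborel. x \<in> {l..r} \<longrightarrow> \<bar>a' x\<bar> \<le> max_abs_deriv {l..r} a"
    and ab: "\<forall>x\<in>{l..r}. \<bar>a x\<bar> \<le> (r - l) * max_abs_deriv {l..r} a"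
    by (rule max_abs_deriv_bound[OF a lr])
  define P where "P = (\<lambda>x. p x + \<epsilon> * a x)"
  define P' where "P' = (\<lambda>x. p' x + \<epsilon> * a' x)"
  have am: "a \<in> borel_measurable borel"
    using a(1) by (intro borel_measurable_continuous_onI) (simp add: piecewise_cont_diff_def)
  have LQ: "h \<in> L2 UNIV \<Longrightarrow> h \<in> L2 Q" for h by (rule L2_subset(1)[OF _ subset_UNIV Qi(3)])
  have eq: "(\<lambda>x. indicator Q x *\<^sub>R w x) = (\<lambda>x. indicator Q x *\<^sub>R u x)"
    by (auto simp: w_def zero_ext_def indicator_def)
  have mw: "(\<lambda>x. indicator Q x *\<^sub>R w x) \<in> borel_measurable lborel"
    unfolding eq by (rule L2_measurable[OF LQ[OF L(1)]])
  have ew: "AE x in lborel. x \<in> Q \<longrightarrow> w x = U x" using uU by eventually_elim (simp add: w_def zero_ext_def)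
  note AQ = antideriv_subset[OF A(1) subset_UNIV, of Q] antideriv_subset[OF A(2) subset_UNIV, of Q]
  have w1: "w \<in> W2 1 Q" by (rule W2_Suc_0_I[OF Qi(1,2) AQ(1) LQ[OF L(2)] LQ[OF L(3)] mw ew])
  have w_norm: "W2_norm 1 Q w = sqrt ((L2_norm {l..r} U)\<^sup>2 + (L2_norm {l..r} U1)\<^sup>2)"
    using W2_norm_1_eq[OF Qi(1,2) AQ(1) mw ew] by (simp add: Q L2_norm_Ioo_Icc[OF L(2)] L2_norm_Ioo_Icc[OF L(3)])
  note wd = wderiv_of_primitive[OF Qi(1,2) AQ(1) mw ew]
  have ma: "(\<lambda>x. indicator Q x *\<^sub>R (of_real (a x) * wderiv Q w x)) \<in> borel_measurable lborel"
  proof -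
    have e: "(\<lambda>x. indicator Q x *\<^sub>R (of_real (a x) * wderiv Q w x)) = (\<lambda>x. of_real (a x) * (indicator Q x *\<^sub>R wderiv Q w x))" by auto
    show ?thesis unfolding e by (rule borel_measurable_times[OF _ wd(3)]) (use am in simp)
  qed
  have ea: "AE x in lborel. x \<in> Q \<longrightarrow> of_real (a x) * wderiv Q w x = of_real (a x) * U1 x"
    using wd(2) by eventually_elim auto
  have aU1: "antideriv UNIV (\<lambda>x. of_real (a x) * U1 x) (\<lambda>x. of_real (a' x) * U1 x + of_real (a x) * u2 x)"
    by (rule antideriv_mult[OF a'p A(2)]) simp
  have div: "AE x in lborel. x \<in> Q \<longrightarrow> div_op Q a w x = of_real (a' x) * U1 x + of_real (a x) * u2 x"
    unfolding div_op_def by (rule wderiv_of_primitive(2)[OF Qi(1,2) antideriv_subset[OF aU1 subset_UNIV] ma ea])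
  define F where "F = zero_ext Q (Tt w)"
  note F = zero_ext_L2[OF Tt(1)[OF w1] Qi(3), folded F_def]
  have PV: "antideriv {l..r} (\<lambda>x. of_real (P x) * U1 x) (\<lambda>x. (of_real (q x) - \<mu>) * U x - of_real \<epsilon> * F x)"
  proof (rule antideriv_cong_AE)
    have "antideriv UNIV (\<lambda>x. flux U1 x + of_real \<epsilon> * (of_real (a x) * U1 x))
      (\<lambda>x. flux_deriv U1 u2 x + of_real \<epsilon> * (of_real (a' x) * U1 x + of_real (a x) * u2 x))"
      by (intro antideriv_add antideriv_cmult flux_primitive aU1 A)
    moreover have "(\<lambda>x. flux U1 x + of_real \<epsilon> * (of_real (a x) * U1 x)) = (\<lambda>x. of_real (P x) * U1 x)"
      by (auto simp: flux_def P_def algebra_simps)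
    ultimately show "antideriv {l..r} (\<lambda>x. of_real (P x) * U1 x)
      (\<lambda>x. flux_deriv U1 u2 x + of_real \<epsilon> * (of_real (a' x) * U1 x + of_real (a x) * u2 x))"
      using antideriv_subset[OF _ subset_UNIV] by simp
    have "(\<lambda>x. (of_real (q x) - \<mu>) * U x - of_real \<epsilon> * F x) \<in> borel_measurable lborel"
      using q_meas borel_measurable_L2_UNIV[OF L(2)] borel_measurable_L2_UNIV[OF F(1)] by simp
    then show "set_borel_measurable lborel {l..r} (\<lambda>x. (of_real (q x) - \<mu>) * U x - of_real \<epsilon> * F x)"
      unfolding set_borel_measurable_def by (intro borel_measurable_scaleR) simp_all
    show "AE x in lborel. x \<in> {l..r} \<longrightarrow> flux_deriv U1 u2 x + of_real \<epsilon> * (of_real (a' x) * U1 x + of_real (a x) * u2 x) =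
        (of_real (q x) - \<mu>) * U x - of_real \<epsilon> * F x"
      using residual_AE[OF R, of Q \<epsilon> T \<mu>] f T div AE_lborel_singleton[of l] AE_lborel_singleton[of r]
    proof eventually_elim
      case (elim x)
      show ?case
      proof
        assume "x \<in> {l..r}"
        then have xQ: "x \<in> Q" using elim(5,6) by (simp add: Q)
        have "T (zero_ext Q u) x = (of_real (a' x) * U1 x + of_real (a x) * u2 x) + F x"
          using elim(3,4) xQ by (simp add: w_def F_def zero_ext_def)
        moreover have "flux_deriv U1 u2 x = (of_real (q x) - \<mu>) * U x - of_real \<epsilon> * T (zero_ext Q u) x"
        proof -
          have "zero_ext Q h x = h x" for h using xQ by (simp add: zero_ext_def)
          then show ?thesis using elim(1,2) by (simp add: algebra_simps)
        qed
        ultimately show "flux_deriv U1 u2 x + of_real \<epsilon> * (of_real (a' x) * U1 x + of_real (a x) * u2 x) =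
            (of_real (q x) - \<mu>) * U x - of_real \<epsilon> * F x" by (simp add: algebra_simps)
      qed
    qed
  qed (simp_all add: is_interval_cc)
  have PP: "antideriv {l..r} (\<lambda>x. of_real (P x)) (\<lambda>x. of_real (P' x))"
  proof -
    have "antideriv UNIV (\<lambda>x. of_real (p x) + of_real \<epsilon> * of_real (a x)) (\<lambda>x. of_real (p' x) + of_real \<epsilon> * of_real (a' x))"
      by (intro antideriv_add antideriv_cmult p_primitive a'p)
    then show ?thesis using antideriv_subset[OF _ subset_UNIV] by (simp add: P_def P'_def)
  qed
  have c0: "p0 / 2 \<le> P y" if y: "y \<in> {l..r}" for y
  proof -
    have "\<bar>\<epsilon> * a y\<bar> = \<epsilon> * \<bar>a y\<bar>" using \<epsilon> by (simp add: abs_mult)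
    also have "\<dots> \<le> \<epsilon> * ((r - l) * max_abs_deriv {l..r} a)" using ab y \<epsilon> by (intro mult_left_mono) auto
    also have "\<dots> \<le> p0 / 2" using a_small(2) by (simp add: mult_ac)
    finally show ?thesis using p_lower[of y] by (simp add: P_def abs_le_iff)
  qed
  have c2: "AE y in lborel. y \<in> {l..r} \<longrightarrow> \<bar>P' y\<bar> \<le> p1 + 1"
    using a'b
  proof eventually_elim
    case (elim y)
    show ?case
    proof
      assume "y \<in> {l..r}"
      then have "\<epsilon> * \<bar>a' y\<bar> \<le> 1" using elim a_small(1) mult_left_mono[OF _ \<epsilon>, of "\<bar>a' y\<bar>"] by force
      then have "\<bar>\<epsilon> * a' y\<bar> \<le> 1" using \<epsilon> by (simp add: abs_mult)
      then show "\<bar>P' y\<bar> \<le> p1 + 1" using p'_bound[of y] by (simp add: P'_def abs_le_iff)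
    qed
  qed
  have FI: "F \<in> L2 {l..r}" by (rule L2_subset(1)[OF F(1)]) auto
  have "L2_norm {l..r} F \<le> L2_norm UNIV F" by (rule L2_subset(2)[OF F(1)]) auto
  also have "\<dots> \<le> M * W2_norm 1 Q w" unfolding F(2) by (rule Tt(2)[OF w1])
  finally have "(L2_norm {l..r} F)\<^sup>2 \<le> (M * W2_norm 1 Q w)\<^sup>2" by (rule power_mono) simp
  then have Fle: "(L2_norm {l..r} F)\<^sup>2 \<le> M\<^sup>2 * ((L2_norm {l..r} U)\<^sup>2 + (L2_norm {l..r} U1)\<^sup>2)"
    unfolding w_norm by (simp add: power_mult_distrib)
  show ?thesis
  proof (rule first_order_perturbation_imp_zero[OF lr _ PV PP _ c0 _ c2 _ q_meas q_bound FI Fle M \<epsilon> z small1 small2 x])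
    show "antideriv {l..r} U U1" by (rule antideriv_subset[OF A(1) subset_UNIV])
    show "continuous_on {l..r} U1" by (rule antideriv_continuous_on_Icc[OF antideriv_subset[OF A(2) subset_UNIV]])
  qed (use p0 p1 in simp_all)
qed

end

section \<open>Absence of embedded eigenvalues\<close>

theorem theorem2p5:
  fixes p q :: "real \<Rightarrow> real"
    and p0 l r \<epsilon>0 :: real
    and Q :: "real set"
    and L :: "real \<Rightarrow> (real \<Rightarrow> complex) \<Rightarrow> (real \<Rightarrow> complex)"
  assumes "\<forall>x. p (x + 1) = p x" and "\<forall>x. q (x + 1) = q x"
    and "piecewise_cont_diff p" and "piecewise_cont q"
    and "p0 > 0" and "\<forall>x. p x \<ge> p0" and "p 0 = 1"
    and "l < r" and "Q = {l<..<r}"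
    and "\<epsilon>0 > 0"
    and "unif_bounded_ops 2 Q {0<..<\<epsilon>0} L"
    and "(\<exists>C. \<forall>\<epsilon> \<in> {0<..<\<epsilon>0}. \<forall>c d. c < d \<and> {c<..<d} \<subseteq> Q \<longrightarrow>
            (\<forall>u \<in> W2 2 Q. L2_norm {c<..<d} (L \<epsilon> u) \<le> C * W2_norm 2 {c<..<d} u))
       \<or> (\<exists>(a :: real \<Rightarrow> real \<Rightarrow> real) Lt.
            (\<forall>\<epsilon> \<in> {0<..<\<epsilon>0}. piecewise_cont_diff (a \<epsilon>) \<and> (\<forall>x. x \<notin> closure Q \<longrightarrow> a \<epsilon> x = 0)) \<and>
            ((\<lambda>\<epsilon>. \<epsilon> * max_abs_deriv (closure Q) (a \<epsilon>)) \<longlongrightarrow> 0) (at_right 0) \<and>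
            unif_bounded_ops 1 Q {0<..<\<epsilon>0} Lt \<and>
            (\<forall>\<epsilon> \<in> {0<..<\<epsilon>0}. \<forall>u \<in> W2 2 Q.
               AE x in lborel. x \<in> Q \<longrightarrow> L \<epsilon> u x = div_op Q (a \<epsilon>) u x + Lt \<epsilon> u x))"
  shows "\<forall>\<^sub>F \<epsilon> in at_right 0. \<forall>\<mu> \<in> cont_spectrum (W2 2 UNIV) (H_pert p q Q \<epsilon> (L \<epsilon>)).
           \<not> is_eigenvalue (W2 2 UNIV) (H_pert p q Q \<epsilon> (L \<epsilon>)) \<mu>"
proof -
  have W0: "0 \<le> W2_norm k S v" for k S v by (simp add: W2_norm_def sum_nonneg)
  have p_cont: "continuous_on UNIV p" using assms(3) by (simp add: piecewise_cont_diff_def)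
  obtain p' p1 where p': "p' \<in> borel_measurable borel" "\<forall>x. \<bar>p' x\<bar> \<le> p1"
    "antideriv UNIV (\<lambda>x. of_real (p x)) (\<lambda>x. of_real (p' x))"
    by (rule periodic_piecewise_cont_diff_primitive[OF assms(3) assms(1)[rule_format]])
  obtain q1 where q1: "\<And>x. x \<in> {0..1} \<Longrightarrow> \<bar>q x\<bar> \<le> q1"
    using piecewise_cont_bounded[OF assms(4) zero_le_one] by blast
  have "bounded (p ` {0..1})"
    by (rule compact_imp_bounded[OF compact_continuous_image[OF continuous_on_subset[OF p_cont]]]) simp_all
  then obtain pm where pm: "\<And>x. x \<in> {0..1} \<Longrightarrow> \<bar>p x\<bar> \<le> pm"
    unfolding bounded_iff real_norm_def by blast
  have p_le: "p x \<le> pm" for x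
    using periodic_bounded[of p pm x] assms(1) pm abs_ge_self[of "p x"] by fastforce
  interpret regular_sturm_liouville p q p0 q1 p' p1 pm
  proof
    show "q \<in> borel_measurable borel" by (rule piecewise_cont_measurable[OF assms(4)])
    show "\<bar>q x\<bar> \<le> q1" for x by (rule periodic_bounded) (use assms(2) q1 in auto)
  qed (use assms p' p_cont p_le in auto)
  have lr: "l < r" and Q: "Q = {l<..<r}" using assms by simp_all
  have clQ: "closure Q = {l..r}" using lr by (simp add: Q)
  have Qi: "is_interval Q" "open Q" by (simp_all add: Q is_interval_oo)
  obtain M0 where M0: "\<And>\<epsilon> u. \<epsilon> \<in> {0<..<\<epsilon>0} \<Longrightarrow> u \<in> W2 2 Q \<Longrightarrow> L2_norm Q (L \<epsilon> u) \<le> M0 * W2_norm 2 Q u"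
    using assms(11) unfolding unif_bounded_ops_def by blast
  define M where "M = max M0 0"
  have M: "0 \<le> M" by (simp add: M_def)
  have LQ: "L \<epsilon> u \<in> L2 Q" if "\<epsilon> \<in> {0<..<\<epsilon>0}" "u \<in> W2 2 Q" for \<epsilon> u
    using assms(11) that unfolding unif_bounded_ops_def linear_op_def by blast
  have LM: "L2_norm Q (L \<epsilon> u) \<le> M * W2_norm 2 Q u" if "\<epsilon> \<in> {0<..<\<epsilon>0}" "u \<in> W2 2 Q" for \<epsilon> u
    using M0[OF that] mult_right_mono[OF max.cobounded1[of M0 0] W0[of 2 Q u]] by (simp add: M_def)
  have reduce: "\<forall>\<mu> \<in> cont_spectrum (W2 2 UNIV) (H_pert p q Q \<epsilon> (L \<epsilon>)). \<not> is_eigenvalue (W2 2 UNIV) (H_pert p q Q \<epsilon> (L \<epsilon>)) \<mu>"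
    if e: "\<epsilon> \<in> {0<..<\<epsilon>0}" "\<epsilon> * M \<le> p0 / 2"
      and vanish: "\<And>\<mu> u U U1 u2 x. represents u U U1 u2 \<Longrightarrow> AE x in lborel. residual Q \<epsilon> (L \<epsilon>) \<mu> u x = 0 \<Longrightarrow>
        U l = 0 \<Longrightarrow> U r = 0 \<Longrightarrow> U1 l = 0 \<Longrightarrow> x \<in> {l..r} \<Longrightarrow> U x = 0" for \<epsilon>
  proof (intro ballI notI)
    fix \<mu> assume \<mu>: "\<mu> \<in> cont_spectrum (W2 2 UNIV) (H_pert p q Q \<epsilon> (L \<epsilon>))"
      and "is_eigenvalue (W2 2 UNIV) (H_pert p q Q \<epsilon> (L \<epsilon>)) \<mu>"
    then obtain u where u: "u \<in> W2 2 UNIV" "\<not> (AE x in lborel. u x = 0)"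
      and ev: "AE x in lborel. H_pert p q Q \<epsilon> (L \<epsilon>) u x = \<mu> * u x"
      unfolding is_eigenvalue_def by blast
    obtain U U1 u2 where R: "represents u U U1 u2" by (rule W2_2_represents[OF u(1)])
    have f: "AE x in lborel. residual Q \<epsilon> (L \<epsilon>) \<mu> u x = 0" using ev by (simp add: residual_def)
    have \<epsilon>: "0 \<le> \<epsilon>" using e by simp
    note out = eigenfunction_zero_outside[OF Q \<epsilon> M e(2) LQ[OF e(1)] LM[OF e(1)] \<mu> R f]
    have "U x = 0" for x
    proof (cases "x \<in> {l..r}")
      case True
      show ?thesis by (rule vanish[OF R f out(1) out(1) out(2) True]) (simp_all add: Q)
    next
      case False
      then show ?thesis by (intro out(1)) (auto simp: Q)
    qed
    moreover have "AE x in lborel. u x = U x" using R by (simp add: represents_def)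
    ultimately show False using u(2) by simp
  qed
  have ev_range: "\<forall>\<^sub>F \<epsilon> in at_right 0. \<epsilon> \<in> {0<..<\<epsilon>0}"
    unfolding eventually_at_right_field using assms(10) by (intro exI[of _ \<epsilon>0]) simp
  have lin0: "((\<lambda>\<epsilon>::real. \<epsilon> * c) \<longlongrightarrow> 0) (at_right 0)" for c :: real
    by (rule tendsto_eq_intros refl | simp)+
  have ev_lin: "\<forall>\<^sub>F \<epsilon> in at_right 0. \<epsilon> * c < b" if "0 < b" for b c :: real
    using order_tendstoD(2)[OF lin0 that] .
  have p02: "0 < p0 / 2" using p0 by simp
  from assms(12) show ?thesis
  proof
    assume "\<exists>C. \<forall>\<epsilon> \<in> {0<..<\<epsilon>0}. \<forall>c d. c < d \<and> {c<..<d} \<subseteq> Q \<longrightarrow>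
            (\<forall>u \<in> W2 2 Q. L2_norm {c<..<d} (L \<epsilon> u) \<le> C * W2_norm 2 {c<..<d} u)"
    then obtain C0 where C0: "\<And>\<epsilon> c d u. \<epsilon> \<in> {0<..<\<epsilon>0} \<Longrightarrow> c < d \<Longrightarrow> {c<..<d} \<subseteq> Q \<Longrightarrow> u \<in> W2 2 Q \<Longrightarrow>
        L2_norm {c<..<d} (L \<epsilon> u) \<le> C0 * W2_norm 2 {c<..<d} u" by blast
    define C where "C = max C0 0"
    have C: "0 \<le> C" by (simp add: C_def)
    show ?thesis
      using ev_range ev_lin[OF p02, of M] ev_lin[OF p02, of C]
    proof eventually_elim
      case (elim \<epsilon>)
      have \<epsilon>: "0 \<le> \<epsilon>" using elim by simp
      show ?case
      proof (rule reduce)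
        fix \<mu> u U U1 u2 x
        assume R: "represents u U U1 u2" and f: "AE x in lborel. residual Q \<epsilon> (L \<epsilon>) \<mu> u x = 0"
          and z: "U l = 0" "U1 l = 0" and x: "x \<in> {l..r}"
        note w = represents_restrict(1)[OF R Qi]
        show "U x = 0"
        proof (rule eigenfunction_zero_of_local_bound[where T = "L \<epsilon>", OF lr Q \<epsilon> C _ R f LQ[OF elim(1) w] _ z x])
          show "\<epsilon> * C \<le> p0 / 2" using elim by simp
          fix c d assume cd: "c < d" "{c<..<d} \<subseteq> Q"
          show "L2_norm {c<..<d} (L \<epsilon> (zero_ext Q u)) \<le> C * W2_norm 2 {c<..<d} (zero_ext Q u)"
            using C0[OF elim(1) cd w] mult_right_mono[OF max.cobounded1[of C0 0] W0[of 2 "{c<..<d}" "zero_ext Q u"]]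
            by (simp add: C_def)
        qed
      qed (use elim in simp_all)
    qed
  next
    assume "\<exists>(a :: real \<Rightarrow> real \<Rightarrow> real) Lt.
            (\<forall>\<epsilon> \<in> {0<..<\<epsilon>0}. piecewise_cont_diff (a \<epsilon>) \<and> (\<forall>x. x \<notin> closure Q \<longrightarrow> a \<epsilon> x = 0)) \<and>
            ((\<lambda>\<epsilon>. \<epsilon> * max_abs_deriv (closure Q) (a \<epsilon>)) \<longlongrightarrow> 0) (at_right 0) \<and>
            unif_bounded_ops 1 Q {0<..<\<epsilon>0} Lt \<and>
            (\<forall>\<epsilon> \<in> {0<..<\<epsilon>0}. \<forall>u \<in> W2 2 Q.
               AE x in lborel. x \<in> Q \<longrightarrow> L \<epsilon> u x = div_op Q (a \<epsilon>) u x + Lt \<epsilon> u x)"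
    then obtain a :: "real \<Rightarrow> real \<Rightarrow> real" and Lt where
      a: "\<And>\<epsilon>. \<epsilon> \<in> {0<..<\<epsilon>0} \<Longrightarrow> piecewise_cont_diff (a \<epsilon>)" "\<And>\<epsilon> x. \<epsilon> \<in> {0<..<\<epsilon>0} \<Longrightarrow> x \<notin> {l..r} \<Longrightarrow> a \<epsilon> x = 0"
      and lim: "((\<lambda>\<epsilon>. \<epsilon> * max_abs_deriv {l..r} (a \<epsilon>)) \<longlongrightarrow> 0) (at_right 0)"
      and Lt: "unif_bounded_ops 1 Q {0<..<\<epsilon>0} Lt"
      and dec: "\<And>\<epsilon> u. \<epsilon> \<in> {0<..<\<epsilon>0} \<Longrightarrow> u \<in> W2 2 Q \<Longrightarrow> AE x in lborel. x \<in> Q \<longrightarrow> L \<epsilon> u x = div_op Q (a \<epsilon>) u x + Lt \<epsilon> u x"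
      unfolding clQ by blast
    obtain N0 where N0: "\<And>\<epsilon> u. \<epsilon> \<in> {0<..<\<epsilon>0} \<Longrightarrow> u \<in> W2 1 Q \<Longrightarrow> L2_norm Q (Lt \<epsilon> u) \<le> N0 * W2_norm 1 Q u"
      using Lt unfolding unif_bounded_ops_def by blast
    define N where "N = max N0 0"
    have N: "0 \<le> N" by (simp add: N_def)
    have LtQ: "Lt \<epsilon> u \<in> L2 Q" if "\<epsilon> \<in> {0<..<\<epsilon>0}" "u \<in> W2 1 Q" for \<epsilon> u
      using Lt that unfolding unif_bounded_ops_def linear_op_def by blast
    have LtN: "L2_norm Q (Lt \<epsilon> u) \<le> N * W2_norm 1 Q u" if "\<epsilon> \<in> {0<..<\<epsilon>0}" "u \<in> W2 1 Q" for \<epsilon> u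
      using N0[OF that] mult_right_mono[OF max.cobounded1[of N0 0] W0[of 1 Q u]] by (simp add: N_def)
    define K where "K = exp (((2 * q1 + 3) * (1 / (p0 / 2) + 1) + (p1 + 1) / (p0 / 2)) * (r - l))"
    define K' where "K' = (r - l) * (1 / (p0 / 2) + 1 / (p0 / 2)\<^sup>2)"
    have "((\<lambda>\<epsilon>. 4 * (\<epsilon> * N)\<^sup>2 * K * K') \<longlongrightarrow> 4 * 0\<^sup>2 * K * K') (at_right 0)"
      by (intro tendsto_intros lin0)
    then have "((\<lambda>\<epsilon>. 4 * (\<epsilon> * N)\<^sup>2 * K * K') \<longlongrightarrow> 0) (at_right 0)" by simp
    from order_tendstoD(2)[OF this zero_less_one]
    have ev_sq: "\<forall>\<^sub>F \<epsilon> in at_right 0. 4 * (\<epsilon> * N)\<^sup>2 * K * K' < 1" .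
    have ev_a: "\<forall>\<^sub>F \<epsilon> in at_right 0. \<epsilon> * max_abs_deriv {l..r} (a \<epsilon>) < min 1 (p0 / 2 / (r - l))"
      using lr p0 by (intro order_tendstoD(2)[OF lim]) simp
    have ev_N: "\<forall>\<^sub>F \<epsilon> in at_right 0. \<epsilon> * N < min (p0 / 2) 1" by (rule ev_lin) (use p0 in simp)
    show ?thesis
      using ev_range ev_lin[OF p02, of M] ev_sq ev_a ev_N
    proof eventually_elim
      case (elim \<epsilon>)
      have \<epsilon>: "0 \<le> \<epsilon>" using elim by simp
      have a_small: "\<epsilon> * max_abs_deriv {l..r} (a \<epsilon>) \<le> 1" "\<epsilon> * max_abs_deriv {l..r} (a \<epsilon>) * (r - l) \<le> p0 / 2"
      proof -
        show "\<epsilon> * max_abs_deriv {l..r} (a \<epsilon>) \<le> 1" using elim by simp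
        have "\<epsilon> * max_abs_deriv {l..r} (a \<epsilon>) \<le> p0 / 2 / (r - l)" using elim by simp
        then show "\<epsilon> * max_abs_deriv {l..r} (a \<epsilon>) * (r - l) \<le> p0 / 2"
          by (subst (asm) pos_le_divide_eq) (use lr in simp_all)
      qed
      show ?case
      proof (rule reduce)
        fix \<mu> u U U1 u2 x
        assume R: "represents u U U1 u2" and f: "AE x in lborel. residual Q \<epsilon> (L \<epsilon>) \<mu> u x = 0"
          and z: "U l = 0" "U r = 0" "U1 l = 0" and x: "x \<in> {l..r}"
        note w = represents_restrict(1)[OF R Qi]
        show "U x = 0"
          by (rule eigenfunction_zero_of_divergence_form[where T = "L \<epsilon>" and Tt = "Lt \<epsilon>", OF lr Q \<epsilon> N a(1)[OF elim(1)] a(2)[OF elim(1)]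
              a_small R f LQ[OF elim(1) w] dec[OF elim(1) w] LtQ[OF elim(1)] LtN[OF elim(1)] elim(5) elim(3)[unfolded K_def K'_def] z x])
      qed (use elim in simp_all)
    qed
  qed
qed

end
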